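(* Let $f(z)=P_0(z)e^{Q_0(z)}+\cdots+P_n(z)e^{Q_n(z)}$ be an exponential polynomial of order $q\ge1$, where the $P_j\not\equiv 0$ and $Q_j$ are polynomials, the $Q_j$ are pairwise different with $Q_j(0)=0$, and, if one of the $Q_j$ vanishes identically, it is $Q_0$. Suppose that $f$ is written in the normalized form $f(z)=H_0(z)e^{w_0z^q}+H_1(z)e^{w_1z^q}+\cdots+H_m(z)e^{w_mz^q}$, where the coefficients $H_j$ are exponential polynomials of order $\rho(H_j)\le q-p$ for an integer $1\le p\le q$. Then, as $r\to\infty$: (i) If $H_0(z)\not\equiv0$, then $m\left(r,\frac1f\right)=O\left(r^{q-p}+\log r\right)$. (ii) If $Q_0(z)\equiv0$, then $m\left(r,\frac1f\right)=O(\log r)$. (iii) In all cases, $N\left(r,\frac1f\right)=C(\operatorname{co}(W_f))\frac{r^q}{2\pi}+O\left(r^{q-p}+\log r\right)$.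
   Context: Here $m(r,\cdot)$ and $N(r,\cdot)$ are the Nevanlinna proximity function and integrated counting function. The order of an exponential polynomial $P_0e^{Q_0}+\cdots+P_ne^{Q_n}$ is $\max_j\deg Q_j$; ordinary polynomials are exponential polynomials of order $0$. Every exponential polynomial of order $q\ge1$ can be written in the normalized form $f(z)=\sum_{j=0}^m H_j(z)e^{w_jz^q}$, where $w_0=0$, the leading coefficients $w_0,\ldots,w_m\in\mathbb{C}$ are pairwise distinct (so $w_j\ne0$ for $j\ge1$), $H_1,\ldots,H_m\not\equiv0$, and $H_0\equiv0$ precisely when $\deg Q_j=q$ for every $j$. If $p=q$ the $H_j$ are ordinary polynomials. $W_f=\{0,\overline{w}_1,\ldots,\overline{w}_m\}$ if $H_0\not\equiv0$, and $W_f=\{\overline{w}_1,\ldots,\overline{w}_m\}$ if $H_0\equiv0$. $\operatorname{co}(W_f)$ is the convex hull and $C(\operatorname{co}(W_f))$ is its circumference (perimeter); if the hull is a segment this is twice its length, and if it is a point this is $0$. *)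

theory Defs
  imports
    "HOL-Complex_Analysis.Complex_Analysis"
    "HOL-Library.Landau_Symbols"
begin

section \<open>Nevanlinna functions\<close>

definition log_plus :: "real \<Rightarrow> real" where
  "log_plus x = ln (max 1 x)"

text \<open>
  The value of \<open>g\<close> at its poles (0 for a quotient \<open>1 / f\<close>) is irrelevant here: a
  circle carries only finitely many poles of a meromorphic function.
\<close>
definition nev_proximity :: "(complex \<Rightarrow> complex) \<Rightarrow> real \<Rightarrow> real" where
  "nev_proximity g r =
     1 / (2 * pi) * integral {0..2 * pi} (\<lambda>t. log_plus (cmod (g (of_real r * cis t))))"

text \<open>Number of poles in the closed disc of radius \<open>r\<close>, with multiplicity.\<close>
definition nev_count :: "(complex \<Rightarrow> complex) \<Rightarrow> real \<Rightarrow> nat" where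
  "nev_count g r = (\<Sum>z | cmod z \<le> r \<and> is_pole g z. nat (- zorder g z))"

definition nev_counting :: "(complex \<Rightarrow> complex) \<Rightarrow> real \<Rightarrow> real" where
  "nev_counting g r =
     integral {0..r} (\<lambda>t. (real (nev_count g t) - real (nev_count g 0)) / t)
     + real (nev_count g 0) * ln r"

section \<open>Exponential polynomials\<close>

definition exp_poly :: "nat \<Rightarrow> (nat \<Rightarrow> complex poly) \<Rightarrow> (nat \<Rightarrow> complex poly) \<Rightarrow> complex \<Rightarrow> complex" where
  "exp_poly n P Q z = (\<Sum>j\<le>n. poly (P j) z * exp (poly (Q j) z))"

definition exp_poly_data :: "nat \<Rightarrow> (nat \<Rightarrow> complex poly) \<Rightarrow> (nat \<Rightarrow> complex poly) \<Rightarrow> bool" where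
  "exp_poly_data n P Q \<longleftrightarrow>
     (\<forall>j\<le>n. P j \<noteq> 0) \<and> inj_on Q {..n} \<and> (\<forall>j\<le>n. poly (Q j) 0 = 0) \<and>
     (\<forall>j\<le>n. Q j = 0 \<longrightarrow> j = 0)"

definition exp_poly_order :: "nat \<Rightarrow> (nat \<Rightarrow> complex poly) \<Rightarrow> nat" where
  "exp_poly_order n Q = Max ((\<lambda>j. degree (Q j)) ` {..n})"

text \<open>
  The order as a property of the function. The second disjunct only adds the zero
  function, which has no representation with nonzero coefficients \<open>P j\<close>.
\<close>
definition has_exp_poly_order :: "(complex \<Rightarrow> complex) \<Rightarrow> nat \<Rightarrow> bool" where
  "has_exp_poly_order g k \<longleftrightarrow>
     (\<exists>n P Q. exp_poly_data n P Q \<and> g = exp_poly n P Q \<and> exp_poly_order n Q = k) \<or>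
     (\<exists>R. g = poly R \<and> k = 0)"

text \<open>
  \<open>normalized_form n P Q q m H w\<close>: the exponential polynomial with data \<open>n, P, Q\<close>,
  of order \<open>q\<close>, equals the sum of the \<open>H j z * exp (w j * z ^ q)\<close> in normalized form.
\<close>
definition normalized_form ::
  "nat \<Rightarrow> (nat \<Rightarrow> complex poly) \<Rightarrow> (nat \<Rightarrow> complex poly) \<Rightarrow> nat \<Rightarrow>
   nat \<Rightarrow> (nat \<Rightarrow> complex \<Rightarrow> complex) \<Rightarrow> (nat \<Rightarrow> complex) \<Rightarrow> bool" where
  "normalized_form n P Q q m H w \<longleftrightarrow>
     exp_poly n P Q = (\<lambda>z. \<Sum>j\<le>m. H j z * exp (w j * z ^ q)) \<and>
     w 0 = 0 \<and> inj_on w {..m} \<and>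
     (\<forall>j\<in>{1..m}. H j \<noteq> (\<lambda>z. 0)) \<and>
     (H 0 = (\<lambda>z. 0) \<longleftrightarrow> (\<forall>j\<le>n. degree (Q j) = q))"

definition conj_leading_set ::
  "nat \<Rightarrow> (nat \<Rightarrow> complex \<Rightarrow> complex) \<Rightarrow> (nat \<Rightarrow> complex) \<Rightarrow> complex set" where
  "conj_leading_set m H w =
     (if H 0 = (\<lambda>z. 0) then (\<lambda>j. cnj (w j)) ` {1..m}
      else insert 0 ((\<lambda>j. cnj (w j)) ` {1..m}))"

section \<open>Circumference of a convex polygon\<close>

text \<open>
  Intended for polytopes in the plane. The diameter of an edge is its length; a segment is
  traversed twice, and a point gets \<open>0\<close>.
\<close>
definition circumference :: "complex set \<Rightarrow> real" where
  "circumference S =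
     (if aff_dim S \<le> 1 then 2 * diameter S else (\<Sum>e | e edge_of S. diameter e))"

end

theory Submission
  imports Defs "HOL-Computational_Algebra.Fundamental_Theorem_Algebra"
begin

text \<open>
  Write \<open>f = \<Sum>i. P i * exp (Q i)\<close>. The operator \<open>g \<mapsto> P k * g' - (P k' + P k * Q k') * g\<close> kills the
  \<open>k\<close>-th term and maps \<open>f\<close> to an exponential sum with one term fewer, at the cost of one
  logarithmic derivative. Since \<open>m(r, g'/g) = O(log r)\<close> for nonzero exponential sums, iterating gives
  \<open>m(r, exp (Q i) / f) = O(log r)\<close> for every \<open>i\<close>. This yields (ii) with \<open>Q i = 0\<close> and (i) with a
  \<open>Q i\<close> of degree at most \<open>q - p\<close>. It also shows that \<open>log \<bar>f\<bar>\<close> and \<open>max i. Re (Q i)\<close> have the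
  same mean over circles up to \<open>O(log r)\<close>. By Jensen's formula the former mean is \<open>N(r, 1/f)\<close> up to a
  constant. The latter is, up to \<open>O(r^(q - p))\<close>, the mean of \<open>r^q\<close> times the support function of
  \<open>co(W_f)\<close>, which Cauchy's formula expresses through the perimeter. Applied to the representation
  obtained by expanding the coefficients \<open>H j\<close>, this gives (i) and (iii) without any uniqueness of the
  representation of \<open>f\<close>.
\<close>

section \<open>Zeros and the logarithmic derivative\<close>

text \<open>The obstacle is the estimate of g'/g on every large circle, while zeros of g may lie on
  the circle or arbitrarily close to it. Dividing out the zeros in the disc of radius
  \<open>2 * r\<close> splits g'/g into a zero-free part, controlled by the Borel-Caratheodory
  inequality, and a sum of terms \<open>k a / (z - a)\<close>. Finite order makes both the bound and
  the number of zeros polynomial in \<open>r\<close>, so the logarithm leaves O(log r) for all large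
  \<open>r\<close>, without an exceptional set of radii. The singular terms are harmless because
  log-plus is compared with square roots, whose singularities are integrable uniformly in the
  position of \<open>a\<close>.

  Elimination must not destroy a surviving term: two different exponents that vanish at 0 have
  different derivatives, and a degree count then keeps every new coefficient nonzero.

  Jensen's formula is used only on circles free of zeros; the monotonicity of the counting function
  and the continuity of the bounds in \<open>r\<close> cover the other radii.\<close>

text \<open>The quotient by \<open>(z - a) ^ k\<close> is holomorphic off \<open>a\<close> and
  agrees with \<open>zor_poly g a\<close> near \<open>a\<close>; these two open sets cover the
  plane. Exponent 0 covers points that are not zeros.\<close>

lemma entire_factor_at:
  fixes g :: "complex \<Rightarrow> complex"
  assumes "g holomorphic_on UNIV" "g z0 \<noteq> 0"
  shows "\<exists>k h. h holomorphic_on UNIV \<and> h a \<noteq> 0 \<and> (\<forall>z. g z = (z - a) ^ k * h z)"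
proof -
  obtain r where r: "r > 0" "zor_poly g a holomorphic_on cball a r"
    "\<And>w. w \<in> cball a r \<Longrightarrow> g w = zor_poly g a w * (w - a) ^ nat (zorder g a) \<and> zor_poly g a w \<noteq> 0"
    using zorder_exist_zero[OF assms(1) open_UNIV connected_UNIV UNIV_I, of a] assms(2) by blast
  define k where "k = nat (zorder g a)"
  define h where "h = (\<lambda>z. if z = a then zor_poly g a a else g z / (z - a) ^ k)"
  have h_eq: "h w = zor_poly g a w" if "w \<in> ball a r" for w
    using r(3)[of w] that by (auto simp: h_def k_def)
  have "h holomorphic_on ball a r"
    using holomorphic_on_subset[OF r(2) ball_subset_cball] h_eq holomorphic_cong by metis
  moreover have "h holomorphic_on - {a}"
  proof (rule holomorphic_transform)
    show "(\<lambda>z. g z / (z - a) ^ k) holomorphic_on - {a}"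
      by (intro holomorphic_intros holomorphic_on_subset[OF assms(1)]) auto
  qed (auto simp: h_def)
  ultimately have "h holomorphic_on (ball a r \<union> - {a})"
    by (intro holomorphic_on_Un) auto
  moreover have "ball a r \<union> - {a} = UNIV"
    using r(1) by auto
  ultimately have "h holomorphic_on UNIV" by simp
  moreover have "h a \<noteq> 0"
    using r(1) r(3)[of a] by (simp add: h_def)
  moreover have "g z = (z - a) ^ k * h z" for z
    using r(1) r(3)[of a] by (cases "z = a") (auto simp: h_def k_def)
  ultimately show ?thesis by blast
qed

text \<open>One point is divided out at a time. The value at \<open>z0\<close> shows that each
  quotient is again not identically zero, and the factorization of \<open>h\<close> through
  \<open>h'\<close> keeps \<open>h'\<close> nonzero at the earlier points.\<close>

lemma entire_factor_zeros:
  fixes g :: "complex \<Rightarrow> complex"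
  assumes "finite S" "g holomorphic_on UNIV" "g z0 \<noteq> 0"
  shows "\<exists>k h. h holomorphic_on UNIV \<and> (\<forall>a\<in>S. h a \<noteq> 0) \<and> (\<forall>z. g z = (\<Prod>a\<in>S. (z - a) ^ k a) * h z)"
  using assms(1)
proof induction
  case empty
  then show ?case using assms by auto
next
  case (insert a S)
  then obtain k h where h: "h holomorphic_on UNIV" "\<forall>a\<in>S. h a \<noteq> 0"
    "\<And>z. g z = (\<Prod>a\<in>S. (z - a) ^ k a) * h z" by blast
  have "h z0 \<noteq> 0" using h(3)[of z0] assms(3) by auto
  then obtain l h' where h': "h' holomorphic_on UNIV" "h' a \<noteq> 0" "\<And>z. h z = (z - a) ^ l * h' z"
    using entire_factor_at[OF h(1), of z0 a] by blast
  have "g z = (\<Prod>b\<in>insert a S. (z - b) ^ (k(a := l)) b) * h' z" for z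
  proof -
    have "(\<Prod>b\<in>S. (z - b) ^ (k(a := l)) b) = (\<Prod>b\<in>S. (z - b) ^ k b)"
      using insert.hyps by (intro prod.cong) auto
    then show ?thesis using insert.hyps by (simp add: h h' mult_ac)
  qed
  moreover have "\<forall>b\<in>insert a S. h' b \<noteq> 0"
    using h(2) h'(2,3) by auto
  ultimately show ?case using h'(1) by blast
qed

lemma finite_zeros_cball:
  fixes g :: "complex \<Rightarrow> complex"
  assumes "g holomorphic_on UNIV" "g z0 \<noteq> 0"
  shows "finite {z \<in> cball 0 R. g z = 0}"
proof (cases "g constant_on UNIV")
  case True
  then have "{z \<in> cball 0 R. g z = 0} = {}" using assms(2) by (auto simp: constant_on_def)
  then show ?thesis by (metis finite.emptyI)
next
  case False
  from holomorphic_compact_finite_zeros[OF assms(1) open_UNIV connected_UNIV compact_cball subset_UNIV this]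
  show ?thesis .
qed

text \<open>The map \<open>u / (2 * M - u)\<close> takes the half-plane Re < \<open>M\<close> into
  the unit disc and fixes 0. Composed with \<open>u\<close> and rescaled by \<open>R\<close>, it
  satisfies the Schwarz lemma; solving for \<open>norm (u z)\<close> gives the estimate.\<close>

lemma Borel_Caratheodory:
  assumes holo: "u holomorphic_on ball 0 R" and u0: "u 0 = 0"
    and Re: "\<And>z. z \<in> ball 0 R \<Longrightarrow> Re (u z) < M" and z: "z \<in> ball 0 R"
  shows "norm (u z) * (R - norm z) \<le> 2 * M * norm z"
proof -
  have R: "R > 0" using z by (auto simp: dist_norm intro: le_less_trans[OF norm_ge_zero])
  have M: "M > 0" using Re[of 0] u0 R by simp
  define \<phi> where "\<phi> = (\<lambda>\<zeta>. u (of_real R * \<zeta>) / (2 * of_real M - u (of_real R * \<zeta>)))"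
  have in_ball: "of_real R * \<zeta> \<in> ball 0 R" if "norm \<zeta> < 1" for \<zeta> :: complex
    using that R by (simp add: norm_mult)
  \<comment> \<open>The point \<open>2 * M\<close> is the mirror image of 0 in the line Re =
    \<open>M\<close>, so values to the left of the line are closer to 0.\<close>
  have less: "norm (u w) < norm (2 * of_real M - u w)" if "w \<in> ball 0 R" for w
  proof -
    have "(norm (u w))\<^sup>2 < (norm (2 * of_real M - u w))\<^sup>2"
      unfolding cmod_power2 using Re[OF that] M by (simp add: power2_eq_square algebra_simps)
    then show ?thesis by (rule power_less_imp_less_base) simp
  qed
  have lt1: "norm (\<phi> \<zeta>) < 1" if "norm \<zeta> < 1" for \<zeta>
    using less[OF in_ball[OF that]] le_less_trans[OF norm_ge_zero less[OF in_ball[OF that]]]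
    by (simp add: \<phi>_def norm_divide divide_less_eq)
  have "(\<lambda>\<zeta>. u (of_real R * \<zeta>)) holomorphic_on ball 0 1"
    by (rule holomorphic_on_compose_gen[OF _ holo, unfolded o_def])
       (use in_ball in \<open>auto intro!: holomorphic_intros\<close>)
  then have "\<phi> holomorphic_on ball 0 1"
    unfolding \<phi>_def using less in_ball
    by (intro holomorphic_intros) (auto simp: dist_norm, fastforce)
  moreover define \<zeta> where "\<zeta> = z / of_real R"
  moreover have \<zeta>: "norm \<zeta> < 1" using z R by (simp add: \<zeta>_def norm_divide)
  ultimately have *: "norm (\<phi> \<zeta>) \<le> norm \<zeta>"
    using Schwarz_Lemma(1)[of \<phi> \<zeta>] lt1 u0 by (simp add: \<phi>_def)
  have R\<zeta>: "of_real R * \<zeta> = z" using R by (simp add: \<zeta>_def)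
  have "norm (u z) \<le> norm \<zeta> * norm (2 * of_real M - u z)"
    using * less[OF z] le_less_trans[OF norm_ge_zero less[OF z]]
    by (simp add: \<phi>_def R\<zeta> norm_divide divide_le_eq)
  also have "\<dots> \<le> norm \<zeta> * (2 * M + norm (u z))"
    using M norm_triangle_ineq4[of "2 * of_real M" "u z"] by (intro mult_left_mono) auto
  also have "norm \<zeta> = norm z / R" using R by (simp add: \<zeta>_def norm_divide)
  finally show ?thesis using R by (simp add: field_simps)
qed

text \<open>On the ball \<open>h = exp g\<close>, and \<open>u = g - g 0\<close> has real part below
  \<open>M\<close>. Borel-Caratheodory on radius \<open>3 * R / 4\<close> gives
  \<open>norm (u w) \<le> 6 * M\<close>; Cauchy's inequality on the circle of radius
  \<open>R / 4\<close> about \<open>z\<close> turns this into \<open>24 * M / R\<close> for the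
  derivative of \<open>u\<close>, which is h'/h.\<close>

lemma norm_logderiv_le_of_zero_free:
  assumes holo: "h holomorphic_on ball 0 R" and nz: "\<And>z. z \<in> ball 0 R \<Longrightarrow> h z \<noteq> 0"
    and bd: "\<And>z. z \<in> ball 0 R \<Longrightarrow> norm (h z) < norm (h 0) * exp M"
    and z: "norm z \<le> R / 2" and R: "R > 0"
  shows "norm (deriv h z / h z) \<le> 24 * M / R"
proof -
  obtain g where g: "g holomorphic_on ball 0 R" "\<And>z. z \<in> ball 0 R \<Longrightarrow> h z = exp (g z)"
    using contractible_imp_holomorphic_log[OF holo] nz convex_imp_contractible[OF convex_ball] by metis
  define u where "u = (\<lambda>z. g z - g 0)"
  have u: "u holomorphic_on ball 0 R" "u 0 = 0"
    unfolding u_def by (intro holomorphic_intros g) auto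
  have Re: "Re (u w) < M" if "w \<in> ball 0 R" for w
  proof -
    have "exp (Re (u w)) = norm (h w) / norm (h 0)"
      using g(2)[OF that] g(2)[of 0] R by (simp add: u_def exp_diff)
    also have "\<dots> < exp M"
      using bd[OF that] nz[of 0] R by (simp add: divide_less_eq mult_ac)
    finally show ?thesis by simp
  qed
  have M: "M > 0" using Re[of 0] u(2) R by simp
  have sub: "cball z (R/4) \<subseteq> ball 0 R"
  proof
    fix w assume "w \<in> cball z (R/4)"
    then have "norm (w - z) \<le> R/4" by (simp add: dist_norm norm_minus_commute)
    then show "w \<in> ball 0 R" using z R norm_triangle_ineq[of "w - z" z] by simp
  qed
  have B: "norm (u w) \<le> 6 * M" if "norm (z - w) = R/4" for w
  proof -
    have w: "norm w \<le> 3 * R / 4"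
      using z that norm_triangle_ineq[of "w - z" z] by (simp add: norm_minus_commute)
    have "norm (u w) * (R/4) \<le> norm (u w) * (R - norm w)"
      using w by (intro mult_left_mono) auto
    also have "\<dots> \<le> 2 * M * norm w"
      using Borel_Caratheodory[OF u Re, of w] w R by simp
    also have "\<dots> \<le> 2 * M * (3 * R / 4)"
      using w M by (intro mult_left_mono) auto
    finally show ?thesis using R by (simp add: field_simps)
  qed
  have "norm ((deriv ^^ 1) u z) \<le> fact 1 * (6 * M) / (R/4) ^ 1"
    by (intro Cauchy_inequality holomorphic_on_subset[OF u(1)] holomorphic_on_imp_continuous_on)
       (use sub B R ball_subset_cball[of z "R/4"] in auto)
  then have 1: "norm (deriv u z) \<le> 24 * M / R" by simp
  have zin: "z \<in> ball 0 R" using z R by simp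
  have gz: "(g has_field_derivative deriv g z) (at z)"
    using g(1) zin holomorphic_derivI open_ball by blast
  have "(u has_field_derivative deriv g z) (at z)"
    unfolding u_def using gz by (auto intro!: derivative_eq_intros)
  then have du: "deriv u z = deriv g z" by (rule DERIV_imp_deriv)
  have "((\<lambda>z. exp (g z)) has_field_derivative exp (g z) * deriv g z) (at z)"
    using gz by (auto intro!: derivative_eq_intros)
  then have "(h has_field_derivative exp (g z) * deriv g z) (at z)"
    using has_field_derivative_transform_within_open[OF _ open_ball zin] g(2) by metis
  then have "deriv h z = h z * deriv g z" using g(2)[OF zin] DERIV_imp_deriv by metis
  then show ?thesis using 1 du nz[OF zin] by simp
qed

lemma has_field_derivative_prod_powers:
  fixes k :: "complex \<Rightarrow> nat"
  assumes "finite S" "z \<notin> S"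
  shows "((\<lambda>z. \<Prod>a\<in>S. (z - a) ^ k a) has_field_derivative
           (\<Prod>a\<in>S. (z - a) ^ k a) * (\<Sum>a\<in>S. of_nat (k a) / (z - a))) (at z)"
  using assms
proof (induction S)
  case (insert a S)
  have "((\<lambda>z. (z - a) ^ k a) has_field_derivative (z - a) ^ k a * (of_nat (k a) / (z - a))) (at z)"
    by (rule derivative_eq_intros refl)+ (use insert.prems in \<open>cases "k a"; simp\<close>)
  from DERIV_mult[OF this insert.IH]
  show ?case using insert.prems insert.hyps by (simp add: algebra_simps)
qed simp

text \<open>Comparing \<open>R\<close> at the origin with \<open>3 * R\<close> on the circle of
  radius \<open>4 * R\<close> yields a factor \<open>3 ^ N\<close>, where \<open>N\<close> is the
  number of zeros with multiplicity. This factor bounds \<open>N\<close> by the growth of the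
  function, so the zero count does not rest on Jensen's formula.\<close>

lemma prod_diff_power_bounds:
  fixes k :: "complex \<Rightarrow> nat"
  assumes "finite S" "S \<subseteq> cball 0 R" "R \<ge> 0"
  shows "norm (\<Prod>a\<in>S. (0 - a) ^ k a) \<le> R ^ (\<Sum>a\<in>S. k a)"
    and "norm z = 4 * R \<Longrightarrow> norm (\<Prod>a\<in>S. (z - a) ^ k a) \<ge> (3 * R) ^ (\<Sum>a\<in>S. k a)"
proof -
  show "norm (\<Prod>a\<in>S. (0 - a) ^ k a) \<le> R ^ (\<Sum>a\<in>S. k a)"
    unfolding power_sum prod_norm[symmetric] norm_power
    using assms by (intro prod_mono conjI power_mono) auto
  have "3 * R \<le> norm (z - a)" if "norm z = 4 * R" "a \<in> S" for a
    using that assms(2) norm_triangle_ineq2[of z a] by auto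
  then show "norm (\<Prod>a\<in>S. (z - a) ^ k a) \<ge> (3 * R) ^ (\<Sum>a\<in>S. k a)" if "norm z = 4 * R"
    unfolding power_sum prod_norm[symmetric] norm_power
    using assms that by (intro prod_mono conjI power_mono) auto
qed

text \<open>With \<open>g\<close> equal to a product over the zeros in \<open>cball 0 R\<close>
  times \<open>h\<close>, the growth of \<open>g\<close> bounds both the number of these zeros and
  \<open>h\<close> relative to \<open>h 0\<close>. The logarithmic derivative of \<open>h\<close> is
  then at most \<open>24 * M / R\<close>, and the product contributes the explicit sum. Only the set
  \<open>S\<close> and the multiplicities depend on \<open>r\<close>.\<close>

lemma logderiv_pointwise_bound_nonzero:
  fixes g :: "complex \<Rightarrow> complex"
  assumes holo: "g holomorphic_on UNIV" and g0: "g 0 \<noteq> 0" and C: "C \<ge> 0"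
    and growth: "\<And>z. norm z \<ge> 1 \<Longrightarrow> norm (g z) \<le> exp (C * norm z ^ d)"
  shows "\<exists>K\<ge>0. \<forall>r\<ge>1. \<exists>S k. finite S \<and> real (\<Sum>a\<in>S. k a) \<le> K * r ^ d \<and>
       (\<forall>z. norm z = r \<and> g z \<noteq> 0 \<longrightarrow>
          norm (deriv g z / g z) \<le> K * r ^ d + (\<Sum>a\<in>S. real (k a) / norm (z - a)))"
proof -
  \<comment> \<open>The absolute value absorbs \<open>- ln (norm (g 0))\<close>; the summand 1 makes
    the later bound on \<open>h\<close> strict, as Borel-Caratheodory requires.\<close>
  define L where "L = \<bar>ln (norm (g 0))\<bar> + 1"
  \<comment> \<open>The factor 12 is \<open>24 / R\<close> with \<open>R = 2 * r\<close>, up to the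
    harmless division by \<open>r \<ge> 1\<close>; the power of 8 comes from the growth bound on the
    circle of radius \<open>4 * R = 8 * r\<close>.\<close>
  define K where "K = 12 * (C * 8 ^ d + L)"
  have L: "L \<ge> 1" by (simp add: L_def)
  have K: "K \<ge> 0" using C L by (simp add: K_def)
  have "\<exists>S k. finite S \<and> real (\<Sum>a\<in>S. k a) \<le> K * r ^ d \<and>
       (\<forall>z. norm z = r \<and> g z \<noteq> 0 \<longrightarrow>
          norm (deriv g z / g z) \<le> K * r ^ d + (\<Sum>a\<in>S. real (k a) / norm (z - a)))" if r: "r \<ge> 1" for r
  proof -
    define R where "R = 2 * r"
    define E where "E = C * (4 * R) ^ d"
    define M where "M = E + L"
    have R: "R > 0" "R \<ge> 2" using r by (auto simp: R_def)
    define S where "S = {z \<in> cball 0 R. g z = 0}"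
    have S: "finite S" "S \<subseteq> cball 0 R"
      unfolding S_def using finite_zeros_cball[OF holo g0] by auto
    obtain k h where h: "h holomorphic_on UNIV" "\<And>a. a \<in> S \<Longrightarrow> h a \<noteq> 0"
      and geq: "\<And>z. g z = (\<Prod>a\<in>S. (z - a) ^ k a) * h z"
      using entire_factor_zeros[OF S(1) holo g0] by blast
    define N where "N = (\<Sum>a\<in>S. k a)"
    have hnz: "h z \<noteq> 0" if "z \<in> cball 0 R" for z
      using h(2)[of z] geq[of z] that by (cases "g z = 0") (auto simp: S_def)
    have sph: "norm (h z) \<le> exp E / (3 * R) ^ N" if z: "norm z = 4 * R" for z
    proof -
      have "(3 * R) ^ N * norm (h z) \<le> norm (g z)"
        unfolding geq norm_mult N_def
        by (intro mult_right_mono prod_diff_power_bounds(2)) (use S R z in auto)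
      also have "\<dots> \<le> exp E" unfolding E_def using growth[of z] z R by simp
      finally show ?thesis using R by (simp add: field_simps)
    qed
    \<comment> \<open>The lower bound for the product of linear factors is available only on the
      circle of radius \<open>4 * R\<close>; the maximum principle carries the resulting bound for
      \<open>h\<close> inside.\<close>
    have hbd: "norm (h z) \<le> exp E / (3 * R) ^ N" if "norm z \<le> 4 * R" for z
    proof (rule maximum_modulus_frontier[of h "cball 0 (4 * R)"])
      show "h holomorphic_on interior (cball 0 (4 * R))" "continuous_on (closure (cball 0 (4 * R))) h"
        using h(1) holomorphic_on_subset holomorphic_on_imp_continuous_on continuous_on_subset by blast+
    qed (use that sph R in auto)
    have "norm (g 0) \<le> R ^ N * norm (h 0)"
      unfolding geq[of 0] norm_mult N_def
      by (intro mult_right_mono prod_diff_power_bounds(1)) (use S R in auto)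
    then have h0: "norm (g 0) / R ^ N \<le> norm (h 0)" using R by (simp add: field_simps)
    have "norm (g 0) / R ^ N \<le> exp E / (3 * R) ^ N"
      using h0 hbd[of 0] R by simp
    then have "norm (g 0) * 3 ^ N \<le> exp E"
      using R by (simp add: field_simps power_mult_distrib)
    then have "ln (norm (g 0) * 3 ^ N) \<le> E"
      using g0 by (metis ln_exp ln_le_cancel_iff exp_gt_zero mult_pos_pos zero_less_norm_iff zero_less_power zero_less_numeral)
    then have "real N * ln 3 \<le> E - ln (norm (g 0))"
      using g0 by (simp add: ln_mult ln_realpow)
    \<comment> \<open>Since e is at most 3, the base 3 bounds \<open>N\<close> itself and not just a
      multiple of it.\<close>
    moreover have "1 \<le> ln (3::real)"
      using exp_le ln_le_cancel_iff[of "exp 1" 3] by (simp del: ln_le_cancel_iff)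
    then have "real N * 1 \<le> real N * ln 3" by (intro mult_left_mono) auto
    ultimately have N: "real N \<le> M" by (simp add: M_def L_def)
    have rd: "1 \<le> r ^ d" using r by (rule one_le_power)
    have "M \<le> C * 8 ^ d * r ^ d + L * r ^ d"
      using mult_left_mono[OF rd, of L] L by (simp add: M_def E_def R_def power_mult_distrib)
    then have M: "12 * M \<le> K * r ^ d" by (simp add: K_def algebra_simps)
    have M0: "M \<ge> 0" using C R L by (simp add: M_def E_def)
    have hlt: "norm (h z) < norm (h 0) * exp M" if "z \<in> ball 0 R" for z
    proof -
      have "norm (h z) \<le> exp E / (3 * R) ^ N" using that R by (intro hbd) auto
      also have "\<dots> \<le> exp E / R ^ N"
        using R by (intro divide_left_mono power_mono) auto
      also have "\<dots> = norm (g 0) / R ^ N * (exp E / norm (g 0))" using g0 by simp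
      also have "\<dots> \<le> norm (h 0) * (exp E / norm (g 0))"
        by (intro mult_right_mono h0) auto
      also have "exp E / norm (g 0) = exp (E - ln (norm (g 0)))" using g0 by (simp add: exp_diff)
      also have "norm (h 0) * exp (E - ln (norm (g 0))) < norm (h 0) * exp M"
        using hnz[of 0] R by (simp add: M_def L_def)
      finally show ?thesis .
    qed
    have "norm (deriv g z / g z) \<le> K * r ^ d + (\<Sum>a\<in>S. real (k a) / norm (z - a))"
      if z: "norm z = r" "g z \<noteq> 0" for z
    proof -
      have zS: "z \<notin> S" using z by (simp add: S_def)
      have "norm (deriv h z / h z) \<le> 24 * M / R"
        using z R hnz hlt holomorphic_on_subset[OF h(1) subset_UNIV]
        by (intro norm_logderiv_le_of_zero_free[of h]) (auto simp: R_def)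
      also have "\<dots> = 12 * M / r" by (simp add: R_def)
      also have "\<dots> \<le> 12 * M" using M0 r mult_left_mono[OF r, of M] by (simp add: divide_le_eq)
      finally have 1: "norm (deriv h z / h z) \<le> K * r ^ d" using M by simp
      have "(h has_field_derivative deriv h z) (at z)"
        using h(1) holomorphic_derivI by blast
      from DERIV_mult[OF has_field_derivative_prod_powers[OF S(1) zS, of k] this]
      have "(g has_field_derivative
          (\<Prod>a\<in>S. (z - a) ^ k a) * (\<Sum>a\<in>S. of_nat (k a) / (z - a)) * h z +
          deriv h z * (\<Prod>a\<in>S. (z - a) ^ k a)) (at z)" by (simp only: geq[symmetric])
      then have "deriv g z = (\<Prod>a\<in>S. (z - a) ^ k a) * (\<Sum>a\<in>S. of_nat (k a) / (z - a)) * h z +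
          deriv h z * (\<Prod>a\<in>S. (z - a) ^ k a)"
        by (rule DERIV_imp_deriv)
      then have "deriv g z / g z = deriv h z / h z + (\<Sum>a\<in>S. of_nat (k a) / (z - a))"
        using z geq[of z] by (simp add: field_simps)
      also have "norm \<dots> \<le> norm (deriv h z / h z) + (\<Sum>a\<in>S. norm (of_nat (k a) / (z - a)))"
        by (intro norm_triangle_le add_mono norm_sum order_refl)
      finally show ?thesis using 1 by (simp add: norm_divide)
    qed
    moreover have "real (\<Sum>a\<in>S. k a) \<le> K * r ^ d" using N M M0 by (simp add: N_def)
    ultimately show ?thesis using S(1) by blast
  qed
  with K show ?thesis by blast
qed

text \<open>A zero of order \<open>m\<close> at the origin adds \<open>m / z\<close> to the
  logarithmic derivative, of norm at most \<open>m\<close> when \<open>r \<ge> 1\<close>. Dividing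
  by \<open>z ^ m\<close> preserves the growth bound, because that bound is only claimed for
  \<open>norm z \<ge> 1\<close>.\<close>

lemma logderiv_pointwise_bound:
  fixes g :: "complex \<Rightarrow> complex"
  assumes holo: "g holomorphic_on UNIV" and z0: "g z0 \<noteq> 0" and C: "C \<ge> 0"
    and growth: "\<And>z. norm z \<ge> 1 \<Longrightarrow> norm (g z) \<le> exp (C * norm z ^ d)"
  shows "\<exists>K\<ge>0. \<forall>r\<ge>1. \<exists>S k. finite S \<and> real (\<Sum>a\<in>S. k a) \<le> K * r ^ d \<and>
       (\<forall>z. norm z = r \<and> g z \<noteq> 0 \<longrightarrow>
          norm (deriv g z / g z) \<le> K * r ^ d + (\<Sum>a\<in>S. real (k a) / norm (z - a)))"
proof -
  obtain m h where h: "h holomorphic_on UNIV" "h 0 \<noteq> 0" and geq: "\<And>z. g z = (z - 0) ^ m * h z"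
    using entire_factor_at[OF holo z0, of 0] by blast
  have "norm (h z) \<le> exp (C * norm z ^ d)" if "norm z \<ge> 1" for z
  proof -
    have "1 * norm (h z) \<le> norm z ^ m * norm (h z)"
      using that by (intro mult_right_mono one_le_power) auto
    also have "\<dots> = norm (g z)" by (simp add: geq norm_mult norm_power)
    finally show ?thesis using growth[OF that] by simp
  qed
  from logderiv_pointwise_bound_nonzero[OF h C this]
  obtain K where K: "K \<ge> 0" and
    bd: "\<forall>r\<ge>1. \<exists>S k. finite S \<and> real (\<Sum>a\<in>S. k a) \<le> K * r ^ d \<and>
       (\<forall>z. norm z = r \<and> h z \<noteq> 0 \<longrightarrow>
          norm (deriv h z / h z) \<le> K * r ^ d + (\<Sum>a\<in>S. real (k a) / norm (z - a)))"
    by blast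
  have "\<exists>S k. finite S \<and> real (\<Sum>a\<in>S. k a) \<le> (K + real m) * r ^ d \<and>
       (\<forall>z. norm z = r \<and> g z \<noteq> 0 \<longrightarrow>
          norm (deriv g z / g z) \<le> (K + real m) * r ^ d + (\<Sum>a\<in>S. real (k a) / norm (z - a)))"
    if r: "r \<ge> 1" for r
  proof -
    obtain S k where S: "finite S" "real (\<Sum>a\<in>S. k a) \<le> K * r ^ d"
      and Sb: "\<forall>z. norm z = r \<and> h z \<noteq> 0 \<longrightarrow>
          norm (deriv h z / h z) \<le> K * r ^ d + (\<Sum>a\<in>S. real (k a) / norm (z - a))"
      using bd[THEN spec, THEN mp, OF r] by (elim exE conjE)
    have rd: "real m \<le> real m * r ^ d" using mult_left_mono[OF one_le_power[OF r], of "real m"] by simp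
    have "norm (deriv g z / g z) \<le> (K + real m) * r ^ d + (\<Sum>a\<in>S. real (k a) / norm (z - a))"
      if z: "norm z = r" "g z \<noteq> 0" for z
    proof -
      have z0: "z \<noteq> 0" using z r by auto
      have "(h has_field_derivative deriv h z) (at z)"
        using h(1) holomorphic_derivI by blast
      from DERIV_mult[OF has_field_derivative_prod_powers[of "{0}" z "\<lambda>_. m"] this]
      have "((\<lambda>z. (z - 0) ^ m * h z) has_field_derivative
           z ^ m * (of_nat m / z) * h z + deriv h z * z ^ m) (at z)" using z0 by simp
      then have "(g has_field_derivative z ^ m * (of_nat m / z) * h z + deriv h z * z ^ m) (at z)"
        by (simp only: geq[symmetric])
      then have "deriv g z = z ^ m * (of_nat m / z) * h z + deriv h z * z ^ m"
        by (rule DERIV_imp_deriv)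
      then have "deriv g z / g z = deriv h z / h z + of_nat m / z"
        using z geq[of z] z0 by (simp add: field_simps)
      also have "norm \<dots> \<le> norm (deriv h z / h z) + norm (of_nat m / z)" by (rule norm_triangle_ineq)
      also have "norm (of_nat m / z) \<le> real m"
        using z r mult_left_mono[OF r, of "real m"] by (simp add: norm_divide divide_le_eq)
      finally show ?thesis using Sb[THEN spec, of z] z geq[of z] rd by (simp add: algebra_simps)
    qed
    moreover have "real (\<Sum>a\<in>S. k a) \<le> (K + real m) * r ^ d" using S(2) rd by (simp add: algebra_simps)
    ultimately show ?thesis using S(1) by blast
  qed
  moreover have "K + real m \<ge> 0" using K by simp
  ultimately show ?thesis by blast
qed

section \<open>Integral means over circles\<close>

lemma log_plus_nonneg: "log_plus x \<ge> 0"
  by (simp add: log_plus_def)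

lemma log_plus_mono: "x \<le> y \<Longrightarrow> log_plus x \<le> log_plus y"
  by (simp add: log_plus_def)

lemma ln_le_log_plus: "x > 0 \<Longrightarrow> ln x \<le> log_plus x"
  by (simp add: log_plus_def)

lemma log_plus_mult: "x \<ge> 0 \<Longrightarrow> y \<ge> 0 \<Longrightarrow> log_plus (x * y) \<le> log_plus x + log_plus y"
proof -
  assume "x \<ge> 0" "y \<ge> 0"
  then have "x * y \<le> max 1 x * max 1 y" by (intro mult_mono) auto
  moreover have "1 * 1 \<le> max 1 x * max 1 y" by (intro mult_mono) auto
  ultimately have "max 1 (x * y) \<le> max 1 x * max 1 y" by simp
  then have "ln (max 1 (x * y)) \<le> ln (max 1 x * max 1 y)"
    by (intro ln_mono) auto
  also have "\<dots> = ln (max 1 x) + ln (max 1 y)"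
    by (simp add: ln_mult max_def)
  finally show ?thesis by (simp add: log_plus_def)
qed

lemma log_plus_add: "log_plus (x + y) \<le> ln 2 + log_plus x + log_plus y"
proof -
  have "max 1 (x + y) \<le> 2 * max (max 1 x) (max 1 y)" by auto
  also have "\<dots> \<le> 2 * (max 1 x * max 1 y)"
    using mult_mono[of "max 1 x" "max 1 x" 1 "max 1 y"] mult_mono[of 1 "max 1 x" "max 1 y" "max 1 y"]
    by (intro mult_left_mono max.boundedI) auto
  finally have "ln (max 1 (x + y)) \<le> ln (2 * (max 1 x * max 1 y))"
    by (intro ln_mono) auto
  also have "\<dots> = ln 2 + (ln (max 1 x) + ln (max 1 y))"
    by (simp add: ln_mult max_def)
  finally show ?thesis by (simp add: log_plus_def)
qed

lemma log_plus_exp: "log_plus (exp x) = max 0 x"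
  by (auto simp: log_plus_def max_def)

text \<open>
  The proximity integrals are controlled through integrable majorants, so that no
  integrability of \<open>\<phi>\<close> itself is ever needed.
\<close>
definition circle_mean_bound :: "(complex \<Rightarrow> real) \<Rightarrow> (real \<Rightarrow> real) \<Rightarrow> bool" where
  "circle_mean_bound \<phi> B \<longleftrightarrow>
     (\<exists>C r0. \<forall>r\<ge>r0. \<exists>\<psi> I T. finite T \<and> (\<psi> has_integral I) {0..2*pi} \<and> I \<le> C * B r \<and>
        (\<forall>t\<in>{0..2*pi} - T. \<phi> (of_real r * cis t) \<le> \<psi> t))"

lemma circle_mean_bound_add:
  assumes "circle_mean_bound \<phi> B" "circle_mean_bound \<phi>' B"
  shows "circle_mean_bound (\<lambda>z. \<phi> z + \<phi>' z) B"
proof -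
  obtain C r0 where C: "\<forall>r\<ge>r0. \<exists>\<psi> I T. finite T \<and> (\<psi> has_integral I) {0..2*pi} \<and> I \<le> C * B r \<and>
        (\<forall>t\<in>{0..2*pi} - T. \<phi> (of_real r * cis t) \<le> \<psi> t)"
    using assms(1) unfolding circle_mean_bound_def by blast
  obtain C' r0' where C': "\<forall>r\<ge>r0'. \<exists>\<psi> I T. finite T \<and> (\<psi> has_integral I) {0..2*pi} \<and> I \<le> C' * B r \<and>
        (\<forall>t\<in>{0..2*pi} - T. \<phi>' (of_real r * cis t) \<le> \<psi> t)"
    using assms(2) unfolding circle_mean_bound_def by blast
  have "\<exists>\<psi> I T. finite T \<and> (\<psi> has_integral I) {0..2*pi} \<and> I \<le> (C + C') * B r \<and>
        (\<forall>t\<in>{0..2*pi} - T. \<phi> (of_real r * cis t) + \<phi>' (of_real r * cis t) \<le> \<psi> t)"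
    if r: "r \<ge> max r0 r0'" for r
  proof -
    have "r \<ge> r0" "r \<ge> r0'" using r by auto
    with C C' obtain \<psi> I T \<psi>' I' T' where
      "finite T" "(\<psi> has_integral I) {0..2*pi}" "I \<le> C * B r"
      "\<forall>t\<in>{0..2*pi} - T. \<phi> (of_real r * cis t) \<le> \<psi> t"
      "finite T'" "(\<psi>' has_integral I') {0..2*pi}" "I' \<le> C' * B r"
      "\<forall>t\<in>{0..2*pi} - T'. \<phi>' (of_real r * cis t) \<le> \<psi>' t" by metis
    then show ?thesis
      by (intro exI[of _ "\<lambda>t. \<psi> t + \<psi>' t"] exI[of _ "I + I'"] exI[of _ "T \<union> T'"])
         (force intro!: has_integral_add simp: distrib_right add_mono)
  qed
  then show ?thesis unfolding circle_mean_bound_def by blast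
qed

lemma circle_mean_bound_mono:
  assumes "circle_mean_bound \<phi> B"
    and "\<And>r. r \<ge> R \<Longrightarrow> \<exists>T. finite T \<and> (\<forall>t\<in>{0..2*pi} - T. \<phi>' (of_real r * cis t) \<le> \<phi> (of_real r * cis t))"
  shows "circle_mean_bound \<phi>' B"
proof -
  obtain C r0 where C: "\<forall>r\<ge>r0. \<exists>\<psi> I T. finite T \<and> (\<psi> has_integral I) {0..2*pi} \<and> I \<le> C * B r \<and>
        (\<forall>t\<in>{0..2*pi} - T. \<phi> (of_real r * cis t) \<le> \<psi> t)"
    using assms(1) unfolding circle_mean_bound_def by blast
  have "\<exists>\<psi> I T. finite T \<and> (\<psi> has_integral I) {0..2*pi} \<and> I \<le> C * B r \<and>
        (\<forall>t\<in>{0..2*pi} - T. \<phi>' (of_real r * cis t) \<le> \<psi> t)"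
    if r: "r \<ge> max r0 R" for r
  proof -
    have "r \<ge> r0" using r by auto
    with C obtain \<psi> I T where 1:
      "finite T" "(\<psi> has_integral I) {0..2*pi}" "I \<le> C * B r"
      "\<forall>t\<in>{0..2*pi} - T. \<phi> (of_real r * cis t) \<le> \<psi> t" by metis
    obtain T' where 2: "finite T'" "\<forall>t\<in>{0..2*pi} - T'. \<phi>' (of_real r * cis t) \<le> \<phi> (of_real r * cis t)"
      using assms(2)[of r] r by auto
    have "\<forall>t\<in>{0..2*pi} - (T \<union> T'). \<phi>' (of_real r * cis t) \<le> \<psi> t"
      using 1(4) 2(2) by (meson DiffD1 DiffD2 DiffI UnI1 UnI2 order_trans)
    then show ?thesis using 1 2 by (meson finite_UnI)
  qed
  then show ?thesis unfolding circle_mean_bound_def by blast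
qed

lemma circle_mean_bound_const:
  assumes "\<And>z. norm z \<ge> R \<Longrightarrow> \<phi> z \<le> C * B (norm z)"
  shows "circle_mean_bound \<phi> B"
  unfolding circle_mean_bound_def
proof (rule exI[of _ "2 * pi * C"], rule exI[of _ "max R 0"], intro allI impI)
  fix r assume r: "r \<ge> max R 0"
  have "((\<lambda>t. C * B r) has_integral (2 * pi * C * B r)) {0..2*pi}"
    using has_integral_const_real[of "C * B r" 0 "2 * pi"] by (simp add: mult.assoc)
  moreover have "\<phi> (of_real r * cis t) \<le> C * B r" for t
    using assms[of "of_real r * cis t"] r by (simp add: norm_mult)
  ultimately show "\<exists>\<psi> I T. finite T \<and> (\<psi> has_integral I) {0..2*pi} \<and> I \<le> 2 * pi * C * B r \<and>
        (\<forall>t\<in>{0..2*pi} - T. \<phi> (of_real r * cis t) \<le> \<psi> t)"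
    by (intro exI[of _ "\<lambda>t. C * B r"] exI[of _ "2 * pi * C * B r"] exI[of _ "{}"]) auto
qed

lemma circle_mean_bound_weaken:
  assumes "circle_mean_bound \<phi> B" "\<And>z. \<phi> z \<ge> 0" "\<And>r. r \<ge> R \<Longrightarrow> 0 \<le> B r \<and> B r \<le> B' r"
  shows "circle_mean_bound \<phi> B'"
proof -
  obtain C r0 where C: "\<forall>r\<ge>r0. \<exists>\<psi> I T. finite T \<and> (\<psi> has_integral I) {0..2*pi} \<and> I \<le> C * B r \<and>
        (\<forall>t\<in>{0..2*pi} - T. \<phi> (of_real r * cis t) \<le> \<psi> t)"
    using assms(1) unfolding circle_mean_bound_def by blast
  have "\<exists>\<psi> I T. finite T \<and> (\<psi> has_integral I) {0..2*pi} \<and> I \<le> max C 0 * B' r \<and>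
        (\<forall>t\<in>{0..2*pi} - T. \<phi> (of_real r * cis t) \<le> \<psi> t)"
    if r: "r \<ge> max r0 R" for r
  proof -
    have "r \<ge> r0" using r by auto
    with C obtain \<psi> I T where 1:
      "finite T" "(\<psi> has_integral I) {0..2*pi}" "I \<le> C * B r"
      "\<forall>t\<in>{0..2*pi} - T. \<phi> (of_real r * cis t) \<le> \<psi> t" by metis
    \<comment> \<open>The constant \<open>C\<close> may be negative, in which case enlarging
      \<open>B\<close> would decrease the bound; hence \<open>max C 0\<close>.\<close>
    have "C * B r \<le> max C 0 * B' r"
      using assms(3)[of r] r by (intro mult_mono) auto
    then show ?thesis using 1 by (meson order_trans)
  qed
  then show ?thesis unfolding circle_mean_bound_def by blast
qed

text \<open>If \<open>\<phi>\<close> is not integrable, its integral is 0 by convention, and the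
  claim reduces to \<open>0 \<le> I\<close>. This follows because the majorant is nonnegative off
  the finite set \<open>T\<close>, where its values can be reset without changing the
  integral.\<close>

lemma integral_le_of_majorant:
  fixes \<phi> \<psi> :: "real \<Rightarrow> real"
  assumes "finite T" "(\<psi> has_integral I) {a..b}" "\<And>t. t \<in> {a..b} - T \<Longrightarrow> \<phi> t \<le> \<psi> t" "\<And>t. \<phi> t \<ge> 0"
  shows "integral {a..b} \<phi> \<le> I"
proof -
  have nonneg: "0 \<le> I"
  proof (rule has_integral_nonneg)
    show "((\<lambda>t. if t \<in> T then 0 else \<psi> t) has_integral I) {a..b}"
      by (rule has_integral_spike_finite[OF assms(1) _ assms(2)]) auto
    show "0 \<le> (if t \<in> T then 0 else \<psi> t)" if "t \<in> {a..b}" for t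
      using assms(3,4)[of t] that by (auto intro: order_trans)
  qed
  show ?thesis
  proof (cases "\<phi> integrable_on {a..b}")
    case True
    have "((\<lambda>t. if t \<in> T then \<phi> t else \<psi> t) has_integral I) {a..b}"
      by (rule has_integral_spike_finite[OF assms(1) _ assms(2)]) auto
    with integrable_integral[OF True] show ?thesis
      by (rule has_integral_le) (use assms(3) in auto)
  qed (use nonneg in \<open>simp add: not_integrable_integral\<close>)
qed

lemma circle_mean_bound_imp_integral:
  assumes "circle_mean_bound \<phi> B" "\<And>z. \<phi> z \<ge> 0"
  shows "\<exists>C r0. \<forall>r\<ge>r0. integral {0..2*pi} (\<lambda>t. \<phi> (of_real r * cis t)) \<le> C * B r"
proof -
  obtain C r0 where C: "\<forall>r\<ge>r0. \<exists>\<psi> I T. finite T \<and> (\<psi> has_integral I) {0..2*pi} \<and> I \<le> C * B r \<and>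
        (\<forall>t\<in>{0..2*pi} - T. \<phi> (of_real r * cis t) \<le> \<psi> t)"
    using assms(1) unfolding circle_mean_bound_def by blast
  have "integral {0..2*pi} (\<lambda>t. \<phi> (of_real r * cis t)) \<le> C * B r" if "r \<ge> r0" for r
  proof -
    obtain \<psi> I T where 1:
      "finite T" "(\<psi> has_integral I) {0..2*pi}" "I \<le> C * B r"
      "\<forall>t\<in>{0..2*pi} - T. \<phi> (of_real r * cis t) \<le> \<psi> t" using C \<open>r \<ge> r0\<close> by metis
    have "integral {0..2*pi} (\<lambda>t. \<phi> (of_real r * cis t)) \<le> I"
      by (rule integral_le_of_majorant[OF 1(1,2)]) (use 1(4) assms(2) in auto)
    then show ?thesis using 1(3) by simp
  qed
  then show ?thesis by blast
qed

text \<open>The primitive \<open>2 * sgn (t - c) * sqrt \<bar>t - c\<bar>\<close> is continuous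
  across the singularity, so the fundamental theorem applies with \<open>c\<close> as its only
  exceptional point, wherever \<open>c\<close> lies.\<close>

lemma has_integral_inverse_sqrt:
  fixes a b c :: real
  assumes "a \<le> b"
  shows "((\<lambda>t. 1 / sqrt \<bar>t - c\<bar>) has_integral
           (2 * sgn (b - c) * sqrt \<bar>b - c\<bar> - 2 * sgn (a - c) * sqrt \<bar>a - c\<bar>)) {a..b}"
proof (rule fundamental_theorem_of_calculus_interior_strong[where S = "{c}"])
  show "((\<lambda>x. 2 * sgn (x - c) * sqrt \<bar>x - c\<bar>) has_vector_derivative 1 / sqrt \<bar>x - c\<bar>) (at x)"
    if x: "x \<in> {a<..<b} - {c}" for x
  proof (cases "x > c")
    case True
    have "((\<lambda>x. 2 * sqrt (x - c)) has_real_derivative 1 / sqrt \<bar>x - c\<bar>) (at x)"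
      using True by (auto intro!: derivative_eq_intros simp: field_simps)
    then have "((\<lambda>x. 2 * sgn (x - c) * sqrt \<bar>x - c\<bar>) has_real_derivative 1 / sqrt \<bar>x - c\<bar>) (at x)"
      by (rule has_field_derivative_transform_within_open[where S = "{c<..}"]) (use True in auto)
    then show ?thesis by (simp add: has_real_derivative_iff_has_vector_derivative)
  next
    case False
    then have lt: "x < c" using x by auto
    have "((\<lambda>x. - 2 * sqrt (c - x)) has_real_derivative 1 / sqrt \<bar>x - c\<bar>) (at x)"
      using lt by (auto intro!: derivative_eq_intros simp: field_simps)
    then have "((\<lambda>x. 2 * sgn (x - c) * sqrt \<bar>x - c\<bar>) has_real_derivative 1 / sqrt \<bar>x - c\<bar>) (at x)"
      by (rule has_field_derivative_transform_within_open[where S = "{..<c}"]) (use lt in auto)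
    then show ?thesis by (simp add: has_real_derivative_iff_has_vector_derivative)
  qed
  have eq: "2 * sgn (x - c) * sqrt \<bar>x - c\<bar> = 2 * sqrt (max (x - c) 0) - 2 * sqrt (max (c - x) 0)" for x
    by (auto simp: sgn_if max_def)
  show "continuous_on {a..b} (\<lambda>x. 2 * sgn (x - c) * sqrt \<bar>x - c\<bar>)"
    unfolding eq by (intro continuous_intros)
qed (use assms in auto)

text \<open>Jordan's inequality: the sine is concave on the interval and lies above its
  chord.\<close>

lemma sin_ge_linear:
  assumes "0 \<le> x" "x \<le> pi / 2"
  shows "sin x \<ge> 2 / pi * x"
proof -
  have "convex_on {0..pi/2} (\<lambda>x. - sin x)"
    by (rule f''_ge0_imp_convex[where f' = "\<lambda>x. - cos x" and f'' = sin])
       (auto intro!: derivative_eq_intros sin_ge_zero)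
  from convex_onD[OF this, of "2 / pi * x" 0 "pi / 2"] show ?thesis
    using assms by (simp add: field_simps)
qed

text \<open>
  Since \<open>norm (r * cis t - a) \<ge> r * \<bar>sin (t - Arg a)\<bar>\<close>, the distance is bounded below, uniformly
  in \<open>a\<close>, by a multiple of the distance of \<open>t\<close> to \<open>Arg a + pi * \<int>\<close>.
\<close>
lemma inverse_sqrt_dist_majorant:
  obtains C where "C \<ge> 0"
    "\<And>a r. r \<ge> 1 \<Longrightarrow> \<exists>\<psi> I T. finite T \<and> (\<psi> has_integral I) {0..2*pi} \<and> I \<le> C \<and>
       (\<forall>t\<in>{0..2*pi} - T. 1 / sqrt (norm (of_real r * cis t - a)) \<le> \<psi> t)"
proof -
  \<comment> \<open>Five singular terms, each with integral at most \<open>4 * sqrt (8 * pi)\<close>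
    by a crude bound on the distances to the singularities; \<open>sqrt (pi / 2)\<close> is the
    inverse square root of the slope in Jordan's inequality.\<close>
  define C where "C = sqrt (pi / 2) * (5 * (4 * sqrt (8 * pi)))"
  have "\<exists>\<psi> I T. finite T \<and> (\<psi> has_integral I) {0..2*pi} \<and> I \<le> C \<and>
       (\<forall>t\<in>{0..2*pi} - T. 1 / sqrt (norm (of_real r * cis t - a)) \<le> \<psi> t)" if r: "r \<ge> 1" for r a
  proof -
    define \<theta> where "\<theta> = Arg a"
    have \<theta>: "- pi < \<theta>" "\<theta> \<le> pi" by (auto simp: \<theta>_def Arg_bounded mpi_less_Arg Arg_le_pi)
    \<comment> \<open>The difference \<open>t - \<theta>\<close> lies in the interval from
      \<open>-pi\<close> (included) to \<open>3 * pi\<close> (excluded), so the multiple of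
      \<open>pi\<close> nearest to it has an index between -1 and 3.\<close>
    define c where "c = (\<lambda>k::int. \<theta> + of_int k * pi)"
    define F where "F = (\<lambda>k x. 2 * sgn (x - c k) * sqrt \<bar>x - c k\<bar>)"
    define \<psi> where "\<psi> = (\<lambda>t. sqrt (pi / 2) * (\<Sum>k\<in>{-1..3}. 1 / sqrt \<bar>t - c k\<bar>))"
    define T where "T = c ` {-1..3}"
    have "(\<psi> has_integral sqrt (pi / 2) * (\<Sum>k\<in>{-1..3}. F k (2 * pi) - F k 0)) {0..2*pi}"
      unfolding \<psi>_def F_def
      by (intro has_integral_mult_right has_integral_sum has_integral_inverse_sqrt) auto
    moreover have "sqrt (pi / 2) * (\<Sum>k\<in>{-1..3}. F k (2 * pi) - F k 0) \<le> C"
    proof -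
      have ab: "\<bar>F k x\<bar> \<le> 2 * sqrt (8 * pi)" if "k \<in> {-1..3}" "x \<in> {0..2*pi}" for k x
      proof -
        have "of_int k * pi \<le> 3 * pi" "- 1 * pi \<le> of_int k * pi"
          using that mult_right_mono[of "-1" "of_int k" pi] by (auto intro!: mult_right_mono)
        then have "\<bar>x - c k\<bar> \<le> 8 * pi"
          using that(2) \<theta> unfolding c_def atLeastAtMost_iff abs_le_iff by linarith
        then have "sqrt \<bar>x - c k\<bar> \<le> sqrt (8 * pi)" by simp
        then show ?thesis by (auto simp: F_def abs_mult sgn_if)
      qed
      have "F k (2 * pi) - F k 0 \<le> 4 * sqrt (8 * pi)" if "k \<in> {-1..3}" for k
        using ab[OF that, of 0] ab[OF that, of "2*pi"] by auto
      then have "(\<Sum>k\<in>{-1..3}. F k (2 * pi) - F k 0) \<le> of_nat (card {-1..3::int}) * (4 * sqrt (8 * pi))"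
        by (intro sum_bounded_above)
      then show ?thesis unfolding C_def by (intro mult_left_mono) auto
    qed
    moreover have "1 / sqrt (norm (of_real r * cis t - a)) \<le> \<psi> t" if t: "t \<in> {0..2*pi} - T" for t
    proof -
      define u where "u = t - \<theta>"
      define k where "k = round (u / pi)"
      define v where "v = u - of_int k * pi"
      have "\<bar>u / pi - of_int k\<bar> \<le> 1 / 2"
        using of_int_round_abs_le[of "u / pi"] by (simp add: k_def abs_minus_commute)
      moreover have "u / pi - of_int k = v / pi" by (simp add: v_def field_simps)
      ultimately have v: "\<bar>v\<bar> \<le> pi / 2" by (simp add: field_simps)
      have u: "-1 \<le> u / pi" "u / pi < 3" using t \<theta> by (auto simp: u_def field_simps)
      have k: "k \<in> {-1..3}"
      proof -
        have "round (-1 :: real) \<le> round (u / pi)" "round (u / pi) \<le> round (3::real)"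
          by (intro round_mono; use u in simp)+
        then show ?thesis using round_of_int[of "-1", where 'a = real] by (simp add: k_def)
      qed
      have v0: "v \<noteq> 0"
      proof
        assume "v = 0"
        then have "t = c k" by (simp add: v_def u_def c_def)
        with t k show False by (auto simp: T_def)
      qed
      have "a = of_real (norm a) * cis \<theta>"
        by (metis \<theta>_def rcis_cmod_Arg rcis_def)
      \<comment> \<open>Rotation by \<open>- \<theta>\<close> makes \<open>a\<close> real, so the
        imaginary part of the difference is \<open>r * sin u\<close>, whatever the modulus of
        \<open>a\<close>.\<close>
      then have "norm (of_real r * cis t - a) = norm ((of_real r * cis t - of_real (norm a) * cis \<theta>) * cis (- \<theta>))"
        by (simp add: norm_mult)
      also have "\<dots> = norm (of_real r * cis u - of_real (norm a))"
        by (simp add: left_diff_distrib mult.assoc cis_mult u_def)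
      also have "\<dots> \<ge> \<bar>r * sin u\<bar>"
        using abs_Im_le_cmod[of "of_real r * cis u - of_real (norm a)"] by simp
      also have "\<bar>r * sin u\<bar> = r * \<bar>sin u\<bar>" using r by (simp add: abs_mult)
      finally have 1: "norm (of_real r * cis t - a) \<ge> r * \<bar>sin u\<bar>" .
      have "u = v + pi * of_int k" by (simp add: v_def)
      then have "\<bar>sin u\<bar> = \<bar>sin v\<bar>"
        by (auto simp: sin_add abs_mult sin_npi_int cos_npi_int)
      also have "\<bar>sin v\<bar> \<ge> 2 / pi * \<bar>v\<bar>"
        using sin_ge_linear[of "\<bar>v\<bar>"] v by (cases "v \<ge> 0") auto
      finally have "2 / pi * \<bar>v\<bar> \<le> \<bar>sin u\<bar>" .
      then have "2 / pi * \<bar>v\<bar> \<le> r * \<bar>sin u\<bar>"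
        using r mult_right_mono[of 1 r "\<bar>sin u\<bar>"] by linarith
      with 1 have "2 / pi * \<bar>v\<bar> \<le> norm (of_real r * cis t - a)" by linarith
      then have "sqrt (2 / pi * \<bar>v\<bar>) \<le> sqrt (norm (of_real r * cis t - a))" by simp
      moreover have "sqrt (2 / pi * \<bar>v\<bar>) > 0" using v0 by simp
      ultimately have "1 / sqrt (norm (of_real r * cis t - a)) \<le> 1 / sqrt (2 / pi * \<bar>v\<bar>)"
        by (intro divide_left_mono mult_pos_pos) auto
      also have "\<dots> = sqrt (pi / 2) * (1 / sqrt \<bar>v\<bar>)"
        by (simp add: real_sqrt_mult real_sqrt_divide)
      also have "1 / sqrt \<bar>v\<bar> = 1 / sqrt \<bar>t - c k\<bar>" by (simp add: v_def c_def u_def algebra_simps)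
      also have "\<dots> \<le> (\<Sum>k\<in>{-1..3}. 1 / sqrt \<bar>t - c k\<bar>)"
        using k by (intro member_le_sum) auto
      finally show ?thesis by (simp add: \<psi>_def mult_left_mono)
    qed
    ultimately show ?thesis unfolding T_def by (meson finite_imageI finite_atLeastAtMost_int)
  qed
  moreover have "C \<ge> 0" by (simp add: C_def)
  ultimately show thesis using that by blast
qed


section \<open>The lemma on the logarithmic derivative, in the mean over circles\<close>

lemma log_plus_le_ln_sqrt: "x \<ge> 0 \<Longrightarrow> log_plus x \<le> 2 * ln (1 + sqrt x)"
proof -
  assume x: "x \<ge> 0"
  have "max 1 x \<le> (1 + sqrt x)\<^sup>2"
    using x by (simp add: power2_sum)
  then have "ln (max 1 x) \<le> ln ((1 + sqrt x)\<^sup>2)"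
    by (intro ln_mono) auto
  also have "\<dots> = 2 * ln (1 + sqrt x)"
    using x by (subst ln_realpow) (auto simp: add_pos_nonneg)
  finally show ?thesis by (simp add: log_plus_def)
qed

lemma sqrt_add_sum_le:
  assumes "finite S" "y \<ge> 0" "\<And>a. a \<in> S \<Longrightarrow> x a \<ge> 0"
  shows "sqrt (y + (\<Sum>a\<in>S. x a)) \<le> sqrt y + (\<Sum>a\<in>S. sqrt (x a))"
  using assms(1,3)
proof induction
  case (insert a S)
  have "sqrt (y + (\<Sum>a\<in>insert a S. x a)) = sqrt (x a + (y + (\<Sum>a\<in>S. x a)))"
    using insert.hyps by (simp add: add_ac)
  also have "\<dots> \<le> sqrt (x a) + sqrt (y + (\<Sum>a\<in>S. x a))"
    using assms(2) insert.prems by (intro sqrt_add_le_add_sqrt add_nonneg_nonneg sum_nonneg) auto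
  finally show ?case using insert by simp
qed simp

text \<open>The circle is parametrized injectively only on the half-open interval, so the finitely
  many zeros in the disc are pulled back there and the endpoint \<open>2 * pi\<close> is added
  afterwards.\<close>

lemma finite_zeros_circle:
  fixes g :: "complex \<Rightarrow> complex"
  assumes "g holomorphic_on UNIV" "g z0 \<noteq> 0" "r > 0"
  shows "finite {t \<in> {0..2*pi}. g (of_real r * cis t) = 0}"
proof -
  have inj: "inj_on (\<lambda>t. of_real r * cis t) {0..<2*pi}"
  proof (rule inj_onI)
    fix x y assume xy: "x \<in> {0..<2*pi}" "y \<in> {0..<2*pi}" "of_real r * cis x = of_real r * cis y"
    then have "sin x = sin y \<and> cos x = cos y"
      using assms(3) by (auto simp: complex_eq_iff)
    then obtain n :: int where n: "x = y + 2 * pi * n"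
      using sin_cos_eq_iff by blast
    have "2 * pi * real_of_int n < 2 * pi * 1" "2 * pi * (- 1) < 2 * pi * real_of_int n"
      using xy(1,2) n unfolding atLeastLessThan_iff by linarith+
    then have "n = 0" by (simp only: mult_less_cancel_left_pos pi_gt_zero mult_pos_pos zero_less_numeral)
    then show "x = y" using n by simp
  qed
  have "(\<lambda>t. of_real r * cis t) ` {t \<in> {0..<2*pi}. g (of_real r * cis t) = 0} \<subseteq> {z \<in> cball 0 r. g z = 0}"
    using assms(3) by (auto simp: norm_mult)
  then have "finite {t \<in> {0..<2*pi}. g (of_real r * cis t) = 0}"
    using finite_zeros_cball[OF assms(1,2)] inj
    by (metis (no_types, lifting) finite_imageD finite_subset inj_on_subset mem_Collect_eq subsetI)
  moreover have "{t \<in> {0..2*pi}. g (of_real r * cis t) = 0} \<subseteq>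
      insert (2*pi) {t \<in> {0..<2*pi}. g (of_real r * cis t) = 0}" by auto
  ultimately show ?thesis by (meson finite_insert finite_subset)
qed

text \<open>
  The concavity of \<open>ln\<close> is used in the form of a tangent at \<open>B + N\<close>, applied to
  square roots so that the singularities become integrable.
\<close>
lemma log_plus_sum_tangent:
  fixes k :: "'a \<Rightarrow> nat" and x :: "'a \<Rightarrow> real"
  assumes "finite S" "y \<ge> 0" "\<And>a. a \<in> S \<Longrightarrow> x a \<ge> 0"
  shows "log_plus (y + (\<Sum>a\<in>S. real (k a) / x a)) \<le>
    2 * ln (2 + y + (\<Sum>a\<in>S. k a)) + 2 * (\<Sum>a\<in>S. real (k a) * (1 / sqrt (x a))) / (1 + (\<Sum>a\<in>S. k a))"
proof -
  define N where "N = real (\<Sum>a\<in>S. k a)"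
  define Y where "Y = (\<Sum>a\<in>S. real (k a) * (1 / sqrt (x a)))"
  have N: "N \<ge> 0" unfolding N_def by (rule of_nat_0_le_iff)
  have Y: "Y \<ge> 0" unfolding Y_def using assms by (intro sum_nonneg) auto
  have sq: "sqrt c \<le> 1 + c" if "c \<ge> 0" for c :: real
    using that by (intro real_le_lsqrt) (auto simp: power2_sum)
  \<comment> \<open>For natural numbers the square root is at most the number itself; this keeps the
    multiplicities linear in \<open>Y\<close>, so that their total is \<open>N\<close>.\<close>
  have sqk: "sqrt (real n) \<le> real n" for n
    by (cases "n = 0") (auto intro!: real_le_lsqrt simp: power2_eq_square)
  have "sqrt (y + (\<Sum>a\<in>S. real (k a) / x a)) \<le> sqrt y + (\<Sum>a\<in>S. sqrt (real (k a) / x a))"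
    using assms by (intro sqrt_add_sum_le) auto
  also have "(\<Sum>a\<in>S. sqrt (real (k a) / x a)) \<le> Y"
    unfolding Y_def
    using assms by (intro sum_mono) (auto simp: real_sqrt_divide intro!: divide_right_mono sqk)
  finally have 1: "1 + sqrt (y + (\<Sum>a\<in>S. real (k a) / x a)) \<le> 2 + y + Y"
    using sq[OF assms(2)] by simp
  have nn: "y + (\<Sum>a\<in>S. real (k a) / x a) \<ge> 0"
    using assms by (intro add_nonneg_nonneg sum_nonneg) auto
  have "log_plus (y + (\<Sum>a\<in>S. real (k a) / x a)) \<le> 2 * ln (1 + sqrt (y + (\<Sum>a\<in>S. real (k a) / x a)))"
    by (rule log_plus_le_ln_sqrt[OF nn])
  also have "\<dots> \<le> 2 * ln (2 + y + Y)"
    using 1 nn by (intro mult_left_mono ln_mono) (auto simp: add_pos_nonneg)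
  \<comment> \<open>After the tangent estimate the denominator is lowered to \<open>1 + N\<close>.
    The total weight in \<open>Y\<close> is \<open>N\<close>, so \<open>Y / (1 + N)\<close> has a
    mean bounded independently of the number of zeros.\<close>
  also have "ln (2 + y + Y) \<le> ln (2 + y + N) + Y / (1 + N)"
  proof -
    have pos: "2 + y + N > 0" using assms(2) N by simp
    have "ln ((2 + y + Y) / (2 + y + N)) \<le> (2 + y + Y) / (2 + y + N) - 1"
      using pos assms(2) Y by (intro ln_le_minus_one) auto
    also have "\<dots> = (Y - N) / (2 + y + N)" using pos by (simp add: field_simps)
    also have "\<dots> \<le> Y / (2 + y + N)" using pos N by (intro divide_right_mono) auto
    also have "\<dots> \<le> Y / (1 + N)" using assms(2) N Y by (intro divide_left_mono) auto
    finally show ?thesis using pos assms(2) Y by (simp add: ln_div)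
  qed
  finally show ?thesis by (simp add: N_def Y_def algebra_simps)
qed

text \<open>The zeros change with \<open>r\<close>, but the majorant of
  \<open>1 / sqrt (norm (z - a))\<close> has an integral bounded uniformly in \<open>a\<close> and
  \<open>r\<close>. The singular part therefore contributes at most \<open>2 * C1\<close>, and the
  logarithm of the polynomial bound contributes the multiple of \<open>ln r\<close>.\<close>

lemma log_derivative_lemma:
  fixes g :: "complex \<Rightarrow> complex"
  assumes holo: "g holomorphic_on UNIV" and z0: "g z0 \<noteq> 0" and C: "C \<ge> 0"
    and growth: "\<And>z. norm z \<ge> 1 \<Longrightarrow> norm (g z) \<le> exp (C * norm z ^ d)"
  shows "circle_mean_bound (\<lambda>z. log_plus (norm (deriv g z / g z))) ln"
proof -
  from logderiv_pointwise_bound[OF holo z0 C growth]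
  obtain K where K: "K \<ge> 0" and
    bd: "\<forall>r\<ge>1. \<exists>S k. finite S \<and> real (\<Sum>a\<in>S. k a) \<le> K * r ^ d \<and>
       (\<forall>z. norm z = r \<and> g z \<noteq> 0 \<longrightarrow>
          norm (deriv g z / g z) \<le> K * r ^ d + (\<Sum>a\<in>S. real (k a) / norm (z - a)))"
    by blast
  obtain C1 where C1: "C1 \<ge> 0"
    "\<And>a r. r \<ge> 1 \<Longrightarrow> \<exists>\<psi> I T. finite T \<and> (\<psi> has_integral I) {0..2*pi} \<and> I \<le> C1 \<and>
       (\<forall>t\<in>{0..2*pi} - T. 1 / sqrt (norm (of_real r * cis t - a)) \<le> \<psi> t)"
    using inverse_sqrt_dist_majorant by blast
  \<comment> \<open>From \<open>r \<ge> exp 1\<close> on one has \<open>1 \<le> ln r\<close>, which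
    lets the additive constants \<open>ln (2 + 2 * K)\<close> and \<open>2 * C1\<close> be absorbed
    into a multiple of \<open>ln r\<close>.\<close>
  define A where "A = 4 * pi * (ln (2 + 2 * K) + real d) + 2 * C1"
  have "\<exists>\<psi> I T. finite T \<and> (\<psi> has_integral I) {0..2*pi} \<and> I \<le> A * ln r \<and>
     (\<forall>t\<in>{0..2*pi} - T. log_plus (norm (deriv g (of_real r * cis t) / g (of_real r * cis t))) \<le> \<psi> t)"
    if r: "r \<ge> exp 1" for r
  proof -
    have r1: "r \<ge> 1" using r exp_ge_add_one_self[of 1] by simp
    have lnr: "ln r \<ge> 1" using r r1 by (subst ln_ge_iff) auto
    obtain S k where S: "finite S" "real (\<Sum>a\<in>S. k a) \<le> K * r ^ d"
      and Sb: "\<forall>z. norm z = r \<and> g z \<noteq> 0 \<longrightarrow>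
          norm (deriv g z / g z) \<le> K * r ^ d + (\<Sum>a\<in>S. real (k a) / norm (z - a))"
      using bd[THEN spec, THEN mp, OF r1] by (elim exE conjE)
    define N where "N = real (\<Sum>a\<in>S. k a)"
    define y where "y = K * r ^ d"
    have y: "y \<ge> 0" using K r1 by (simp add: y_def)
    have N: "N \<ge> 0" "N \<le> y" using S(2) unfolding N_def y_def by (simp_all only: of_nat_0_le_iff)
    obtain \<psi> I T where \<psi>: "\<And>a. finite (T a)" "\<And>a. (\<psi> a has_integral I a) {0..2*pi}" "\<And>a. I a \<le> C1"
       "\<And>a t. t \<in> {0..2*pi} - T a \<Longrightarrow> 1 / sqrt (norm (of_real r * cis t - a)) \<le> \<psi> a t"
      using C1(2)[OF r1] by metis
    define \<Psi> where "\<Psi> = (\<lambda>t. 2 * ln (2 + y + N) + 2 * (\<Sum>a\<in>S. real (k a) * \<psi> a t) / (1 + N))"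
    define J where "J = 4 * pi * ln (2 + y + N) + 2 * (\<Sum>a\<in>S. real (k a) * I a) / (1 + N)"
    define TT where "TT = {t \<in> {0..2*pi}. g (of_real r * cis t) = 0} \<union> (\<Union>a\<in>S. T a)"
    have "finite TT" unfolding TT_def
      using S(1) \<psi>(1) finite_zeros_circle[OF holo z0, of r] r1 by auto
    moreover have "(\<Psi> has_integral J) {0..2*pi}"
    proof -
      have "((\<lambda>t. 2 * ln (2 + y + N)) has_integral 4 * pi * ln (2 + y + N)) {0..2*pi}"
        using has_integral_const_real[of "2 * ln (2 + y + N)" 0 "2*pi"] by (simp add: mult_ac)
      moreover have "((\<lambda>t. 2 * (\<Sum>a\<in>S. real (k a) * \<psi> a t) / (1 + N)) has_integral
          2 * (\<Sum>a\<in>S. real (k a) * I a) / (1 + N)) {0..2*pi}"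
        using S(1) by (intro has_integral_divide has_integral_mult_right has_integral_sum \<psi>(2)) auto
      ultimately show ?thesis unfolding \<Psi>_def J_def by (rule has_integral_add)
    qed
    moreover have "J \<le> A * ln r"
    proof -
      have "(\<Sum>a\<in>S. real (k a) * I a) \<le> (\<Sum>a\<in>S. real (k a) * C1)"
        by (intro sum_mono mult_left_mono \<psi>(3)) auto
      also have "\<dots> = N * C1" by (simp add: N_def sum_distrib_right)
      also have "\<dots> \<le> (1 + N) * C1" using C1(1) by (intro mult_right_mono) auto
      finally have 1: "2 * (\<Sum>a\<in>S. real (k a) * I a) / (1 + N) \<le> 2 * C1"
        using N by (simp add: field_simps)
      have rd: "1 \<le> r ^ d" using r1 by (rule one_le_power)
      have "2 + y + N \<le> (2 + 2 * K) * r ^ d" using N rd by (simp add: y_def algebra_simps)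
      then have "ln (2 + y + N) \<le> ln ((2 + 2 * K) * r ^ d)"
        using y N by (intro ln_mono) auto
      also have "\<dots> = ln (2 + 2 * K) + real d * ln r"
        using K r1 by (subst ln_mult_pos) (auto simp: ln_realpow)
      also have "\<dots> \<le> ln (2 + 2 * K) * ln r + real d * ln r"
        using mult_left_mono[OF lnr, of "ln (2 + 2 * K)"] K by simp
      finally have "4 * pi * ln (2 + y + N) \<le> 4 * pi * ((ln (2 + 2 * K) + real d) * ln r)"
        by (intro mult_left_mono) (auto simp: algebra_simps)
      moreover have "2 * C1 \<le> 2 * C1 * ln r" using mult_left_mono[OF lnr, of "2 * C1"] C1 by simp
      ultimately show ?thesis using 1 by (simp add: J_def A_def algebra_simps)
    qed
    moreover have "log_plus (norm (deriv g (of_real r * cis t) / g (of_real r * cis t))) \<le> \<Psi> t"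
      if t: "t \<in> {0..2*pi} - TT" for t
    proof -
      define z where "z = of_real r * cis t"
      have z: "norm z = r" "g z \<noteq> 0" using t r1 by (auto simp: z_def TT_def norm_mult)
      have "log_plus (norm (deriv g z / g z)) \<le> log_plus (y + (\<Sum>a\<in>S. real (k a) / norm (z - a)))"
        using Sb z by (intro log_plus_mono) (auto simp: y_def)
      also have "\<dots> \<le> 2 * ln (2 + y + (\<Sum>a\<in>S. k a)) +
          2 * (\<Sum>a\<in>S. real (k a) * (1 / sqrt (norm (z - a)))) / (1 + (\<Sum>a\<in>S. k a))"
        by (rule log_plus_sum_tangent[OF S(1) y]) auto
      also have "\<dots> = 2 * ln (2 + y + N) + 2 * (\<Sum>a\<in>S. real (k a) * (1 / sqrt (norm (z - a)))) / (1 + N)"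
        by (simp add: N_def)
      also have "\<dots> \<le> \<Psi> t"
        unfolding \<Psi>_def z_def
        using N t by (intro add_left_mono divide_right_mono mult_left_mono sum_mono \<psi>(4)) (auto simp: TT_def)
      finally show ?thesis by (simp add: z_def)
    qed
    ultimately show ?thesis by blast
  qed
  then show ?thesis unfolding circle_mean_bound_def by blast
qed

section \<open>Exponential sums\<close>

lemma norm_poly_le:
  fixes z :: "'a::real_normed_field"
  assumes "norm z \<ge> 1"
  shows "norm (poly p z) \<le> (\<Sum>i\<le>degree p. norm (coeff p i)) * norm z ^ degree p"
proof -
  have "norm (poly p z) \<le> (\<Sum>i\<le>degree p. norm (coeff p i * z ^ i))"
    unfolding poly_altdef by (rule norm_sum)
  also have "\<dots> \<le> (\<Sum>i\<le>degree p. norm (coeff p i) * norm z ^ degree p)"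
    using assms by (intro sum_mono) (auto simp: norm_mult norm_power intro!: mult_left_mono power_increasing)
  finally show ?thesis by (simp add: sum_distrib_right)
qed

lemma poly_norm_bound:
  fixes p :: "'a::real_normed_field poly"
  obtains C where "C \<ge> 0" "\<And>z. norm z \<ge> 1 \<Longrightarrow> norm (poly p z) \<le> C * norm z ^ degree p"
proof
  show "(\<Sum>i\<le>degree p. norm (coeff p i)) \<ge> 0" by (intro sum_nonneg) auto
qed (rule norm_poly_le)

lemma poly_norm_lower_bound:
  fixes p :: "complex poly"
  assumes "p \<noteq> 0"
  obtains c R where "c > 0" "\<And>z. norm z \<ge> R \<Longrightarrow> norm (poly p z) \<ge> c"
proof (cases p)
  case (pCons a q)
  show thesis
  proof (cases "q = 0")
    case True
    then show thesis using that[of "norm a" 0] pCons assms by auto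
  next
    case False
    then show thesis using that[of 1] poly_infinity[OF False, of 1 a] pCons by auto
  qed
qed

lemma circle_mean_bound_log_plus_poly:
  "circle_mean_bound (\<lambda>z. log_plus (norm (poly p z))) ln"
proof -
  obtain C where C: "C \<ge> 0" "\<And>z. norm z \<ge> 1 \<Longrightarrow> norm (poly p z) \<le> C * norm z ^ degree p"
    using poly_norm_bound by blast
  show ?thesis
  \<comment> \<open>Beyond radius \<open>C\<close> the constant \<open>C\<close> costs only one more
    power of \<open>norm z\<close>; this is the origin of \<open>Suc (degree p)\<close>.\<close>
  proof (rule circle_mean_bound_const[of "max 1 C" _ "Suc (degree p)"])
    fix z :: complex assume z: "norm z \<ge> max 1 C"
    have "norm (poly p z) \<le> C * norm z ^ degree p" using C z by simp
    also have "\<dots> \<le> norm z ^ Suc (degree p)"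
      using z by (auto intro!: mult_right_mono)
    finally have "max 1 (norm (poly p z)) \<le> norm z ^ Suc (degree p)"
      using z one_le_power[of "norm z" "Suc (degree p)"] by simp
    then have "ln (max 1 (norm (poly p z))) \<le> ln (norm z ^ Suc (degree p))"
      by (intro ln_mono) auto
    also have "\<dots> = Suc (degree p) * ln (norm z)" using z by (subst ln_realpow) auto
    finally show "log_plus (norm (poly p z)) \<le> Suc (degree p) * ln (norm z)"
      by (simp add: log_plus_def)
  qed
qed

lemma circle_mean_bound_ln_const: "circle_mean_bound (\<lambda>z. c) ln"
proof (rule circle_mean_bound_const[of "exp 1" _ "\<bar>c\<bar>"])
  fix z :: complex assume "norm z \<ge> exp 1"
  then have "ln (norm z) \<ge> 1"
    by (subst ln_ge_iff) (auto intro: less_le_trans[OF exp_gt_zero])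
  then show "c \<le> \<bar>c\<bar> * ln (norm z)"
    using mult_left_mono[of 1 "ln (norm z)" "\<bar>c\<bar>"] by simp
qed

lemma circle_mean_bound_log_plus_inverse_poly:
  assumes "p \<noteq> 0"
  shows "circle_mean_bound (\<lambda>z. log_plus (norm (1 / poly p z))) ln"
proof -
  obtain c R where c: "c > 0" "\<And>z. norm z \<ge> R \<Longrightarrow> norm (poly p z) \<ge> c"
    using poly_norm_lower_bound[OF assms] by blast
  show ?thesis
  proof (rule circle_mean_bound_mono[OF circle_mean_bound_ln_const[of "log_plus (1 / c)"], of "max R 0"])
    fix r assume r: "r \<ge> max R 0"
    have "log_plus (norm (1 / poly p (of_real r * cis t))) \<le> log_plus (1 / c)" for t
    proof (rule log_plus_mono)
      have "norm (poly p (of_real r * cis t)) \<ge> c"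
        using r by (intro c(2)) (auto simp: norm_mult)
      then show "norm (1 / poly p (of_real r * cis t)) \<le> 1 / c"
        using c(1) by (auto simp: norm_divide intro!: divide_left_mono mult_pos_pos)
    qed
    then show "\<exists>T. finite T \<and> (\<forall>t\<in>{0..2*pi} - T.
        log_plus (norm (1 / poly p (of_real r * cis t))) \<le> log_plus (1 / c))" by blast
  qed
qed

text \<open>Arbitrary index sets replace the initial segments of \<open>exp_poly\<close>:
  elimination removes any chosen index, and the expansion of a normalized form is indexed by
  pairs.\<close>

definition exp_sum :: "'a set \<Rightarrow> ('a \<Rightarrow> complex poly) \<Rightarrow> ('a \<Rightarrow> complex poly) \<Rightarrow> complex \<Rightarrow> complex" where
  "exp_sum I P Q z = (\<Sum>j\<in>I. poly (P j) z * exp (poly (Q j) z))"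

text \<open>The exponent \<open>d\<close> is not sharp. Any finite order is enough, since
  \<open>d\<close> only enters the constant in front of \<open>ln r\<close> in the logarithmic
  derivative estimate.\<close>

lemma exp_sum_growth:
  assumes "finite I"
  shows "\<exists>C\<ge>0. \<exists>d. \<forall>z. norm z \<ge> 1 \<longrightarrow> norm (exp_sum I P Q z) \<le> exp (C * norm z ^ d)"
  using assms
proof induction
  case empty
  then show ?case by (auto simp: exp_sum_def intro!: exI[of _ 0])
next
  case (insert i I)
  then obtain C d where C: "C \<ge> 0" "\<And>z. norm z \<ge> 1 \<Longrightarrow> norm (exp_sum I P Q z) \<le> exp (C * norm z ^ d)"
    by blast
  obtain A where A: "A \<ge> 0" "\<And>z. norm z \<ge> 1 \<Longrightarrow> norm (poly (P i) z) \<le> A * norm z ^ degree (P i)"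
    using poly_norm_bound by blast
  obtain B where B: "B \<ge> 0" "\<And>z. norm z \<ge> 1 \<Longrightarrow> norm (poly (Q i) z) \<le> B * norm z ^ degree (Q i)"
    using poly_norm_bound by blast
  define e where "e = d + degree (P i) + degree (Q i)"
  have "norm (exp_sum (insert i I) P Q z) \<le> exp ((1 + A + B + C) * norm z ^ e)" if z: "norm z \<ge> 1" for z
  proof -
    define x where "x = norm z ^ e"
    have pw: "norm z ^ d \<le> x" "norm z ^ degree (P i) \<le> x" "norm z ^ degree (Q i) \<le> x" "1 \<le> x"
      using z by (auto simp: x_def e_def intro!: power_increasing one_le_power)
    have "norm (poly (P i) z) \<le> A * x" using A(2)[OF z] mult_left_mono[OF pw(2) A(1)] by simp
    then have 1: "norm (poly (P i) z) \<le> exp (A * x)"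
      using exp_ge_add_one_self[of "A * x"] by linarith
    have "norm (exp (poly (Q i) z)) \<le> exp (norm (poly (Q i) z))" by (rule norm_exp)
    also have "norm (poly (Q i) z) \<le> B * x" using B(2)[OF z] mult_left_mono[OF pw(3) B(1)] by simp
    finally have 2: "norm (exp (poly (Q i) z)) \<le> exp (B * x)" by simp
    have "norm (exp_sum I P Q z) \<le> exp (C * norm z ^ d)" by (rule C(2)[OF z])
    also have "\<dots> \<le> exp (C * x)" using mult_left_mono[OF pw(1) C(1)] by simp
    finally have 3: "norm (exp_sum I P Q z) \<le> exp (C * x)" .
    have "norm (exp_sum (insert i I) P Q z) \<le> norm (poly (P i) z) * norm (exp (poly (Q i) z)) + norm (exp_sum I P Q z)"
      using insert.hyps norm_triangle_ineq[of "poly (P i) z * exp (poly (Q i) z)" "exp_sum I P Q z"]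
      by (simp add: exp_sum_def norm_mult)
    also have "\<dots> \<le> exp (A * x) * exp (B * x) + exp (C * x)"
      by (intro add_mono mult_mono 1 2 3) auto
    also have "\<dots> \<le> exp ((A + B + C) * x) + exp ((A + B + C) * x)"
      unfolding exp_add[symmetric] distrib_right[symmetric]
      using A(1) B(1) C(1) pw(4) by (intro add_mono) (auto intro!: mult_right_mono)
    also have "\<dots> \<le> exp 1 * exp ((A + B + C) * x)"
      using exp_ge_add_one_self[of 1] mult_right_mono[of 2 "exp 1" "exp ((A + B + C) * x)"] by simp
    also have "\<dots> \<le> exp ((1 + A + B + C) * x)"
      using pw(4) by (simp add: exp_add[symmetric] algebra_simps)
    finally show ?thesis by (simp add: x_def)
  qed
  then show ?case using A(1) B(1) C(1) by (intro exI[of _ "1 + A + B + C"]) auto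
qed

section \<open>Differentiation of exponential sums and elimination of terms\<close>

lemma exp_sum_holomorphic: "exp_sum I P Q holomorphic_on S"
proof -
  have "(\<lambda>z. \<Sum>j\<in>I. poly (P j) z * exp (poly (Q j) z)) holomorphic_on S"
    by (intro holomorphic_intros)
  then show ?thesis by (simp add: exp_sum_def[abs_def])
qed

lemma deriv_exp_sum:
  "deriv (exp_sum I P Q) z = (\<Sum>j\<in>I. (poly (pderiv (P j)) z + poly (P j) z * poly (pderiv (Q j)) z) * exp (poly (Q j) z))"
proof (rule DERIV_imp_deriv)
  show "(exp_sum I P Q has_field_derivative
     (\<Sum>j\<in>I. (poly (pderiv (P j)) z + poly (P j) z * poly (pderiv (Q j)) z) * exp (poly (Q j) z))) (at z)"
    unfolding exp_sum_def[abs_def]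
    by (rule derivative_eq_intros poly_DERIV refl)+ (simp add: algebra_simps)
qed

text \<open>This is the Wronskian of \<open>A * exp S\<close> and \<open>B * exp T\<close> divided
  by \<open>exp (S + T)\<close>: the coefficient with which \<open>exp T\<close> survives when the
  term \<open>A * exp S\<close> is eliminated.\<close>

definition elim_coeff :: "complex poly \<Rightarrow> complex poly \<Rightarrow> complex poly \<Rightarrow> complex poly \<Rightarrow> complex poly" where
  "elim_coeff A S B T = A * pderiv B + A * B * pderiv T - (pderiv A + A * pderiv S) * B"

lemma elim_coeff_self [simp]: "elim_coeff A S A S = 0"
  by (simp add: elim_coeff_def algebra_simps)

text \<open>If it vanished, \<open>A * B' - A' * B\<close> would equal
  \<open>- A * B * (T' - S')\<close>. Here T' differs from S', because the common value at 0
  excludes a difference by a nonzero constant. So the right side is nonzero of degree at least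
  \<open>degree A + degree B\<close>, whereas the left side has smaller degree, or is 0 when both
  \<open>A\<close> and \<open>B\<close> are constant.\<close>

lemma elim_coeff_nonzero:
  assumes A: "A \<noteq> 0" and B: "B \<noteq> 0" and ST: "S \<noteq> T" "poly S 0 = poly T 0"
  shows "elim_coeff A S B T \<noteq> 0"
proof
  assume "elim_coeff A S B T = 0"
  then have eq: "A * pderiv B - pderiv A * B = - (A * B * (pderiv T - pderiv S))" (is "?L = ?R")
    by (simp add: elim_coeff_def algebra_simps)
  have D: "pderiv T - pderiv S \<noteq> 0"
  proof
    assume "pderiv T - pderiv S = 0"
    then have "pderiv (T - S) = 0" by (simp add: pderiv_diff)
    then have "degree (T - S) = 0" by (simp add: pderiv_eq_0_iff)
    then obtain c where "T - S = [:c:]" by (auto elim: degree_eq_zeroE)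
    moreover have "poly (T - S) 0 = 0" using ST(2) by simp
    ultimately have "T - S = 0" by simp
    then show False using ST(1) by simp
  qed
  have deg: "degree ?R \<ge> degree A + degree B" "?R \<noteq> 0"
    using A B D by (simp_all add: degree_mult_eq)
  show False
  proof (cases "degree A + degree B = 0")
    case True
    then have "pderiv A = 0" "pderiv B = 0" by (auto simp: pderiv_eq_0_iff)
    then show False using eq deg(2) by simp
  next
    case False
    have "degree (A * pderiv B) < degree A + degree B"
    proof (cases "degree B = 0")
      case True
      then have "pderiv B = 0" by (simp add: pderiv_eq_0_iff)
      then show ?thesis using False by simp
    next
      case False
      then show ?thesis using degree_mult_le[of A "pderiv B"] by (simp add: degree_pderiv)
    qed
    moreover have "degree (pderiv A * B) < degree A + degree B"
    proof (cases "degree A = 0")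
      case True
      then have "pderiv A = 0" by (simp add: pderiv_eq_0_iff)
      then show ?thesis using False by simp
    next
      case False
      then show ?thesis using degree_mult_le[of "pderiv A" B] by (simp add: degree_pderiv)
    qed
    ultimately have "degree ?L < degree A + degree B" by (rule degree_diff_less)
    then show False using deg(1) eq by simp
  qed
qed

lemma exp_sum_eliminate:
  assumes "finite I" "k \<notin> I"
  shows "exp_sum I (\<lambda>j. elim_coeff (P k) (Q k) (P j) (Q j)) Q z =
    poly (P k) z * deriv (exp_sum (insert k I) P Q) z -
    poly (pderiv (P k) + P k * pderiv (Q k)) z * exp_sum (insert k I) P Q z"
proof -
  have "poly (P k) z * deriv (exp_sum (insert k I) P Q) z -
      poly (pderiv (P k) + P k * pderiv (Q k)) z * exp_sum (insert k I) P Q z =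
      exp_sum (insert k I) (\<lambda>j. elim_coeff (P k) (Q k) (P j) (Q j)) Q z"
    unfolding deriv_exp_sum exp_sum_def sum_distrib_left sum_subtractf[symmetric]
    by (intro sum.cong refl) (simp add: elim_coeff_def algebra_simps)
  also have "\<dots> = exp_sum I (\<lambda>j. elim_coeff (P k) (Q k) (P j) (Q j)) Q z"
    using assms by (simp add: exp_sum_def)
  finally show ?thesis by simp
qed

text \<open>
  Applying \<open>P k * f' - (P k' + P k * Q k') * f\<close> removes the term with index \<open>k\<close> at the cost of
  one logarithmic derivative, until only the term with index \<open>i\<close> is left.
\<close>
theorem exp_sum_lower_bound:
  assumes "finite J" "i \<notin> J" "\<And>j. j \<in> insert i J \<Longrightarrow> P j \<noteq> 0" "inj_on Q (insert i J)"
    "\<And>j. j \<in> insert i J \<Longrightarrow> poly (Q j) 0 = 0"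
  shows "(\<exists>z. exp_sum (insert i J) P Q z \<noteq> 0) \<and>
    circle_mean_bound (\<lambda>z. log_plus (norm (exp (poly (Q i) z) / exp_sum (insert i J) P Q z))) ln"
  using assms
\<comment> \<open>Elimination leaves the exponents \<open>Q\<close> unchanged but replaces every
  coefficient, hence the generalization over \<open>P\<close> alone.\<close>
proof (induction J arbitrary: P)
  case empty
  then have P: "P i \<noteq> 0" by simp
  then obtain z where "poly (P i) z \<noteq> 0" using poly_all_0_iff_0 by blast
  then show ?case using circle_mean_bound_log_plus_inverse_poly[OF P] by (auto simp: exp_sum_def)
next
  case (insert k J)
  define P' where "P' = (\<lambda>j. elim_coeff (P k) (Q k) (P j) (Q j))"
  define U where "U = pderiv (P k) + P k * pderiv (Q k)"
  define f where "f = exp_sum (insert i (insert k J)) P Q"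
  define h where "h = exp_sum (insert i J) P' Q"
  have hf: "h z = poly (P k) z * deriv f z - poly U z * f z" for z
    unfolding h_def f_def P'_def U_def
    using exp_sum_eliminate[of "insert i J" k P Q z] insert.hyps insert.prems(1)
    by (simp only: insert_commute[of i k]) auto
  have "P' j \<noteq> 0" if "j \<in> insert i J" for j
    unfolding P'_def
  proof (rule elim_coeff_nonzero)
    show "Q k \<noteq> Q j"
      using insert.prems(1,3) insert.hyps that by (auto simp: inj_on_def)
  qed (use insert.prems that in auto)
  moreover have "inj_on Q (insert i J)" using insert.prems(3) by (rule inj_on_subset) auto
  ultimately have IH: "\<exists>z. h z \<noteq> 0" "circle_mean_bound (\<lambda>z. log_plus (norm (exp (poly (Q i) z) / h z))) ln"
    using insert.IH[of P'] insert.prems unfolding h_def by auto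
  then obtain z1 where z1: "h z1 \<noteq> 0" by blast
  have fholo: "f holomorphic_on UNIV" unfolding f_def by (rule exp_sum_holomorphic)
  have hholo: "h holomorphic_on UNIV" unfolding h_def by (rule exp_sum_holomorphic)
  \<comment> \<open>\<open>h\<close> is a linear differential expression in \<open>f\<close>, so it
    would vanish along with \<open>f\<close>. Nontriviality is carried through the induction because
    the logarithmic derivative estimate for \<open>f\<close> requires it.\<close>
  have "\<exists>z. f z \<noteq> 0"
  proof (rule ccontr)
    assume "\<nexists>z. f z \<noteq> 0"
    then have "f = (\<lambda>z. 0)" by auto
    then show False using hf[of z1] z1 by simp
  qed
  then obtain z0 where z0: "f z0 \<noteq> 0" by blast
  obtain C d where C: "C \<ge> 0" "\<And>z. norm z \<ge> 1 \<Longrightarrow> norm (f z) \<le> exp (C * norm z ^ d)"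
    using exp_sum_growth[of "insert i (insert k J)" P Q] insert.hyps unfolding f_def by auto
  have "circle_mean_bound (\<lambda>z. log_plus (norm (deriv f z / f z))) ln"
    by (rule log_derivative_lemma[OF fholo z0 C])
  then have "circle_mean_bound (\<lambda>z. log_plus (norm (exp (poly (Q i) z) / h z)) +
      (ln 2 + ((log_plus (norm (poly (P k) z)) + log_plus (norm (deriv f z / f z))) +
      log_plus (norm (poly U z))))) ln"
    by (intro circle_mean_bound_add circle_mean_bound_log_plus_poly circle_mean_bound_ln_const IH(2))
  then have "circle_mean_bound (\<lambda>z. log_plus (norm (exp (poly (Q i) z) / f z))) ln"
  proof (rule circle_mean_bound_mono[where R = 1])
    fix r :: real assume r: "r \<ge> 1"
    define T where "T = {t \<in> {0..2*pi}. f (of_real r * cis t) = 0} \<union> {t \<in> {0..2*pi}. h (of_real r * cis t) = 0}"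
    have "finite T" unfolding T_def
      using finite_zeros_circle[OF fholo z0, of r] finite_zeros_circle[OF hholo z1, of r] r by auto
    moreover have "log_plus (norm (exp (poly (Q i) z) / f z)) \<le> log_plus (norm (exp (poly (Q i) z) / h z)) +
      (ln 2 + ((log_plus (norm (poly (P k) z)) + log_plus (norm (deriv f z / f z))) +
      log_plus (norm (poly U z))))" if nz: "f z \<noteq> 0" "h z \<noteq> 0" for z
    proof -
      \<comment> \<open>The quotient splits as \<open>exp (Q i) / h\<close>, bounded by induction,
        times \<open>h / f\<close>, which involves \<open>f\<close> only through its logarithmic
        derivative.\<close>
      have "log_plus (norm (exp (poly (Q i) z) / f z)) = log_plus (norm (exp (poly (Q i) z) / h z) * norm (h z / f z))"
        using nz by (simp add: norm_divide)
      also have "\<dots> \<le> log_plus (norm (exp (poly (Q i) z) / h z)) + log_plus (norm (h z / f z))"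
        by (intro log_plus_mult) auto
      also have "h z / f z = poly (P k) z * (deriv f z / f z) - poly U z"
        using nz by (simp add: hf field_simps)
      also have "log_plus (norm (poly (P k) z * (deriv f z / f z) - poly U z)) \<le>
          log_plus (norm (poly (P k) z) * norm (deriv f z / f z) + norm (poly U z))"
        by (intro log_plus_mono order_trans[OF norm_triangle_ineq4]) (simp add: norm_mult norm_divide)
      also have "\<dots> \<le> ln 2 + log_plus (norm (poly (P k) z) * norm (deriv f z / f z)) + log_plus (norm (poly U z))"
        by (rule log_plus_add)
      also have "log_plus (norm (poly (P k) z) * norm (deriv f z / f z)) \<le>
          log_plus (norm (poly (P k) z)) + log_plus (norm (deriv f z / f z))"
        by (intro log_plus_mult) auto
      finally show ?thesis by simp
    qed
    ultimately show "\<exists>T. finite T \<and> (\<forall>t\<in>{0..2*pi} - T.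
        log_plus (norm (exp (poly (Q i) (of_real r * cis t)) / f (of_real r * cis t))) \<le>
        log_plus (norm (exp (poly (Q i) (of_real r * cis t)) / h (of_real r * cis t))) +
      (ln 2 + ((log_plus (norm (poly (P k) (of_real r * cis t))) +
         log_plus (norm (deriv f (of_real r * cis t) / f (of_real r * cis t)))) +
      log_plus (norm (poly U (of_real r * cis t))))))"
      by (intro exI[of _ T]) (auto simp: T_def)
  qed
  then show ?case using z0 unfolding f_def by blast
qed

section \<open>Cauchy's perimeter formula\<close>

text \<open>An antiderivative on the line grows by the same constant \<open>c\<close> over each
  period. The argument \<open>q * t + \<gamma>\<close> runs through \<open>q\<close> periods, and
  the chain rule divides by \<open>q\<close>.\<close>

lemma periodic_has_integral:
  fixes g :: "real \<Rightarrow> real" and q :: nat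
  assumes cont: "continuous_on UNIV g" and per: "\<And>x. g (x + 2 * pi) = g x" and q: "q \<ge> 1"
  shows "((\<lambda>t. g (real q * t + \<gamma>)) has_integral integral {0..2*pi} g) {0..2*pi}"
proof -
  obtain G where G: "\<And>x. (G has_real_derivative g x) (at x)"
    using einterval_antiderivative[of "-\<infinity>" "\<infinity>" g] cont
    by (auto simp: continuous_on_eq_continuous_at has_real_derivative_iff_has_vector_derivative)
  define c where "c = G (2 * pi) - G 0"
  have step: "G (x + 2 * pi) = G x + c" for x
  proof -
    have "((\<lambda>x. G (x + 2 * pi) - G x) has_real_derivative 0) (at x)" for x
    proof -
      have "((\<lambda>x. G (x + 2 * pi)) has_real_derivative g (x + 2 * pi)) (at x)"
        using DERIV_shift[of G "g (x + 2 * pi)" x "2 * pi"] G by (simp add: add_ac)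
      from DERIV_diff[OF this G[of x]] show ?thesis by (simp add: per)
    qed
    then have "G (x + 2 * pi) - G x = G (0 + 2 * pi) - G 0"
      by (rule DERIV_isconst_all[rule_format])
    then show ?thesis by (simp add: c_def)
  qed
  have steps: "G (x + real n * (2 * pi)) = G x + real n * c" for x n
  proof (induction n)
    case (Suc n)
    have "G (x + real (Suc n) * (2 * pi)) = G ((x + real n * (2 * pi)) + 2 * pi)"
      by (simp add: algebra_simps)
    also have "\<dots> = G x + real n * c + c" by (simp only: step Suc)
    finally show ?case by (simp add: algebra_simps)
  qed simp
  have int: "((\<lambda>t. g (real n * t + \<gamma>)) has_integral (G (real n * (2 * pi) + \<gamma>) / n - G (real n * 0 + \<gamma>) / n)) {0..2*pi}"
    if "n \<ge> 1" for n \<gamma>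
  proof (rule fundamental_theorem_of_calculus)
    fix x
    have "((\<lambda>t. G (real n * t + \<gamma>)) has_real_derivative g (real n * x + \<gamma>) * real n) (at x within {0..2*pi})"
      by (rule DERIV_chain2[OF G]) (auto intro!: derivative_eq_intros)
    from DERIV_cdivide[OF this, of "real n"]
    show "((\<lambda>t. G (real n * t + \<gamma>) / real n) has_vector_derivative g (real n * x + \<gamma>)) (at x within {0..2*pi})"
      using that by (simp add: has_real_derivative_iff_has_vector_derivative)
  qed simp
  have "(g has_integral c) {0..2*pi}" using int[of 1 0] by (simp add: c_def)
  then have "integral {0..2*pi} g = c" by (rule integral_unique)
  moreover have "G (real q * (2 * pi) + \<gamma>) / q - G (real q * 0 + \<gamma>) / q = c"
    using steps[of \<gamma> q] q by (simp add: field_simps)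
  ultimately show ?thesis using int[OF q, of \<gamma>] by simp
qed

lemma has_integral_abs_cos: "((\<lambda>t. \<bar>cos t\<bar>) has_integral 4) {0..2*pi}"
proof -
  have "((\<lambda>t. \<bar>sin t\<bar>) has_integral (- cos pi - (- cos 0)) + (cos (2*pi) - cos pi)) {0..2*pi}"
  proof (rule has_integral_combine[where c = pi])
    have "(sin has_integral (- cos pi - (- cos 0))) {0..pi}"
      by (rule fundamental_theorem_of_calculus)
         (auto intro!: derivative_eq_intros simp: has_real_derivative_iff_has_vector_derivative[symmetric])
    then show "((\<lambda>t. \<bar>sin t\<bar>) has_integral (- cos pi - (- cos 0))) {0..pi}"
      by (rule has_integral_eq[rotated]) (auto simp: sin_ge_zero)
    have "((\<lambda>t. - sin t) has_integral (cos (2*pi) - cos pi)) {pi..2*pi}"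
      by (rule fundamental_theorem_of_calculus)
         (auto intro!: derivative_eq_intros simp: has_real_derivative_iff_has_vector_derivative[symmetric])
    then show "((\<lambda>t. \<bar>sin t\<bar>) has_integral (cos (2*pi) - cos pi)) {pi..2*pi}"
      by (rule has_integral_eq[rotated]) (use sin_le_zero in \<open>force simp: abs_if\<close>)
  qed auto
  then have "integral {0..2*pi} (\<lambda>t. \<bar>sin t\<bar>) = 4" by (intro integral_unique) simp
  moreover have "((\<lambda>t. \<bar>sin (real 1 * t + pi/2)\<bar>) has_integral integral {0..2*pi} (\<lambda>t. \<bar>sin t\<bar>)) {0..2*pi}"
    by (intro periodic_has_integral) (auto intro!: continuous_intros)
  ultimately show ?thesis by (simp add: sin_add)
qed

text \<open>The integrand is \<open>norm c\<close> times the absolute cosine of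
  \<open>t - Arg c\<close>, and the shift does not affect the integral. It measures the projection
  of a segment with direction vector \<open>c\<close> onto all directions.\<close>

lemma has_integral_abs_inner_cis: "((\<lambda>t. \<bar>c \<bullet> cis t\<bar>) has_integral 4 * norm c) {0..2*pi}"
proof -
  have "((\<lambda>t. norm c * \<bar>cos (real 1 * t + - Arg c)\<bar>) has_integral norm c * integral {0..2*pi} (\<lambda>t. \<bar>cos t\<bar>)) {0..2*pi}"
    by (intro has_integral_mult_right periodic_has_integral) (auto intro!: continuous_intros)
  moreover have "integral {0..2*pi} (\<lambda>t. \<bar>cos t\<bar>) = 4" using has_integral_abs_cos by (rule integral_unique)
  moreover have "norm c * \<bar>cos (real 1 * t + - Arg c)\<bar> = \<bar>c \<bullet> cis t\<bar>" for t
  proof -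
    have c: "c = rcis (norm c) (Arg c)" by (simp add: rcis_cmod_Arg)
    have "c \<bullet> cis t = norm c * cos (Arg c) * cos t + norm c * sin (Arg c) * sin t"
      by (subst c) (simp add: inner_complex_def del: rcis_cmod_Arg)
    also have "\<dots> = norm c * cos (t - Arg c)" by (simp add: cos_diff algebra_simps)
    finally show ?thesis by (simp add: abs_mult)
  qed
  ultimately show ?thesis by (simp only: mult.commute[of _ 4])
qed

section \<open>Support functions of finite planar sets and edges of their convex hulls\<close>

lemma continuous_on_Max_image:
  fixes f :: "'i \<Rightarrow> 'a::topological_space \<Rightarrow> real"
  assumes "finite I" "I \<noteq> {}" "\<And>i. i \<in> I \<Longrightarrow> continuous_on S (f i)"
  shows "continuous_on S (\<lambda>x. Max ((\<lambda>i. f i x) ` I))"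
  using assms
proof (induction I rule: finite_ne_induct)
  case (insert i I)
  have "(\<lambda>x. Max ((\<lambda>i. f i x) ` insert i I)) = (\<lambda>x. max (f i x) (Max ((\<lambda>i. f i x) ` I)))"
    using insert.hyps by auto
  then show ?case using insert by (auto intro!: continuous_on_max)
qed auto

text \<open>The support function of the convex hull of \<open>V\<close>, encoded by the finite
  generating set so that the supremum is a maximum; a linear functional attains its maximum over the
  hull on \<open>V\<close>.\<close>

definition support_fun :: "'a::real_inner set \<Rightarrow> 'a \<Rightarrow> real" where
  "support_fun V u = Max ((\<lambda>v. v \<bullet> u) ` V)"

lemma inner_le_support_fun_hull:
  assumes "finite V" "x \<in> convex hull V"
  shows "x \<bullet> u \<le> support_fun V u"
proof -
  have "convex hull V \<subseteq> {x. u \<bullet> x \<le> support_fun V u}"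
    using assms(1) by (intro hull_minimal convex_halfspace_le) (auto simp: support_fun_def inner_commute[of u])
  then show ?thesis using assms(2) by (auto simp: inner_commute)
qed

lemma support_fun_attained:
  assumes "finite V" "V \<noteq> {}"
  obtains v where "v \<in> V" "v \<bullet> u = support_fun V u"
  using Max_in[of "(\<lambda>v. v \<bullet> u) ` V"] assms unfolding support_fun_def
  by (metis (no_types, lifting) finite_imageI image_iff image_is_empty)

lemma diameter_closed_segment:
  fixes a b :: "'a::euclidean_space"
  shows "diameter (closed_segment a b) = norm (b - a)"
proof (rule antisym)
  show "diameter (closed_segment a b) \<le> norm (b - a)"
    by (rule diameter_le) (auto simp: dist_norm[symmetric] intro: dist_in_closed_segment order_trans, metis dist_commute dist_decreases_closed_segment dist_in_closed_segment order_trans segment_bound(2) dist_norm)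
  show "norm (b - a) \<le> diameter (closed_segment a b)"
    using diameter_bounded_bound[of "closed_segment a b" b a] bounded_closed_segment[of a b]
    by (simp add: dist_norm)
qed

lemma polytope_aff_dim_le_1:
  assumes "polytope S" "aff_dim S \<le> 1" "S \<noteq> {}"
  obtains a b where "S = closed_segment a b"
  using compact_convex_collinear_segment[of S] assms polytope_imp_compact polytope_imp_convex collinear_aff_dim
  by metis

text \<open>
  A line perpendicular to \<open>u\<close> that meets the interior but no vertex crosses the boundary in two
  points, which lie on different edges and on no other edge.
\<close>
lemma card_edges_meeting_line:
  fixes V :: "complex set"
  assumes V: "finite V" and dim: "aff_dim (convex hull V) = 2" and u: "u \<noteq> 0"
    and s: "s < support_fun V u" "- support_fun V (- u) < s" "s \<notin> (\<lambda>v. v \<bullet> u) ` V"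
  shows "card {e. e edge_of (convex hull V) \<and> s \<in> (\<lambda>x. x \<bullet> u) ` e} = 2"
proof -
  define K where "K = convex hull V"
  have K: "polytope K" "convex K" "compact K" "bounded K" "closed K"
    using V by (auto simp: K_def polytope_convex_hull finite_imp_compact compact_convex_hull
        compact_imp_bounded compact_imp_closed)
  have ne: "V \<noteq> {}" using dim by auto
  have dimK: "aff_dim K = 2" by (simp only: K_def dim)
  then have int: "rel_interior K = interior K"
    using aff_dim_eq_full[of K] by (intro rel_interior_interior) simp
  have intne: "interior K \<noteq> {}"
    using int K(2) ne rel_interior_eq_empty[OF K(2)] by (auto simp: K_def)
  \<comment> \<open>The relative boundary of a polytope is the union of its facets, and in dimension
    two the facets are the edges.\<close>
  have front: "frontier K = \<Union>{e. e edge_of K}"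
  proof -
    have "rel_frontier K = \<Union>{F. F facet_of K}"
      using K(1) by (intro rel_frontier_of_polyhedron polytope_imp_polyhedron)
    moreover have "rel_frontier K = frontier K" by (simp add: rel_frontier_def frontier_def int)
    moreover have "F facet_of K \<longleftrightarrow> F edge_of K" for F
      using dim by (auto simp: facet_of_def edge_of_def K_def)
    ultimately show ?thesis by simp
  qed
  obtain p where p: "p \<in> interior K" using intne by auto
  \<comment> \<open>On a segment from an interior point \<open>p\<close> to a point of
    \<open>K\<close>, everything before the endpoint is interior; \<open>\<mu>\<close> selects the
    point at level \<open>s\<close>.\<close>
  have cross: "\<exists>x\<in>interior K. x \<bullet> u = s" if b: "b \<in> K" and st: "(p \<bullet> u < s \<and> s < b \<bullet> u) \<or> (b \<bullet> u < s \<and> s < p \<bullet> u)" for b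
  proof -
    define \<mu> where "\<mu> = (s - p \<bullet> u) / (b \<bullet> u - p \<bullet> u)"
    have l: "0 < \<mu>" "\<mu> < 1" using st by (auto simp: \<mu>_def field_simps)
    have "p \<noteq> b" using st by auto
    then have "(1 - \<mu>) *\<^sub>R p + \<mu> *\<^sub>R b \<in> open_segment p b"
      using l by (auto simp: in_segment)
    then have "(1 - \<mu>) *\<^sub>R p + \<mu> *\<^sub>R b \<in> interior K"
      using in_interior_closure_convex_segment[OF K(2) p, of b] b closure_subset by blast
    moreover have "((1 - \<mu>) *\<^sub>R p + \<mu> *\<^sub>R b) \<bullet> u = p \<bullet> u + \<mu> * (b \<bullet> u - p \<bullet> u)"
      by (simp add: inner_add_left algebra_simps)
    then have "((1 - \<mu>) *\<^sub>R p + \<mu> *\<^sub>R b) \<bullet> u = s" using st by (auto simp: \<mu>_def)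
    ultimately show ?thesis by blast
  qed
  obtain x0 where x0: "x0 \<in> interior K" "x0 \<bullet> u = s"
  proof -
    obtain vmax where vmax: "vmax \<in> V" "vmax \<bullet> u = support_fun V u"
      using support_fun_attained[OF V ne] by blast
    obtain vmin where vmin: "vmin \<in> V" "vmin \<bullet> - u = support_fun V (- u)"
      using support_fun_attained[OF V ne] by blast
    have "vmax \<in> K" "vmin \<in> K" using vmax vmin by (auto simp: K_def hull_inc)
    then show thesis using that p cross[of vmax] cross[of vmin] vmax(2) vmin(2) s
      by (cases "p \<bullet> u" s rule: linorder_cases) auto
  qed
  \<comment> \<open>A quarter turn of \<open>u\<close>, so \<open>l\<close> spans the direction of
    the line at level \<open>s\<close>.\<close>
  define l where "l = \<i> * u"
  have l: "l \<noteq> 0" "- l \<noteq> 0" "l \<bullet> u = 0" using u by (auto simp: l_def inner_complex_def)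
  have perp: "\<exists>c. y = x0 + c *\<^sub>R l" if "y \<bullet> u = s" for y
  proof -
    define w where "w = y - x0"
    have w: "Re w * Re u + Im w * Im u = 0"
      using that x0(2) by (simp add: w_def inner_complex_def algebra_simps)
    define c where "c = (Im w * Re u - Re w * Im u) / ((Re u)\<^sup>2 + (Im u)\<^sup>2)"
    have pos: "(Re u)\<^sup>2 + (Im u)\<^sup>2 \<noteq> 0" using u by (simp add: sum_power2_eq_zero_iff complex_eq_iff)
    have "Re w * ((Re u)\<^sup>2 + (Im u)\<^sup>2) = - Im u * (Im w * Re u - Re w * Im u)"
      using w by algebra
    moreover have "Im w * ((Re u)\<^sup>2 + (Im u)\<^sup>2) = Re u * (Im w * Re u - Re w * Im u)"
      using w by algebra
    ultimately have "w = c *\<^sub>R l"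
      using pos by (simp add: complex_eq_iff c_def l_def field_simps)
    then show ?thesis by (intro exI[of _ c]) (simp add: w_def algebra_simps)
  qed
  obtain d1 where d1: "d1 > 0" "x0 + d1 *\<^sub>R l \<in> frontier K" "\<And>e. 0 \<le> e \<Longrightarrow> e < d1 \<Longrightarrow> x0 + e *\<^sub>R l \<in> interior K"
    using ray_to_frontier[OF K(4) x0(1) l(1)] by blast
  obtain d2 where d2: "d2 > 0" "x0 + d2 *\<^sub>R (- l) \<in> frontier K" "\<And>e. 0 \<le> e \<Longrightarrow> e < d2 \<Longrightarrow> x0 + e *\<^sub>R (- l) \<in> interior K"
    using ray_to_frontier[OF K(4) x0(1) l(2)] by blast
  define y1 where "y1 = x0 + d1 *\<^sub>R l"
  define y2 where "y2 = x0 + d2 *\<^sub>R (- l)"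
  have yu: "y1 \<bullet> u = s" "y2 \<bullet> u = s" using x0(2) l(3) by (simp_all add: y1_def y2_def inner_add_left inner_diff_left)
  have no_int: "z \<notin> interior K" if "e edge_of K" "z \<in> e" for e z
    using that front by (force simp: frontier_def)
  \<comment> \<open>A boundary point on a ray from \<open>x0\<close> is the last point of
    \<open>K\<close> on it: otherwise it would lie strictly between an interior point and a point of
    \<open>K\<close>, hence be interior.\<close>
  have beyond: "c \<le> d" if "0 < d" "x0 + d *\<^sub>R k \<in> frontier K" "x0 + c *\<^sub>R k \<in> K" "k \<noteq> 0" for c d and k :: complex
  proof (rule ccontr)
    assume "\<not> c \<le> d"
    then have cd: "d < c" by simp
    have "x0 + d *\<^sub>R k = (1 - d / c) *\<^sub>R x0 + (d / c) *\<^sub>R (x0 + c *\<^sub>R k)"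
      using cd that(1) by (simp add: algebra_simps)
    moreover have "0 < d / c" "d / c < 1" using cd that(1) by auto
    moreover have "x0 \<noteq> x0 + c *\<^sub>R k" using that(1,4) cd by simp
    ultimately have "x0 + d *\<^sub>R k \<in> open_segment x0 (x0 + c *\<^sub>R k)"
      unfolding in_segment by blast
    then have "x0 + d *\<^sub>R k \<in> interior K"
      using in_interior_closure_convex_segment[OF K(2) x0(1)] that(3) closure_subset by blast
    then show False using that(2) by (simp add: frontier_def)
  qed
  have on_line: "y = y1 \<or> y = y2" if y_e: "e edge_of K" "y \<in> e" and y_u: "y \<bullet> u = s" for e y
  proof -
    obtain c where c: "y = x0 + c *\<^sub>R l" using perp[OF y_u] by blast
    have yK: "y \<in> K" using y_e edge_of_imp_subset by blast
    have yi: "y \<notin> interior K" by (rule no_int[OF y_e])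
    show ?thesis
    proof (cases "c \<ge> 0")
      case True
      then have "c \<ge> d1" using d1(3)[of c] yi c by (meson not_le)
      moreover have "c \<le> d1" using beyond[OF d1(1,2)] yK c l(1) by simp
      ultimately show ?thesis by (simp add: c y1_def)
    next
      case False
      have y: "y = x0 + (- c) *\<^sub>R (- l)" using c by simp
      have "- c \<ge> d2" using d2(3)[of "- c"] yi y False by (meson not_le neg_0_le_iff_le nle_le)
      moreover have "- c \<le> d2" using beyond[OF d2(1,2)] yK y l(2) by metis
      ultimately have "- c = d2" by simp
      then show ?thesis by (metis y y2_def)
    qed
  qed
  \<comment> \<open>Two different edges meet in a proper face of an edge. If that face is nonempty,
    it is a single extreme point, hence an element of \<open>V\<close>, and the level
    \<open>s\<close> avoids \<open>V\<close>.\<close>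
  have unique: "e = e'" if e: "e edge_of K" "e' edge_of K" "y \<in> e" "y \<in> e'" "y \<bullet> u = s" for e e' y
  proof (rule ccontr)
    assume neq: "e \<noteq> e'"
    have conv: "convex e" "convex e'" using e by (auto simp: edge_of_def intro: face_of_imp_convex)
    have face: "e \<inter> e' face_of K" using e by (auto simp: edge_of_def intro: face_of_Int)
    have "e \<inter> e' face_of e"
      using face e(1) by (intro face_of_subset[OF face]) (auto simp: edge_of_imp_subset)
    moreover have "e \<inter> e' \<noteq> e"
    proof
      assume "e \<inter> e' = e"
      then have "e \<subseteq> e'" by blast
      moreover have "e face_of K" "e' \<subseteq> K" using e(1,2) by (auto simp: edge_of_def dest: face_of_imp_subset)
      ultimately have "e face_of e'" by (intro face_of_subset[of e K e'])
      then have "aff_dim e < aff_dim e'" using neq conv by (intro face_of_aff_dim_lt) auto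
      then show False using e by (simp add: edge_of_def)
    qed
    ultimately have "aff_dim (e \<inter> e') < aff_dim e" using conv by (intro face_of_aff_dim_lt) auto
    then have "aff_dim (e \<inter> e') < 1" using e by (simp add: edge_of_def)
    moreover have "aff_dim (e \<inter> e') \<ge> 0" using e by (metis IntI aff_dim_negative_iff empty_iff not_le)
    ultimately have "aff_dim (e \<inter> e') = 0" by simp
    then obtain x where "e \<inter> e' = {x}" by (auto simp: aff_dim_eq_0)
    moreover have "y \<in> e \<inter> e'" using e by simp
    ultimately have "e \<inter> e' = {y}" by simp
    then have "y extreme_point_of K" using face face_of_singleton by metis
    then have "y \<in> V" unfolding K_def by (rule extreme_point_of_convex_hull)
    then show False using e(5) s(3) by auto
  qed
  obtain e1 where e1: "e1 edge_of K" "y1 \<in> e1" using d1(2) front by (auto simp: y1_def)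
  obtain e2 where e2: "e2 edge_of K" "y2 \<in> e2" using d2(2) front by (auto simp: y2_def)
  \<comment> \<open>A common edge would contain the segment from \<open>y1\<close> to
    \<open>y2\<close>, hence the interior point \<open>x0\<close>.\<close>
  have "e1 \<noteq> e2"
  proof
    assume "e1 = e2"
    then have seg: "closed_segment y1 y2 \<subseteq> e1"
      using e1 e2 closed_segment_subset[of y1 e1 y2] by (auto simp: edge_of_def face_of_imp_convex)
    have "x0 = (1 - d1 / (d1 + d2)) *\<^sub>R y1 + (d1 / (d1 + d2)) *\<^sub>R y2"
    proof -
      have "(1 - d1 / (d1 + d2)) * d1 = d1 / (d1 + d2) * d2"
        using d1(1) d2(1) by (simp add: field_simps)
      then have "((1 - d1 / (d1 + d2)) * d1) *\<^sub>R l = (d1 / (d1 + d2) * d2) *\<^sub>R l" by simp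
      then show ?thesis
        unfolding y1_def y2_def scaleR_add_right scaleR_minus_right scaleR_scaleR scaleR_diff_left
        by (simp add: algebra_simps)
    qed
    moreover have "0 \<le> d1 / (d1 + d2)" "d1 / (d1 + d2) \<le> 1" using d1(1) d2(1) by auto
    ultimately have "x0 \<in> closed_segment y1 y2" unfolding in_segment by blast
    then show False using seg no_int[OF e1(1)] x0(1) by blast
  qed
  moreover have "{e. e edge_of K \<and> s \<in> (\<lambda>x. x \<bullet> u) ` e} = {e1, e2}"
  proof (intro equalityI subsetI)
    fix e assume "e \<in> {e. e edge_of K \<and> s \<in> (\<lambda>x. x \<bullet> u) ` e}"
    then obtain y where e: "e edge_of K" and y: "y \<in> e" "y \<bullet> u = s" by auto
    from on_line[OF e y] show "e \<in> {e1, e2}"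
      using unique[OF e e1(1) y(1) _ y(2)] unique[OF e e2(1) y(1) _ y(2)] e1(2) e2(2) by auto
  next
    fix e assume "e \<in> {e1, e2}"
    then show "e \<in> {e. e edge_of K \<and> s \<in> (\<lambda>x. x \<bullet> u) ` e}"
      using e1 e2 yu by (auto simp: image_iff intro: sym)
  qed
  ultimately show ?thesis by (simp add: K_def)
qed


text \<open>Double counting over the levels \<open>s\<close>: integrating the number of edges that
  meet the line at level \<open>s\<close> gives the sum of the projected edge lengths, while this
  number is 2 for all but finitely many levels between the minimum and the maximum of the
  projection.\<close>

lemma sum_edge_projections:
  fixes V :: "complex set"
  assumes V: "finite V" and dim: "aff_dim (convex hull V) = 2" and u: "u \<noteq> 0"
    and ab: "\<And>e. e edge_of (convex hull V) \<Longrightarrow> e = closed_segment (a e) (b e)"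
  shows "(\<Sum>e | e edge_of (convex hull V). \<bar>(b e - a e) \<bullet> u\<bar>) = 2 * (support_fun V u + support_fun V (- u))"
proof -
  define K where "K = convex hull V"
  define E where "E = {e. e edge_of K}"
  define A where "A = - support_fun V (- u)"
  define B where "B = support_fun V u"
  have fin: "finite E"
    unfolding E_def edge_of_def
    by (rule finite_subset[OF _ finite_polytope_faces[of K]]) (auto simp: K_def V polytope_convex_hull)
  have bounds: "A \<le> x \<bullet> u" "x \<bullet> u \<le> B" if "x \<in> K" for x
    using inner_le_support_fun_hull[OF V, of x u] inner_le_support_fun_hull[OF V, of x "- u"] that
    by (auto simp: A_def B_def K_def)
  obtain v where "v \<in> V" using dim by fastforce
  then have "v \<in> K" by (simp add: K_def hull_inc)
  then have AB: "A \<le> B" using bounds[of v] by linarith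
  define ind where "ind = (\<lambda>e s. if s \<in> (\<lambda>x. x \<bullet> u) ` e then 1 else 0 :: real)"
  have ind: "(ind e has_integral \<bar>(b e - a e) \<bullet> u\<bar>) {A..B}" if "e \<in> E" for e
  proof -
    have e: "e = closed_segment (a e) (b e)" "e \<subseteq> K"
      using that ab edge_of_imp_subset by (auto simp: E_def K_def)
    have lin: "linear (\<lambda>x. x \<bullet> u)" by (intro bounded_linear.linear bounded_linear_inner_left)
    define lo where "lo = min (a e \<bullet> u) (b e \<bullet> u)"
    define hi where "hi = max (a e \<bullet> u) (b e \<bullet> u)"
    have lohi: "lo \<le> hi" by (auto simp: lo_def hi_def)
    have img: "(\<lambda>x. x \<bullet> u) ` e = {lo..hi}"
      by (subst e(1), subst closed_segment_linear_image[OF lin, symmetric])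
         (auto simp: closed_segment_eq_real_ivl lo_def hi_def)
    have "a e \<in> e" "b e \<in> e" by (subst e(1), simp)+
    then have sub: "{lo..hi} \<subseteq> {A..B}"
      using bounds[of "a e"] bounds[of "b e"] e(2) by (auto simp: lo_def hi_def)
    have "((\<lambda>s. 1) has_integral (hi - lo)) {lo..hi}"
      using has_integral_const_real[of "1::real" lo hi] lohi by simp
    then have "((\<lambda>s. if s \<in> {lo..hi} then 1 else 0) has_integral (hi - lo)) {A..B}"
      using has_integral_restrict[OF sub, of "\<lambda>s. 1 :: real"] by blast
    moreover have "hi - lo = \<bar>(b e - a e) \<bullet> u\<bar>" by (auto simp: hi_def lo_def inner_diff_left)
    ultimately show ?thesis by (simp add: ind_def img)
  qed
  have "((\<lambda>s. \<Sum>e\<in>E. ind e s) has_integral (\<Sum>e\<in>E. \<bar>(b e - a e) \<bullet> u\<bar>)) {A..B}"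
    using fin ind by (rule has_integral_sum)
  moreover have "((\<lambda>s. \<Sum>e\<in>E. ind e s) has_integral (B - A) * 2) {A..B}"
  proof (rule has_integral_spike_finite)
    show "finite ({A, B} \<union> (\<lambda>v. v \<bullet> u) ` V)" using V by simp
    show "((\<lambda>s. 2) has_integral (B - A) * 2) {A..B}"
      using has_integral_const_real[of "2::real" A B] AB by simp
    fix s assume s: "s \<in> {A..B} - ({A, B} \<union> (\<lambda>v. v \<bullet> u) ` V)"
    have "(\<Sum>e\<in>E. ind e s) = real (card {e \<in> E. s \<in> (\<lambda>x. x \<bullet> u) ` e})"
      using fin by (simp add: ind_def sum.If_cases Int_def)
    also have "{e \<in> E. s \<in> (\<lambda>x. x \<bullet> u) ` e} = {e. e edge_of (convex hull V) \<and> s \<in> (\<lambda>x. x \<bullet> u) ` e}"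
      by (auto simp: E_def K_def)
    also have "card \<dots> = 2"
      using s by (intro card_edges_meeting_line[OF V dim u]) (auto simp: A_def B_def)
    finally show "(\<Sum>e\<in>E. ind e s) = 2" by simp
  qed
  ultimately have "(\<Sum>e\<in>E. \<bar>(b e - a e) \<bullet> u\<bar>) = (B - A) * 2" by (rule has_integral_unique)
  then show ?thesis by (simp add: E_def K_def A_def B_def)
qed

lemma continuous_on_support_fun:
  fixes f :: "'b::topological_space \<Rightarrow> 'a::real_inner"
  assumes "finite V" "V \<noteq> {}" "continuous_on S f"
  shows "continuous_on S (\<lambda>x. support_fun V (f x))"
  unfolding support_fun_def using assms by (intro continuous_on_Max_image continuous_intros) auto

text \<open>Adding the support function at \<open>t\<close> and at \<open>t + pi\<close> gives the
  width, whose integral is twice the integral \<open>J\<close> sought. Twice the width is the sum of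
  the edge projections, and each edge integrates to 4 times its length, so \<open>4 * J\<close> is 4
  times the perimeter. For a segment the width is a single projection and
  \<open>2 * J = 4 * norm (b - a)\<close>, in accordance with counting a segment twice.\<close>

theorem support_fun_has_integral_circumference:
  fixes V :: "complex set"
  assumes V: "finite V" "V \<noteq> {}" and q: "q \<ge> 1"
  shows "((\<lambda>t. support_fun V (cis (real q * t))) has_integral circumference (convex hull V)) {0..2*pi}"
proof -
  define K where "K = convex hull V"
  define g where "g = (\<lambda>t. support_fun V (cis t))"
  define J where "J = integral {0..2*pi} g"
  have cont: "continuous_on UNIV g"
    unfolding g_def by (intro continuous_on_support_fun V continuous_intros)
  have per: "g (x + 2 * pi) = g x" for x
  proof -
    have "cis (x + 2 * pi) = cis x" by (simp add: complex_eq_iff)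
    then show ?thesis by (simp add: g_def)
  qed
  have "((\<lambda>t. g (real 1 * t + 0)) has_integral J) {0..2*pi}"
    unfolding J_def by (rule periodic_has_integral[OF cont per]) simp
  moreover have "((\<lambda>t. g (real 1 * t + pi)) has_integral J) {0..2*pi}"
    unfolding J_def by (rule periodic_has_integral[OF cont per]) simp
  ultimately have "((\<lambda>t. g t + g (t + pi)) has_integral (J + J)) {0..2*pi}"
    by (intro has_integral_add) auto
  moreover have "g (t + pi) = support_fun V (- cis t)" for t
  proof -
    have "cis (t + pi) = - cis t" by (simp add: complex_eq_iff)
    then show ?thesis by (simp add: g_def)
  qed
  ultimately have width: "((\<lambda>t. support_fun V (cis t) + support_fun V (- cis t)) has_integral (J + J)) {0..2*pi}"
    by (simp add: g_def)
  have K: "polytope K" "K \<noteq> {}" using V by (auto simp: K_def polytope_convex_hull)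
  have "J = circumference K"
  proof (cases "aff_dim K \<le> 1")
    case True
    then obtain a b where ab: "K = closed_segment a b" using polytope_aff_dim_le_1[OF K(1) _ K(2)] by blast
    have "support_fun V u + support_fun V (- u) = \<bar>(b - a) \<bullet> u\<bar>" for u
    proof -
      \<comment> \<open>\<open>V\<close> may contain points inside the segment besides its
        endpoints; the maximum over \<open>V\<close> is still that over the endpoints.\<close>
      have hull: "support_fun V u' = max (a \<bullet> u') (b \<bullet> u')" for u'
      proof (rule antisym)
        obtain v where v: "v \<in> V" "v \<bullet> u' = support_fun V u'" using support_fun_attained[OF V] by blast
        then have "v \<in> closed_segment a b" using ab by (metis K_def hull_inc)
        then have "v \<in> convex hull {a, b}" by (simp add: segment_convex_hull)
        then have "v \<bullet> u' \<le> support_fun {a, b} u'" by (intro inner_le_support_fun_hull) auto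
        then show "support_fun V u' \<le> max (a \<bullet> u') (b \<bullet> u')" using v by (simp add: support_fun_def)
        have "a \<in> K" "b \<in> K" using ab by auto
        then show "max (a \<bullet> u') (b \<bullet> u') \<le> support_fun V u'"
          using inner_le_support_fun_hull[OF V(1)] by (simp add: K_def)
      qed
      show ?thesis unfolding hull by (auto simp: inner_diff_left max_def)
    qed
    then have "((\<lambda>t. \<bar>(b - a) \<bullet> cis t\<bar>) has_integral (J + J)) {0..2*pi}" using width by simp
    then have "J + J = 4 * norm (b - a)" using has_integral_abs_inner_cis has_integral_unique by blast
    then show ?thesis using True ab by (simp add: circumference_def diameter_closed_segment)
  next
    case False
    have "aff_dim K \<le> 2" using aff_dim_le_DIM[of K] by simp
    then have dim: "aff_dim (convex hull V) = 2" using False by (simp only: K_def)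
    define E where "E = {e. e edge_of K}"
    have "\<exists>a b. e = closed_segment a b" if "e edge_of K" for e
    proof -
      have "polytope e" "aff_dim e \<le> 1" "e \<noteq> {}"
        using that K(1) by (auto simp: edge_of_def intro: face_of_polytope_polytope)
      then show ?thesis using polytope_aff_dim_le_1 by metis
    qed
    then obtain a b where ab: "\<And>e. e edge_of K \<Longrightarrow> e = closed_segment (a e) (b e)" by metis
    have "(\<Sum>e\<in>E. \<bar>(b e - a e) \<bullet> cis t\<bar>) = 2 * (support_fun V (cis t) + support_fun V (- cis t))" for t
      unfolding E_def K_def using ab by (intro sum_edge_projections V dim) (auto simp: K_def)
    moreover have fin: "finite E"
      unfolding E_def edge_of_def by (rule finite_subset[OF _ finite_polytope_faces[OF K(1)]]) auto
    then have "((\<lambda>t. \<Sum>e\<in>E. \<bar>(b e - a e) \<bullet> cis t\<bar>) has_integral (\<Sum>e\<in>E. 4 * norm (b e - a e))) {0..2*pi}"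
      by (intro has_integral_sum has_integral_abs_inner_cis)
    ultimately have "((\<lambda>t. 2 * (support_fun V (cis t) + support_fun V (- cis t))) has_integral
        (\<Sum>e\<in>E. 4 * norm (b e - a e))) {0..2*pi}" by simp
    moreover have "((\<lambda>t. 2 * (support_fun V (cis t) + support_fun V (- cis t))) has_integral 2 * (J + J)) {0..2*pi}"
      using width by (rule has_integral_mult_right)
    ultimately have "2 * (J + J) = (\<Sum>e\<in>E. 4 * norm (b e - a e))" by (rule has_integral_unique[rotated])
    also have "\<dots> = 4 * (\<Sum>e\<in>E. norm (b e - a e))" by (simp add: sum_distrib_left)
    also have "(\<Sum>e\<in>E. norm (b e - a e)) = (\<Sum>e\<in>E. diameter e)"
      using ab by (intro sum.cong refl) (metis E_def diameter_closed_segment mem_Collect_eq)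
    finally show ?thesis using False by (simp add: circumference_def E_def)
  qed
  moreover have "((\<lambda>t. g (real q * t + 0)) has_integral J) {0..2*pi}"
    unfolding J_def by (rule periodic_has_integral[OF cont per q])
  ultimately show ?thesis by (simp add: g_def K_def)
qed

section \<open>Jensen's formula\<close>

text \<open>The mean value property of the harmonic function \<open>ln (norm (h z))\<close>, read
  off from Cauchy's formula at the centre for a holomorphic logarithm of \<open>h\<close>.\<close>

lemma has_integral_ln_norm_zero_free:
  assumes h: "h holomorphic_on ball 0 R" "\<And>z. z \<in> ball 0 R \<Longrightarrow> h z \<noteq> 0" and r: "0 < r" "r < R"
  shows "((\<lambda>t. ln (norm (h (of_real r * cis t)))) has_integral 2 * pi * ln (norm (h 0))) {0..2*pi}"
proof -
  obtain L where L: "L holomorphic_on ball 0 R" "\<And>z. z \<in> ball 0 R \<Longrightarrow> h z = exp (L z)"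
    using contractible_imp_holomorphic_log[OF h(1) convex_imp_contractible[OF convex_ball] h(2)] by metis
  have Re_L: "ln (norm (h z)) = Re (L z)" if "z \<in> ball 0 R" for z using L(2)[OF that] by simp
  have "L holomorphic_on cball 0 r"
    by (rule holomorphic_on_subset[OF L(1)]) (use r in auto)
  then have "((\<lambda>u. L u / (u - 0)) has_contour_integral (2 * of_real pi * \<i> * L 0)) (circlepath 0 r)"
    by (rule Cauchy_integral_circlepath_simple) (use r in auto)
  then have "((\<lambda>t. L (0 + of_real r * cis t) / (0 + of_real r * cis t - 0) * of_real r * \<i> * cis t)
      has_integral (2 * of_real pi * \<i> * L 0)) {0..2*pi}"
    unfolding circlepath_def by (subst (asm) has_contour_integral_part_circlepath_iff) auto
  moreover have "L (0 + of_real r * cis t) / (0 + of_real r * cis t - 0) * of_real r * \<i> * cis t =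
      \<i> * L (of_real r * cis t)" for t
    using r by simp
  ultimately have "((\<lambda>t. \<i> * L (of_real r * cis t)) has_integral (2 * of_real pi * \<i> * L 0)) {0..2*pi}"
    by (simp only:)
  from has_integral_linear[OF this bounded_linear_Im]
  have "((\<lambda>t. Re (L (of_real r * cis t))) has_integral 2 * pi * Re (L 0)) {0..2*pi}"
    by (simp add: o_def)
  moreover have "of_real r * cis t \<in> ball 0 R" for t using r by (simp add: norm_mult)
  ultimately show ?thesis using Re_L[of 0] Re_L[of "of_real r * cis _"] r by simp
qed

text \<open>For \<open>a\<close> outside the circle, \<open>z - a\<close> is zero-free in the disc.
  For \<open>a\<close> inside, it is replaced by \<open>r - cnj a * z / r\<close>, which has the
  same modulus on the circle and no zero in the larger disc of radius \<open>r^2 / norm a\<close>,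
  the zero being moved by reflection in the circle.\<close>

lemma has_integral_ln_norm_diff:
  assumes r: "0 < r" and a: "a \<noteq> 0" "norm a \<noteq> r"
  shows "((\<lambda>t. ln (norm (of_real r * cis t - a))) has_integral 2 * pi * (ln (norm a) + max 0 (ln (r / norm a)))) {0..2*pi}"
proof (cases "r < norm a")
  case True
  have "((\<lambda>t. ln (norm (of_real r * cis t - a))) has_integral 2 * pi * ln (norm (0 - a))) {0..2*pi}"
    by (rule has_integral_ln_norm_zero_free[where R = "norm a"]) (use r True in \<open>auto intro!: holomorphic_intros\<close>)
  moreover have "max 0 (ln (r / norm a)) = 0" using True r a by (simp add: max_def)
  ultimately show ?thesis by simp
next
  case False
  define h where "h = (\<lambda>z. of_real r - cnj a / of_real r * z)"
  have nz: "h z \<noteq> 0" if "z \<in> ball 0 (r\<^sup>2 / norm a)" for z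
  proof
    assume "h z = 0"
    then have "of_real r = cnj a / of_real r * z" by (simp add: h_def)
    then have "r = norm a / r * norm z" using r by (metis abs_of_pos complex_mod_cnj norm_divide norm_mult norm_of_real)
    moreover have "norm z < r\<^sup>2 / norm a" using that by simp
    ultimately show False using r a by (simp add: field_simps power2_eq_square)
  qed
  have "((\<lambda>t. ln (norm (h (of_real r * cis t)))) has_integral 2 * pi * ln (norm (h 0))) {0..2*pi}"
  proof (rule has_integral_ln_norm_zero_free[OF _ nz r])
    show "h holomorphic_on ball 0 (r\<^sup>2 / norm a)" unfolding h_def by (intro holomorphic_intros)
    show "r < r\<^sup>2 / norm a" using False r a by (simp add: field_simps power2_eq_square)
  qed
  moreover have "norm (h (of_real r * cis t)) = norm (of_real r * cis t - a)" for t
  proof -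
    have "norm (of_real r * cis t - a) = norm ((of_real r * cis t - a) * cis (- t))" by (simp add: norm_mult)
    also have "\<dots> = norm (of_real r - a * cis (- t))" by (simp add: left_diff_distrib mult.assoc cis_mult)
    also have "\<dots> = norm (cnj (of_real r - a * cis (- t)))" by (simp only: complex_mod_cnj)
    also have "cnj (of_real r - a * cis (- t)) = h (of_real r * cis t)" using r by (simp add: h_def cis_cnj)
    finally show ?thesis by simp
  qed
  moreover have "norm (h 0) = r" using r by (simp add: h_def)
  moreover have "ln (norm a) + max 0 (ln (r / norm a)) = ln r"
    using False r a by (simp add: ln_div max_def)
  ultimately show ?thesis by simp
qed

section \<open>Counting function of the reciprocal in terms of the zeros, and Jensen's
  formula\<close>

lemma pole_inverse_of_factorization:
  fixes h :: "complex \<Rightarrow> complex"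
  assumes h: "h holomorphic_on UNIV" "h a \<noteq> 0" and f: "\<And>z. f z = (z - a) ^ k * h z"
  shows "zorder (\<lambda>z. 1 / f z) a = - int k" "is_pole (\<lambda>z. 1 / f z) a \<longleftrightarrow> k > 0"
proof -
  have op: "open {z. h z \<noteq> 0}"
    using open_Collect_neq[of h "\<lambda>_. 0"] h(1) holomorphic_on_imp_continuous_on by auto
  have hh: "(\<lambda>z. 1 / h z) holomorphic_on {z. h z \<noteq> 0}"
    by (intro holomorphic_intros holomorphic_on_subset[OF h(1)]) auto
  show "zorder (\<lambda>z. 1 / f z) a = - int k"
    by (rule zorder_eqI[OF op _ hh]) (use h f in \<open>auto simp: power_int_minus field_simps\<close>)
  have an: "(\<lambda>z. 1 / h z) analytic_on {a}" using hh op h(2) analytic_at by blast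
  have "is_pole (\<lambda>z. 1 / f z) a \<longleftrightarrow> is_pole (\<lambda>z. 1 / h z * (1 / (z - a) ^ k)) a"
    using f by (simp add: mult.commute)
  also have "\<dots> \<longleftrightarrow> is_pole (\<lambda>z. 1 / (z - a) ^ k) a"
    using h(2) by (intro is_pole_mult_analytic_nonzero1_iff an) auto
  also have "\<dots> \<longleftrightarrow> k > 0"
    using is_pole_inverse_power[of k a] not_is_pole_holomorphic[of UNIV a "\<lambda>_. 1"] by (cases "k = 0") auto
  finally show "is_pole (\<lambda>z. 1 / f z) a \<longleftrightarrow> k > 0" .
qed

text \<open>At each point of the disc, splitting off its own factor leaves a function that is
  nonzero there, so the pole order is the exponent. Points of \<open>S\<close> with exponent 0 or
  outside the counting disc add nothing.\<close>

lemma nev_count_inverse: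
  fixes h :: "complex \<Rightarrow> complex"
  assumes S: "finite S" and h: "h holomorphic_on UNIV" "\<And>z. z \<in> cball 0 R \<Longrightarrow> h z \<noteq> 0"
    and f: "\<And>z. f z = (\<Prod>a\<in>S. (z - a) ^ k a) * h z" and t: "t \<le> R"
  shows "nev_count (\<lambda>z. 1 / f z) t = (\<Sum>a\<in>S. if norm a \<le> t then k a else 0)"
proof -
  have fac: "zorder (\<lambda>z. 1 / f z) a = - int (if a \<in> S then k a else 0) \<and>
     (is_pole (\<lambda>z. 1 / f z) a \<longleftrightarrow> a \<in> S \<and> k a > 0)" if a: "norm a \<le> R" for a
  proof -
    define H where "H = (\<lambda>z. (\<Prod>b\<in>S - {a}. (z - b) ^ k b) * h z)"
    have H: "H holomorphic_on UNIV" unfolding H_def by (intro holomorphic_intros h)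
    have Ha: "H a \<noteq> 0" using h(2)[of a] a S by (auto simp: H_def)
    have "f z = (z - a) ^ (if a \<in> S then k a else 0) * H z" for z
      using S by (auto simp: f H_def prod.remove[of S a])
    from pole_inverse_of_factorization[OF H Ha this] show ?thesis by auto
  qed
  have "nev_count (\<lambda>z. 1 / f z) t = (\<Sum>a | norm a \<le> t \<and> a \<in> S \<and> k a > 0. k a)"
    unfolding nev_count_def using fac t by (intro sum.cong) auto
  also have "\<dots> = (\<Sum>a\<in>S. if norm a \<le> t then k a else 0)"
    using S by (intro sum.mono_neutral_cong_left) auto
  finally show ?thesis .
qed

text \<open>The contribution to the integrated counting function of a zero of modulus
  \<open>c\<close> and multiplicity \<open>x\<close>; the integrand vanishes below \<open>c\<close>,
  so there is no singularity at 0.\<close>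

lemma has_integral_step_over_id:
  fixes c r x :: real
  assumes "0 < c" "0 < r"
  shows "((\<lambda>t. (if c \<le> t then x else 0) / t) has_integral x * max 0 (ln (r / c))) {0..r}"
proof (cases "c \<le> r")
  case True
  have "((\<lambda>t. x / t) has_integral (x * ln r - x * ln c)) {c..r}"
    using assms True
    by (intro fundamental_theorem_of_calculus[where f = "\<lambda>t::real. x * ln t"])
       (auto intro!: derivative_eq_intros simp: has_real_derivative_iff_has_vector_derivative[symmetric])
  then have int: "((\<lambda>t. if t \<in> {c..r} then x / t else 0) has_integral (x * ln r - x * ln c)) {0..r}"
    using assms by (subst has_integral_restrict) auto
  have eq: "(if t \<in> {c..r} then x / t else 0) = (if c \<le> t then x else 0) / t" if "t \<in> {0..r}" for t
    using that by auto
  have "x * ln r - x * ln c = x * max 0 (ln (r / c))"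
    using assms True by (simp add: ln_div algebra_simps max_def)
  with has_integral_eq[OF eq int] show ?thesis by (simp only:)
next
  case False
  then have "max 0 (ln (r / c)) = 0" using assms by (simp add: max_def)
  moreover have "((\<lambda>t. (if c \<le> t then x else 0) / t) has_integral 0) {0..r}"
    by (rule has_integral_is_0) (use False in auto)
  ultimately show ?thesis by simp
qed

lemma nev_counting_inverse:
  fixes h :: "complex \<Rightarrow> complex"
  assumes S: "finite S" "0 \<notin> S" and h: "h holomorphic_on UNIV" "\<And>z. z \<in> cball 0 R \<Longrightarrow> h z \<noteq> 0"
    and f: "\<And>z. f z = z ^ m * ((\<Prod>a\<in>S. (z - a) ^ k a) * h z)" and r: "0 < r" "r \<le> R"
  shows "nev_counting (\<lambda>z. 1 / f z) r = (\<Sum>a\<in>S. k a * max 0 (ln (r / norm a))) + m * ln r"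
proof -
  have f': "f z = (\<Prod>a\<in>insert 0 S. (z - a) ^ (k(0 := m)) a) * h z" for z
  proof -
    have "(\<Prod>a\<in>S. (z - a) ^ (k(0 := m)) a) = (\<Prod>a\<in>S. (z - a) ^ k a)"
      using S by (intro prod.cong) auto
    then show ?thesis using S by (simp add: f mult.assoc)
  qed
  have cnt: "nev_count (\<lambda>z. 1 / f z) t = m + (\<Sum>a\<in>S. if norm a \<le> t then k a else 0)" if "0 \<le> t" "t \<le> R" for t
  proof -
    have "nev_count (\<lambda>z. 1 / f z) t = (\<Sum>a\<in>insert 0 S. if norm a \<le> t then (k(0 := m)) a else 0)"
      using S h f' that by (intro nev_count_inverse) auto
    also have "\<dots> = m + (\<Sum>a\<in>S. if norm a \<le> t then (k(0 := m)) a else 0)"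
      using S that by simp
    also have "(\<Sum>a\<in>S. if norm a \<le> t then (k(0 := m)) a else 0) = (\<Sum>a\<in>S. if norm a \<le> t then k a else 0)"
      using S by (intro sum.cong) auto
    finally show ?thesis .
  qed
  have cnt0: "nev_count (\<lambda>z. 1 / f z) 0 = m"
    using cnt[of 0] r S by (simp add: sum.neutral)
  have "((\<lambda>t. \<Sum>a\<in>S. (if norm a \<le> t then real (k a) else 0) / t) has_integral
      (\<Sum>a\<in>S. k a * max 0 (ln (r / norm a)))) {0..r}"
    using S r by (intro has_integral_sum has_integral_step_over_id) auto
  then have "((\<lambda>t. (real (nev_count (\<lambda>z. 1 / f z) t) - real (nev_count (\<lambda>z. 1 / f z) 0)) / t) has_integral
      (\<Sum>a\<in>S. k a * max 0 (ln (r / norm a)))) {0..r}"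
  proof (rule has_integral_eq[rotated])
    fix t assume "t \<in> {0..r}"
    then have "0 \<le> t" "t \<le> R" using r by auto
    then show "(\<Sum>a\<in>S. (if norm a \<le> t then real (k a) else 0) / t) =
       (real (nev_count (\<lambda>z. 1 / f z) t) - real (nev_count (\<lambda>z. 1 / f z) 0)) / t"
      by (simp add: cnt cnt0 sum_divide_distrib if_distrib cong: if_cong)
  qed
  then show ?thesis unfolding nev_counting_def cnt0 by (simp add: integral_unique)
qed

text \<open>Integrate the logarithm of each factor of a factorization valid on a slightly larger
  disc: the origin contributes \<open>m * ln r\<close>, each other zero \<open>ln (norm a)\<close>
  plus its share of the counting function, and the zero-free factor its value at 0. The terms
  without \<open>r\<close> recombine to \<open>ln (norm (g 0))\<close>, with \<open>g 0\<close> the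
  first nonzero Taylor coefficient of \<open>f\<close>.\<close>

lemma Jensen_formula:
  assumes g: "g holomorphic_on UNIV" "g 0 \<noteq> 0" and f: "\<And>z. f z = z ^ m * g z" and r: "0 < r"
    and nz: "\<And>z. norm z = r \<Longrightarrow> f z \<noteq> 0"
  shows "((\<lambda>t. ln (norm (f (of_real r * cis t)))) has_integral
     2 * pi * (nev_counting (\<lambda>z. 1 / f z) r + ln (norm (g 0)))) {0..2*pi}"
proof -
  define R where "R = r + 1"
  have R: "r < R" "0 < R" using r by (auto simp: R_def)
  define S where "S = {z \<in> cball 0 R. g z = 0}"
  have S: "finite S" "0 \<notin> S" unfolding S_def using finite_zeros_cball[OF g] g(2) by auto
  obtain k h where h: "h holomorphic_on UNIV" "\<forall>a\<in>S. h a \<noteq> 0"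
    and geq: "\<forall>z. g z = (\<Prod>a\<in>S. (z - a) ^ k a) * h z"
    using entire_factor_zeros[OF S(1) g] by blast
  have hnz: "h z \<noteq> 0" if "z \<in> cball 0 R" for z
  proof (cases "g z = 0")
    case True
    then have "z \<in> S" using that by (simp add: S_def)
    then show ?thesis using h(2) by blast
  next
    case False
    then show ?thesis using geq by (metis mult_zero_right)
  qed
  have feq: "f z = z ^ m * ((\<Prod>a\<in>S. (z - a) ^ k a) * h z)" for z
    by (simp only: f geq[THEN spec, of z])
  have N: "nev_counting (\<lambda>z. 1 / f z) r = (\<Sum>a\<in>S. k a * max 0 (ln (r / norm a))) + m * ln r"
    using R by (intro nev_counting_inverse[OF S h(1) hnz feq r]) auto
  have S': "a \<noteq> 0" "norm a \<noteq> r" if "a \<in> S" for a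
    using that nz[of a] f S by (auto simp: S_def)
  have "((\<lambda>t. m * ln r + ((\<Sum>a\<in>S. k a * ln (norm (of_real r * cis t - a))) + ln (norm (h (of_real r * cis t))))) has_integral
      (2 * pi * (m * ln r) + ((\<Sum>a\<in>S. k a * (2 * pi * (ln (norm a) + max 0 (ln (r / norm a))))) + 2 * pi * ln (norm (h 0))))) {0..2*pi}"
  proof (intro has_integral_add has_integral_sum has_integral_mult_right)
    show "((\<lambda>t. m * ln r) has_integral 2 * pi * (m * ln r)) {0..2*pi}"
      using has_integral_const_real[of "m * ln r" 0 "2 * pi"] by simp
    show "((\<lambda>t. ln (norm (h (of_real r * cis t)))) has_integral 2 * pi * ln (norm (h 0))) {0..2*pi}"
      by (rule has_integral_ln_norm_zero_free[OF holomorphic_on_subset[OF h(1)] _ r R(1)]) (use hnz in auto)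
  qed (use S S' has_integral_ln_norm_diff r in auto)
  moreover have "m * ln r + ((\<Sum>a\<in>S. k a * ln (norm (of_real r * cis t - a))) + ln (norm (h (of_real r * cis t)))) =
      ln (norm (f (of_real r * cis t)))" for t
  proof -
    define z where "z = of_real r * cis t"
    have z: "norm z = r" using r by (simp add: z_def norm_mult)
    have "z \<notin> S" using S' z by auto
    then have "ln (norm (\<Prod>a\<in>S. (z - a) ^ k a)) = (\<Sum>a\<in>S. k a * ln (norm (z - a)))"
      unfolding prod_norm[symmetric] norm_power
      by (subst ln_prod) (auto simp: S(1) ln_realpow)
    moreover have "ln (norm (f z)) = ln (norm z ^ m) + ln (norm (\<Prod>a\<in>S. (z - a) ^ k a)) + ln (norm (h z))"
      using nz[OF z] unfolding feq norm_mult norm_power by (simp add: ln_mult add.assoc)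
    ultimately show ?thesis using z r by (simp add: z_def ln_realpow)
  qed
  moreover have "2 * pi * (m * ln r) + ((\<Sum>a\<in>S. k a * (2 * pi * (ln (norm a) + max 0 (ln (r / norm a))))) + 2 * pi * ln (norm (h 0))) =
      2 * pi * (nev_counting (\<lambda>z. 1 / f z) r + ln (norm (g 0)))"
  proof -
    have "ln (norm (\<Prod>a\<in>S. (0 - a) ^ k a)) = (\<Sum>a\<in>S. k a * ln (norm a))"
      unfolding prod_norm[symmetric] norm_power using S
      by (subst ln_prod) (auto simp: ln_realpow)
    moreover have "ln (norm (g 0)) = ln (norm (\<Prod>a\<in>S. (0 - a) ^ k a)) + ln (norm (h 0))"
      using g(2) geq[THEN spec, of 0] by (simp only: norm_mult) (simp add: ln_mult)
    ultimately have "ln (norm (g 0)) = (\<Sum>a\<in>S. k a * ln (norm a)) + ln (norm (h 0))" by simp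
    then show ?thesis
      by (simp add: N sum_distrib_left sum_distrib_right algebra_simps sum.distrib)
  qed
  ultimately show ?thesis by simp
qed

text \<open>One factorization on the disc of radius \<open>s\<close> serves both radii, and every
  term of the resulting explicit formula is nondecreasing in the radius.\<close>

lemma nev_counting_inverse_mono:
  assumes f: "f holomorphic_on UNIV" "f z0 \<noteq> 0" and "1 \<le> r" "r \<le> s"
  shows "nev_counting (\<lambda>z. 1 / f z) r \<le> nev_counting (\<lambda>z. 1 / f z) s"
proof -
  obtain m g where g: "g holomorphic_on UNIV" "g 0 \<noteq> 0" "\<forall>z. f z = (z - 0) ^ m * g z"
    using entire_factor_at[OF f, of 0] by blast
  define S where "S = {z \<in> cball 0 s. g z = 0}"
  have S: "finite S" "0 \<notin> S" unfolding S_def using finite_zeros_cball[OF g(1,2)] g(2) by auto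
  obtain k h where h: "h holomorphic_on UNIV" "\<forall>a\<in>S. h a \<noteq> 0"
    and geq: "\<forall>z. g z = (\<Prod>a\<in>S. (z - a) ^ k a) * h z"
    using entire_factor_zeros[OF S(1) g(1,2)] by blast
  have hnz: "h z \<noteq> 0" if "z \<in> cball 0 s" for z
  proof (cases "g z = 0")
    case True
    then have "z \<in> S" using that by (simp add: S_def)
    then show ?thesis using h(2) by blast
  next
    case False
    then show ?thesis using geq by (metis mult_zero_right)
  qed
  have feq: "f z = z ^ m * ((\<Prod>a\<in>S. (z - a) ^ k a) * h z)" for z
    by (simp only: g(3)[THEN spec, of z] geq[THEN spec, of z] diff_zero)
  have N: "nev_counting (\<lambda>z. 1 / f z) x = (\<Sum>a\<in>S. k a * max 0 (ln (x / norm a))) + m * ln x"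
    if "0 < x" "x \<le> s" for x
    using that by (intro nev_counting_inverse[OF S h(1) hnz feq]) auto
  have "(\<Sum>a\<in>S. k a * max 0 (ln (r / norm a))) \<le> (\<Sum>a\<in>S. k a * max 0 (ln (s / norm a)))"
    using assms S by (intro sum_mono mult_left_mono max.mono ln_mono divide_right_mono divide_pos_pos) auto
  moreover have "m * ln r \<le> m * ln s" using assms by (intro mult_left_mono) auto
  ultimately show ?thesis using N[of r] N[of s] assms by simp
qed

section \<open>Proximity and counting functions of exponential sums\<close>

lemma exp_sum_index_bound:
  assumes I: "finite I" "i \<in> I" and P: "\<And>j. j \<in> I \<Longrightarrow> P j \<noteq> 0" and Q: "inj_on Q I" "\<And>j. j \<in> I \<Longrightarrow> poly (Q j) 0 = 0"
  shows "\<exists>z. exp_sum I P Q z \<noteq> 0"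
    "circle_mean_bound (\<lambda>z. log_plus (norm (exp (poly (Q i) z) / exp_sum I P Q z))) ln"
proof -
  have eq: "insert i (I - {i}) = I" using I(2) by auto
  have "(\<exists>z. exp_sum (insert i (I - {i})) P Q z \<noteq> 0) \<and> circle_mean_bound
      (\<lambda>z. log_plus (norm (exp (poly (Q i) z) / exp_sum (insert i (I - {i})) P Q z))) ln"
    by (rule exp_sum_lower_bound) (use assms eq in auto)
  then show "\<exists>z. exp_sum I P Q z \<noteq> 0"
    "circle_mean_bound (\<lambda>z. log_plus (norm (exp (poly (Q i) z) / exp_sum I P Q z))) ln"
    unfolding eq by blast+
qed

lemma nev_proximity_bigo:
  assumes "circle_mean_bound (\<lambda>z. log_plus (norm (g z))) B" "eventually (\<lambda>r. B r \<ge> 0) at_top"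
  shows "nev_proximity g \<in> O[at_top](B)"
proof -
  from circle_mean_bound_imp_integral[OF assms(1) log_plus_nonneg]
  obtain C r0 where C: "\<forall>r\<ge>r0. integral {0..2*pi} (\<lambda>t. log_plus (norm (g (of_real r * cis t)))) \<le> C * B r"
    by blast
  show ?thesis
  proof (rule bigoI[where c = "C / (2 * pi)"])
    show "eventually (\<lambda>r. norm (nev_proximity g r) \<le> C / (2 * pi) * norm (B r)) at_top"
      using assms(2) eventually_ge_at_top[of r0]
    proof eventually_elim
      case (elim r)
      have "0 \<le> integral {0..2*pi} (\<lambda>t. log_plus (norm (g (of_real r * cis t))))"
        by (cases "(\<lambda>t. log_plus (norm (g (of_real r * cis t)))) integrable_on {0..2*pi}")
           (auto simp: not_integrable_integral log_plus_nonneg intro!: integral_nonneg)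
      then show ?case using elim C by (simp add: nev_proximity_def field_simps)
    qed
  qed
qed

text \<open>The reciprocal of the sum is \<open>exp (Q i)\<close> over the sum, times
  \<open>exp (- Q i)\<close>. The first factor costs O(log r), the second at most
  \<open>norm (Q i z)\<close>, which is of order \<open>r ^ d\<close>.\<close>

lemma exp_sum_proximity:
  assumes I: "finite I" "i \<in> I" and P: "\<And>j. j \<in> I \<Longrightarrow> P j \<noteq> 0" and Q: "inj_on Q I" "\<And>j. j \<in> I \<Longrightarrow> poly (Q j) 0 = 0"
    and d: "degree (Q i) \<le> d"
  shows "nev_proximity (\<lambda>z. 1 / exp_sum I P Q z) \<in> O[at_top](\<lambda>r. r ^ d + ln r)"
proof (rule nev_proximity_bigo)
  show "eventually (\<lambda>r::real. r ^ d + ln r \<ge> 0) at_top"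
    using eventually_ge_at_top[of 1] by eventually_elim (auto intro!: add_nonneg_nonneg)
  obtain C where C: "C \<ge> 0" "\<And>z. norm z \<ge> 1 \<Longrightarrow> norm (poly (Q i) z) \<le> C * norm z ^ degree (Q i)"
    using poly_norm_bound by blast
  have "circle_mean_bound (\<lambda>z. log_plus (norm (exp (poly (Q i) z) / exp_sum I P Q z))) (\<lambda>r. r ^ d + ln r)"
    by (rule circle_mean_bound_weaken[OF exp_sum_index_bound(2)[OF I P Q], where R = 1])
       (auto simp: log_plus_nonneg)
  moreover have "circle_mean_bound (\<lambda>z. log_plus (norm (exp (- poly (Q i) z)))) (\<lambda>r. r ^ d + ln r)"
  proof (rule circle_mean_bound_const[where R = 1 and C = C])
    fix z :: complex assume z: "norm z \<ge> 1"
    have "- Re (poly (Q i) z) \<le> norm (poly (Q i) z)" using abs_Re_le_cmod[of "poly (Q i) z"] by linarith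
    also have "\<dots> \<le> C * norm z ^ degree (Q i)" by (rule C(2)[OF z])
    also have "\<dots> \<le> C * norm z ^ d" using C(1) z d by (intro mult_left_mono power_increasing)
    also have "\<dots> \<le> C * (norm z ^ d + ln (norm z))" using C(1) z by (intro mult_left_mono) auto
    finally have "- Re (poly (Q i) z) \<le> C * (norm z ^ d + ln (norm z))" .
    moreover have "0 \<le> C * (norm z ^ d + ln (norm z))" using C(1) z by (intro mult_nonneg_nonneg add_nonneg_nonneg) auto
    ultimately show "log_plus (norm (exp (- poly (Q i) z))) \<le> C * (norm z ^ d + ln (norm z))"
      by (simp add: log_plus_exp)
  qed
  ultimately have "circle_mean_bound (\<lambda>z. log_plus (norm (exp (poly (Q i) z) / exp_sum I P Q z)) +
      log_plus (norm (exp (- poly (Q i) z)))) (\<lambda>r. r ^ d + ln r)" by (rule circle_mean_bound_add)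
  then show "circle_mean_bound (\<lambda>z. log_plus (norm (1 / exp_sum I P Q z))) (\<lambda>r. r ^ d + ln r)"
  proof (rule circle_mean_bound_mono)
    fix r :: real
    have "log_plus (norm (1 / exp_sum I P Q z)) \<le>
        log_plus (norm (exp (poly (Q i) z) / exp_sum I P Q z)) + log_plus (norm (exp (- poly (Q i) z)))" for z
    proof -
      have "norm (1 / exp_sum I P Q z) = norm (exp (poly (Q i) z) / exp_sum I P Q z) * norm (exp (- poly (Q i) z))"
        unfolding norm_mult[symmetric] by (simp add: exp_minus)
      then show ?thesis using log_plus_mult[OF norm_ge_zero norm_ge_zero] by metis
    qed
    then show "\<exists>T. finite T \<and> (\<forall>t\<in>{0..2*pi} - T. log_plus (norm (1 / exp_sum I P Q (of_real r * cis t))) \<le>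
        log_plus (norm (exp (poly (Q i) (of_real r * cis t)) / exp_sum I P Q (of_real r * cis t))) +
        log_plus (norm (exp (- poly (Q i) (of_real r * cis t)))))" by blast
  qed
qed

lemma Max_diff_le:
  fixes f g :: "'a \<Rightarrow> real"
  assumes "finite I" "I \<noteq> {}" "\<And>i. i \<in> I \<Longrightarrow> \<bar>f i - g i\<bar> \<le> K"
  shows "\<bar>Max (f ` I) - Max (g ` I)\<bar> \<le> K"
proof -
  have "Max (f ` I) \<le> Max (g ` I) + K" if fg: "\<And>i. i \<in> I \<Longrightarrow> \<bar>f i - g i\<bar> \<le> K" for f g :: "'a \<Rightarrow> real"
  proof -
    have "f i \<le> Max (g ` I) + K" if "i \<in> I" for i
    proof -
      have "g i \<le> Max (g ` I)" using assms(1) that by (intro Max_ge) auto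
      then show ?thesis using fg[OF that] by (simp only: abs_le_iff) linarith
    qed
    then show ?thesis using assms(1,2) by auto
  qed
  from this[of f g] this[of g f] assms(3) show ?thesis by (force simp: abs_le_iff abs_minus_commute)
qed

lemma eventually_notin_finite:
  fixes B :: "'a::t1_space set"
  assumes "finite B"
  shows "eventually (\<lambda>x. x \<notin> B) (at a within S)"
proof -
  have "eventually (\<lambda>x. \<forall>b\<in>B. x \<noteq> b) (at a within S)"
    using assms by (intro eventually_ball_finite ballI eventually_neq_at_within)
  then show ?thesis by eventually_elim auto
qed

text \<open>The coefficients \<open>\<omega> j\<close> may coincide or be 0; only the exponents
  \<open>Q j\<close> have to be distinct. This is what the expansion of a normalized form produces,
  where several indices share one leading coefficient.\<close>

theorem exp_sum_counting:
  fixes \<omega> :: "'a \<Rightarrow> complex" and I :: "'a set"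
  assumes I: "finite I" "I \<noteq> {}" and P: "\<And>j. j \<in> I \<Longrightarrow> P j \<noteq> 0"
    and Q: "inj_on Q I" "\<And>j. j \<in> I \<Longrightarrow> poly (Q j) 0 = 0"
    and L: "\<And>j. j \<in> I \<Longrightarrow> Q j = monom (\<omega> j) q + L j" "\<And>j. j \<in> I \<Longrightarrow> degree (L j) \<le> d" and q: "q \<ge> 1"
  shows "(\<lambda>r. nev_counting (\<lambda>z. 1 / exp_sum I P Q z) r -
            circumference (convex hull ((\<lambda>j. cnj (\<omega> j)) ` I)) * (r ^ q / (2 * pi))) \<in> O[at_top](\<lambda>r. r ^ d + ln r)"
proof -
  define f where "f = exp_sum I P Q"
  define N where "N = nev_counting (\<lambda>z. 1 / f z)"
  define V where "V = (\<lambda>j. cnj (\<omega> j)) ` I"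
  define c where "c = circumference (convex hull V)"
  define M where "M = (\<lambda>z. Max ((\<lambda>j. Re (poly (Q j) z)) ` I))"
  define W where "W = (\<lambda>t. support_fun V (cis (real q * t)))"
  define \<phi> where "\<phi> = (\<lambda>z. \<Sum>i\<in>I. log_plus (norm (exp (poly (Q i) z) / f z)))"
  have V: "finite V" "V \<noteq> {}" using I by (auto simp: V_def)
  have W: "(W has_integral c) {0..2*pi}"
    unfolding W_def c_def by (rule support_fun_has_integral_circumference[OF V q])
  have holo: "f holomorphic_on UNIV" unfolding f_def by (rule exp_sum_holomorphic)
  have index_bound: "\<exists>z. f z \<noteq> 0" "circle_mean_bound (\<lambda>z. log_plus (norm (exp (poly (Q i) z) / f z))) ln"
    if "i \<in> I" for i
    using exp_sum_index_bound[of I i P Q] I(1) P Q that unfolding f_def by auto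
  obtain z0 where z0: "f z0 \<noteq> 0" using index_bound(1) I(2) by blast
  obtain m g where g: "g holomorphic_on UNIV" "g 0 \<noteq> 0" "\<forall>z. f z = (z - 0) ^ m * g z"
    using entire_factor_at[OF holo z0, of 0] by blast
  define c0 where "c0 = ln (norm (g 0))"
  have "\<exists>K\<ge>0. \<forall>j\<in>I. \<forall>z. norm z \<ge> 1 \<longrightarrow> norm (poly (L j) z) \<le> K * norm z ^ d"
  proof -
    define K where "K = (\<lambda>p::complex poly. \<Sum>i\<le>degree p. norm (coeff p i))"
    have K: "K p \<ge> 0" "norm z \<ge> 1 \<Longrightarrow> norm (poly p z) \<le> K p * norm z ^ degree p" for p z
      unfolding K_def by (auto intro!: sum_nonneg norm_poly_le)
    have "norm (poly (L j) z) \<le> (\<Sum>j\<in>I. K (L j)) * norm z ^ d" if "j \<in> I" "norm z \<ge> 1" for j z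
    proof -
      have "norm (poly (L j) z) \<le> K (L j) * norm z ^ degree (L j)" using K(2) that by blast
      also have "\<dots> \<le> (\<Sum>j\<in>I. K (L j)) * norm z ^ d"
        using that K(1) L(2) I(1) by (intro mult_mono member_le_sum power_increasing sum_nonneg) auto
      finally show ?thesis .
    qed
    then show ?thesis by (intro exI[of _ "\<Sum>j\<in>I. K (L j)"]) (auto intro: sum_nonneg K)
  qed
  then obtain K where K: "K \<ge> 0" "\<And>j z. j \<in> I \<Longrightarrow> norm z \<ge> 1 \<Longrightarrow> norm (poly (L j) z) \<le> K * norm z ^ d"
    by blast
  have "\<exists>A\<ge>1. \<exists>e::nat. \<forall>j\<in>I. \<forall>z. norm z \<ge> 1 \<longrightarrow> norm (poly (P j) z) \<le> A * norm z ^ e"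
  proof -
    define K where "K = (\<lambda>p::complex poly. \<Sum>i\<le>degree p. norm (coeff p i))"
    have K: "K p \<ge> 0" "norm z \<ge> 1 \<Longrightarrow> norm (poly p z) \<le> K p * norm z ^ degree p" for p z
      unfolding K_def by (auto intro!: sum_nonneg norm_poly_le)
    define e where "e = (\<Sum>j\<in>I. degree (P j))"
    have "norm (poly (P j) z) \<le> (1 + (\<Sum>j\<in>I. K (P j))) * norm z ^ e" if "j \<in> I" "norm z \<ge> 1" for j z
    proof -
      have "norm (poly (P j) z) \<le> K (P j) * norm z ^ degree (P j)" using K(2) that by blast
      also have "\<dots> \<le> (\<Sum>j\<in>I. K (P j)) * norm z ^ e"
        using that K(1) I(1) unfolding e_def
        by (intro mult_mono member_le_sum power_increasing sum_nonneg) auto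
      also have "\<dots> \<le> (1 + (\<Sum>j\<in>I. K (P j))) * norm z ^ e" by (intro mult_right_mono) auto
      finally show ?thesis .
    qed
    then show ?thesis
      by (intro exI[of _ "1 + (\<Sum>j\<in>I. K (P j))"] conjI exI[of _ e]) (auto intro: sum_nonneg K)
  qed
  then obtain A e where A: "A \<ge> 1" "\<And>j z. j \<in> I \<Longrightarrow> norm z \<ge> 1 \<Longrightarrow> norm (poly (P j) z) \<le> A * norm z ^ e"
    by blast
  \<comment> \<open>On the circle \<open>Re (\<omega> * z ^ q)\<close> is \<open>r ^ q\<close> times
    the inner product of \<open>cnj \<omega>\<close> with \<open>cis (q * t)\<close>. This is where
    the conjugates in the leading set come from; the lower-order parts \<open>L j\<close> change the
    maximum by at most \<open>K * r ^ d\<close>.\<close>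
  have MW: "\<bar>M (of_real r * cis t) - r ^ q * W t\<bar> \<le> K * r ^ d" if r: "r \<ge> 1" for r t
  proof -
    define z where "z = of_real r * cis t"
    have z: "norm z = r" using r by (simp add: z_def norm_mult)
    have "\<bar>Max ((\<lambda>j. Re (poly (Q j) z)) ` I) - Max ((\<lambda>j. r ^ q * (cnj (\<omega> j) \<bullet> cis (real q * t))) ` I)\<bar> \<le> K * r ^ d"
    proof (rule Max_diff_le[OF I])
      fix j assume j: "j \<in> I"
      have "z ^ q = of_real (r ^ q) * cis (real q * t)"
        by (simp add: z_def power_mult_distrib Complex.DeMoivre)
      then have "Re (poly (monom (\<omega> j) q) z) = r ^ q * (cnj (\<omega> j) \<bullet> cis (real q * t))"
        by (simp add: poly_monom inner_complex_def algebra_simps)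
      then have "Re (poly (Q j) z) - r ^ q * (cnj (\<omega> j) \<bullet> cis (real q * t)) = Re (poly (L j) z)"
        using L(1)[OF j] by simp
      then show "\<bar>Re (poly (Q j) z) - r ^ q * (cnj (\<omega> j) \<bullet> cis (real q * t))\<bar> \<le> K * r ^ d"
        using abs_Re_le_cmod[of "poly (L j) z"] K(2)[OF j, of z] z r by simp
    qed
    moreover have "Max ((\<lambda>j. r ^ q * (cnj (\<omega> j) \<bullet> cis (real q * t))) ` I) = r ^ q * W t"
    proof -
      have "(*) (r ^ q) (Max ((\<lambda>j. cnj (\<omega> j) \<bullet> cis (real q * t)) ` I)) =
          Max ((*) (r ^ q) ` ((\<lambda>j. cnj (\<omega> j) \<bullet> cis (real q * t)) ` I))"
        using r I by (intro mono_Max_commute) (auto intro!: monoI mult_left_mono)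
      then show ?thesis by (simp add: W_def support_fun_def V_def image_image)
    qed
    ultimately show ?thesis by (simp add: M_def z_def)
  qed
  have Q_le_M: "Re (poly (Q j) z) \<le> M z" if "j \<in> I" for j z
    unfolding M_def using I(1) that by (intro Max_ge) auto
  have upper: "ln (norm (f z)) \<le> ln (card I * A) + e * ln (norm z) + M z" if z: "norm z \<ge> 1" "f z \<noteq> 0" for z
  proof -
    have "norm (f z) \<le> (\<Sum>j\<in>I. norm (poly (P j) z) * exp (Re (poly (Q j) z)))"
      unfolding f_def exp_sum_def by (rule order_trans[OF norm_sum]) (simp add: norm_mult)
    also have "\<dots> \<le> (\<Sum>j\<in>I. (A * norm z ^ e) * exp (M z))"
      using A z Q_le_M by (intro sum_mono mult_mono) auto
    also have "\<dots> = (card I * A) * norm z ^ e * exp (M z)" by simp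
    finally have "ln (norm (f z)) \<le> ln ((card I * A) * norm z ^ e * exp (M z))"
      using z by (intro ln_mono) auto
    also have "\<dots> = ln (card I * A) + e * ln (norm z) + M z"
    proof -
      have "norm z > 0" using z(1) by linarith
      then have "card I * A > 0" "norm z ^ e > 0" using I A(1) by (auto simp: card_gt_0_iff)
      then show ?thesis using \<open>norm z > 0\<close>
        by (simp only: ln_mult_pos mult_pos_pos exp_gt_zero ln_exp) (simp add: ln_realpow)
    qed
    finally show ?thesis .
  qed
  \<comment> \<open>The index attaining the maximum varies with \<open>z\<close>; the sum
    \<open>\<phi>\<close> over all indices gives one bound for every choice.\<close>
  have lower: "M z \<le> ln (norm (f z)) + \<phi> z" if z: "f z \<noteq> 0" for z
  proof -
    obtain j where j: "j \<in> I" "M z = Re (poly (Q j) z)"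
      using Max_in[of "(\<lambda>j. Re (poly (Q j) z)) ` I"] I unfolding M_def
      by (metis (no_types, lifting) finite_imageI image_iff image_is_empty)
    have "M z - ln (norm (f z)) = ln (norm (exp (poly (Q j) z) / f z))"
      using z j by (simp add: norm_divide ln_div)
    also have "\<dots> \<le> log_plus (norm (exp (poly (Q j) z) / f z))"
      using z by (intro ln_le_log_plus) auto
    also have "\<dots> \<le> \<phi> z" unfolding \<phi>_def using j(1) I(1) by (intro member_le_sum) (auto simp: log_plus_nonneg)
    finally show ?thesis by simp
  qed
  have "circle_mean_bound (\<lambda>z. \<Sum>i\<in>J. log_plus (norm (exp (poly (Q i) z) / f z))) ln" if "J \<subseteq> I" for J
    using finite_subset[OF that I(1)] that
  proof induction
    case empty
    then show ?case using circle_mean_bound_ln_const[of 0] by simp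
  next
    case (insert j J)
    then have "circle_mean_bound (\<lambda>z. log_plus (norm (exp (poly (Q j) z) / f z)) +
        (\<Sum>i\<in>J. log_plus (norm (exp (poly (Q i) z) / f z)))) ln"
      by (intro circle_mean_bound_add index_bound(2)) auto
    then show ?case using insert.hyps by simp
  qed
  then have "circle_mean_bound \<phi> ln" unfolding \<phi>_def by blast
  then obtain C r0 where C: "\<forall>r\<ge>r0. \<exists>\<psi> J T. finite T \<and> (\<psi> has_integral J) {0..2*pi} \<and> J \<le> C * ln r \<and>
        (\<forall>t\<in>{0..2*pi} - T. \<phi> (of_real r * cis t) \<le> \<psi> t)"
    unfolding circle_mean_bound_def by blast
  define E1 where "E1 = (\<lambda>r. K * r ^ d + ln (card I * A) + e * ln r - c0)"
  define E2 where "E2 = (\<lambda>r. C * ln r / (2 * pi) + K * r ^ d + c0)"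
  have good: "N r \<le> c * (r ^ q / (2 * pi)) + E1 r \<and> c * (r ^ q / (2 * pi)) - E2 r \<le> N r"
    if r: "r \<ge> max 1 r0" and nz: "\<And>z. norm z = r \<Longrightarrow> f z \<noteq> 0" for r
  proof -
    have r1: "r \<ge> 1" using r by simp
    have zr: "norm (of_real r * cis t) = r" for t using r1 by (simp add: norm_mult)
    have J: "((\<lambda>t. ln (norm (f (of_real r * cis t)))) has_integral 2 * pi * (N r + c0)) {0..2*pi}"
      unfolding N_def c0_def using g r1 nz by (intro Jensen_formula) auto
    have const: "((\<lambda>t. x) has_integral 2 * pi * x) {0..2*pi}" for x :: real
      using has_integral_const_real[of x 0 "2 * pi"] by simp
    have rW: "((\<lambda>t. r ^ q * W t) has_integral r ^ q * c) {0..2*pi}"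
      by (rule has_integral_mult_right[OF W])
    have "2 * pi * (N r + c0) \<le> r ^ q * c + 2 * pi * (K * r ^ d + ln (card I * A) + e * ln r)"
    proof (rule has_integral_le[OF J has_integral_add[OF rW const]])
      fix t
      show "ln (norm (f (of_real r * cis t))) \<le> r ^ q * W t + (K * r ^ d + ln (card I * A) + e * ln r)"
        using upper[OF _ nz[OF zr], of t] MW[OF r1, of t] r1 unfolding zr abs_le_iff by linarith
    qed
    then have 1: "N r \<le> c * (r ^ q / (2 * pi)) + E1 r"
      unfolding E1_def by (simp add: field_simps)
    have "r \<ge> r0" using r by simp
    then obtain \<psi> j T where \<psi>: "finite T" "(\<psi> has_integral j) {0..2*pi}" "j \<le> C * ln r"
      "\<forall>t\<in>{0..2*pi} - T. \<phi> (of_real r * cis t) \<le> \<psi> t" using C by metis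
    \<comment> \<open>The majorant is reset on the finite set \<open>T\<close>, so that the
      inequality between the integrands holds at every \<open>t\<close>.\<close>
    define \<psi>' where "\<psi>' = (\<lambda>t. if t \<in> T then \<phi> (of_real r * cis t) else \<psi> t)"
    have \<psi>': "(\<psi>' has_integral j) {0..2*pi}"
      by (rule has_integral_spike_finite[OF \<psi>(1) _ \<psi>(2)]) (auto simp: \<psi>'_def)
    have "r ^ q * c \<le> 2 * pi * (N r + c0) + j + 2 * pi * (K * r ^ d)"
    proof (rule has_integral_le[OF rW has_integral_add[OF has_integral_add[OF J \<psi>'] const]])
      fix t assume t: "t \<in> {0..2*pi}"
      have "\<phi> (of_real r * cis t) \<le> \<psi>' t" using \<psi>(4) t by (auto simp: \<psi>'_def)
      moreover have "M (of_real r * cis t) \<le> ln (norm (f (of_real r * cis t))) + \<phi> (of_real r * cis t)"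
        by (rule lower[OF nz[OF zr]])
      moreover have "r ^ q * W t \<le> M (of_real r * cis t) + K * r ^ d"
        using MW[OF r1, of t] by (simp only: abs_le_iff) linarith
      ultimately show "r ^ q * W t \<le> ln (norm (f (of_real r * cis t))) + \<psi>' t + K * r ^ d" by linarith
    qed
    then have "r ^ q * c \<le> 2 * pi * (N r + c0) + C * ln r + 2 * pi * (K * r ^ d)" using \<psi>(3) by linarith
    then have "c * (r ^ q / (2 * pi)) - E2 r \<le> N r" unfolding E2_def by (simp add: field_simps)
    with 1 show ?thesis by blast
  qed
  text \<open>Radii of circles through zeros of \<open>f\<close> are reached from both sides, as \<open>N\<close> is monotone.\<close>
  have all: "N r \<le> c * (r ^ q / (2 * pi)) + E1 r \<and> c * (r ^ q / (2 * pi)) - E2 r \<le> N r"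
    if r: "r > max 1 r0" for r
  proof
    \<comment> \<open>The radii of circles that meet a zero; the disc of radius \<open>r + 1\<close>
      covers all radii used in the limits from the right and from the left.\<close>
    define B where "B = norm ` {z \<in> cball 0 (r + 1). f z = 0}"
    have B: "finite B" unfolding B_def using finite_zeros_cball[OF holo z0] by (rule finite_imageI)
    have nz: "f z \<noteq> 0" if "x \<notin> B" "x < r + 1" "norm z = x" for x z
      using that by (auto simp: B_def)
    have mono: "N x \<le> N y" if "1 \<le> x" "x \<le> y" for x y
      unfolding N_def by (rule nev_counting_inverse_mono[OF holo z0 that])
    have r0: "r > 0" using r by simp
    show "N r \<le> c * (r ^ q / (2 * pi)) + E1 r"
    proof (rule tendsto_lowerbound)
      show "((\<lambda>x. c * (x ^ q / (2 * pi)) + E1 x) \<longlongrightarrow> c * (r ^ q / (2 * pi)) + E1 r) (at_right r)"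
        unfolding E1_def using r0 by (intro tendsto_intros) auto
      have "eventually (\<lambda>x. x \<in> {r<..<r+1}) (at_right r)" by (rule eventually_at_right_real) simp
      with eventually_notin_finite[OF B]
      show "eventually (\<lambda>x. N r \<le> c * (x ^ q / (2 * pi)) + E1 x) (at_right r)"
      proof eventually_elim
        case (elim x)
        then show ?case using good[of x] nz[of x] mono[of r x] r by auto
      qed
    qed simp
    show "c * (r ^ q / (2 * pi)) - E2 r \<le> N r"
    proof (rule tendsto_upperbound)
      show "((\<lambda>x. c * (x ^ q / (2 * pi)) - E2 x) \<longlongrightarrow> c * (r ^ q / (2 * pi)) - E2 r) (at_left r)"
        unfolding E2_def using r0 by (intro tendsto_intros) auto
      have "eventually (\<lambda>x. x \<in> {max 1 r0<..<r}) (at_left r)" by (rule eventually_at_left_real) (use r in simp)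
      with eventually_notin_finite[OF B]
      show "eventually (\<lambda>x. c * (x ^ q / (2 * pi)) - E2 x \<le> N r) (at_left r)"
      proof eventually_elim
        case (elim x)
        then show ?case using good[of x] nz[of x] mono[of x r] r by auto
      qed
    qed simp
  qed
  \<comment> \<open>Since \<open>r ^ d \<ge> 1\<close>, every summand of \<open>E1\<close> and
    \<open>E2\<close> is at most its coefficient times \<open>r ^ d + ln r\<close>. Absolute values
    are taken where the sign of a constant is not known.\<close>
  define D where "D = K + \<bar>ln (card I * A)\<bar> + e + \<bar>c0\<bar> + \<bar>C\<bar>"
  have "(\<lambda>r. N r - c * (r ^ q / (2 * pi))) \<in> O[at_top](\<lambda>r. r ^ d + ln r)"
  proof (rule bigoI[where c = D])
    show "eventually (\<lambda>r. norm (N r - c * (r ^ q / (2 * pi))) \<le> D * norm (r ^ d + ln r)) at_top"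
      using eventually_gt_at_top[of "max 1 r0"]
    proof eventually_elim
      case (elim r)
      define x where "x = r ^ d"
      define y where "y = ln r"
      have x: "x \<ge> 1" "y \<ge> 0" using elim by (auto simp: x_def y_def one_le_power)
      have D0: "D \<ge> 0" using K(1) by (simp add: D_def)
      have rhs: "D * norm (r ^ d + ln r) = D * (x + y)" using x by (simp add: x_def y_def)
      have a: "K * x \<le> K * (x + y)" using K(1) x by (intro mult_left_mono) auto
      have b: "ln (card I * A) \<le> \<bar>ln (card I * A)\<bar> * (x + y)"
        using mult_left_mono[of 1 "x + y" "\<bar>ln (card I * A)\<bar>"] x by auto
      have c: "e * y \<le> e * (x + y)" using x by (intro mult_left_mono) auto
      have d: "\<bar>c0\<bar> \<le> \<bar>c0\<bar> * (x + y)"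
        using mult_left_mono[of 1 "x + y" "\<bar>c0\<bar>"] x by auto
      have "C * y / (2 * pi) \<le> \<bar>C\<bar> * y / 1"
        using x pi_ge_two by (intro frac_le mult_right_mono) auto
      also have "\<dots> \<le> \<bar>C\<bar> * (x + y)" using x by (auto intro!: mult_left_mono)
      finally have f: "C * y / (2 * pi) \<le> \<bar>C\<bar> * (x + y)" .
      have nn: "0 \<le> \<bar>ln (card I * A)\<bar> * (x + y)" "0 \<le> e * (x + y)" "0 \<le> \<bar>C\<bar> * (x + y)" using x by auto
      have "D * (x + y) = K * (x + y) + \<bar>ln (card I * A)\<bar> * (x + y) + e * (x + y) + \<bar>c0\<bar> * (x + y) + \<bar>C\<bar> * (x + y)"
        by (simp add: D_def algebra_simps)
      moreover have "E1 r \<le> K * (x + y) + \<bar>ln (card I * A)\<bar> * (x + y) + e * (x + y) + \<bar>c0\<bar> * (x + y)"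
        using a b c d by (simp only: E1_def x_def[symmetric] y_def[symmetric])
      moreover have "E2 r \<le> K * (x + y) + \<bar>c0\<bar> * (x + y) + \<bar>C\<bar> * (x + y)"
        using a d f by (simp only: E2_def x_def[symmetric] y_def[symmetric])
      ultimately have "E1 r \<le> D * (x + y)" "E2 r \<le> D * (x + y)" using nn by linarith+
      then show ?case unfolding rhs using all[OF elim] by (simp only: real_norm_def abs_le_iff) linarith
    qed
  qed
  then show ?thesis by (simp add: N_def f_def c_def V_def)
qed

section \<open>Expansion of the coefficients of a normalized form\<close>

lemma has_exp_poly_order_nonzero:
  assumes "has_exp_poly_order g k" "g \<noteq> (\<lambda>z. 0)"
  shows "\<exists>n P Q. exp_poly_data n P Q \<and> g = exp_poly n P Q \<and> (\<forall>j\<le>n. degree (Q j) \<le> k)"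
  using assms(1) unfolding has_exp_poly_order_def
proof (elim disjE exE conjE)
  fix n P Q assume "exp_poly_data n P Q" "g = exp_poly n P Q" "exp_poly_order n Q = k"
  moreover from this have "degree (Q j) \<le> k" if "j \<le> n" for j
    using Max_ge[of "(\<lambda>j. degree (Q j)) ` {..n}" "degree (Q j)"] that
    by (simp add: exp_poly_order_def)
  ultimately show ?thesis by blast
next
  \<comment> \<open>A nonzero polynomial is the exponential polynomial with one term and exponent
    0.\<close>
  fix R assume R: "g = poly R" "k = 0"
  then have "R \<noteq> 0" using assms(2) by auto
  then have "exp_poly_data 0 (\<lambda>_. R) (\<lambda>_. 0)" by (simp add: exp_poly_data_def)
  moreover have "g = exp_poly 0 (\<lambda>_. R) (\<lambda>_. 0)" using R by (simp add: exp_poly_def fun_eq_iff)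
  ultimately show ?thesis by (intro exI[of _ 0] exI[of _ "\<lambda>_. R"] exI[of _ "\<lambda>_. 0"]) auto
qed

theorem theorem3p2:
  fixes f :: "complex \<Rightarrow> complex" and P Q :: "nat \<Rightarrow> complex poly"
    and H :: "nat \<Rightarrow> complex \<Rightarrow> complex" and w :: "nat \<Rightarrow> complex"
    and n m p q :: nat
  assumes "exp_poly_data n P Q"
    and "f = exp_poly n P Q"
    and "exp_poly_order n Q = q" and "q \<ge> 1"
    and "1 \<le> p" and "p \<le> q"
    and "normalized_form n P Q q m H w"
    and "\<forall>j\<le>m. \<exists>k\<le>q - p. has_exp_poly_order (H j) k"
  shows
    "(H 0 \<noteq> (\<lambda>z. 0) \<longrightarrow>
        nev_proximity (\<lambda>z. 1 / f z) \<in> O[at_top](\<lambda>r. r ^ (q - p) + ln r)) \<and>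
     (Q 0 = 0 \<longrightarrow>
        nev_proximity (\<lambda>z. 1 / f z) \<in> O[at_top](\<lambda>r. ln r)) \<and>
     (\<lambda>r. nev_counting (\<lambda>z. 1 / f z) r
          - circumference (convex hull (conj_leading_set m H w)) * (r ^ q / (2 * pi)))
        \<in> O[at_top](\<lambda>r. r ^ (q - p) + ln r)"
proof -
  define d where "d = q - p"
  have dq: "d < q" using assms(4,5) by (simp add: d_def)
  have f_sum: "f = exp_sum {..n} P Q"
    using assms(2) by (simp add: exp_poly_def exp_sum_def fun_eq_iff)
  have dat: "\<And>j. j \<in> {..n} \<Longrightarrow> P j \<noteq> 0" "inj_on Q {..n}" "\<And>j. j \<in> {..n} \<Longrightarrow> poly (Q j) 0 = 0"
    using assms(1) by (auto simp: exp_poly_data_def)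
  have nf: "f = (\<lambda>z. \<Sum>j\<le>m. H j z * exp (w j * z ^ q))" "w 0 = 0" "inj_on w {..m}"
    "\<And>j. j \<in> {1..m} \<Longrightarrow> H j \<noteq> (\<lambda>z. 0)"
    using assms(2,7) by (auto simp: normalized_form_def)
  \<comment> \<open>Only the coefficient with index 0 can vanish, so \<open>J\<close> matches the
    case distinction in \<open>conj_leading_set\<close>.\<close>
  define J where "J = {j\<in>{..m}. H j \<noteq> (\<lambda>z. 0)}"
  have "\<forall>j\<in>J. \<exists>n P Q. exp_poly_data n P Q \<and> H j = exp_poly n P Q \<and> (\<forall>i\<le>n. degree (Q i) \<le> d)"
  proof
    fix j assume j: "j \<in> J"
    then obtain k where k: "k \<le> d" "has_exp_poly_order (H j) k"
      using assms(8) by (auto simp: J_def d_def)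
    from has_exp_poly_order_nonzero[OF k(2)] j k(1)
    show "\<exists>n P Q. exp_poly_data n P Q \<and> H j = exp_poly n P Q \<and> (\<forall>i\<le>n. degree (Q i) \<le> d)"
      by (fastforce simp: J_def)
  qed
  then obtain l A B where AB: "\<And>j. j \<in> J \<Longrightarrow> exp_poly_data (l j) (A j) (B j)"
    "\<And>j. j \<in> J \<Longrightarrow> H j = exp_poly (l j) (A j) (B j)"
    "\<And>j i. j \<in> J \<Longrightarrow> i \<le> l j \<Longrightarrow> degree (B j i) \<le> d" by metis
  define I where "I = (SIGMA j:J. {..l j})"
  define P' where "P' = (\<lambda>(j, i). A j i)"
  define Q' where "Q' = (\<lambda>(j, i). monom (w j) q + B j i)"
  have I: "finite I" by (simp add: I_def J_def)
  have f_sum': "f = exp_sum I P' Q'"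
  proof
    fix z
    have "f z = (\<Sum>j\<in>J. H j z * exp (w j * z ^ q))"
      unfolding nf(1) J_def by (rule sum.mono_neutral_right) auto
    also have "\<dots> = (\<Sum>j\<in>J. \<Sum>i\<le>l j. poly (A j i) z * exp (poly (monom (w j) q + B j i) z))"
      by (intro sum.cong refl, simp only: AB(2) exp_poly_def sum_distrib_right, intro sum.cong refl)
         (simp add: poly_monom exp_add)
    also have "\<dots> = exp_sum I P' Q' z"
      unfolding exp_sum_def I_def P'_def Q'_def by (subst sum.Sigma) (auto simp: J_def split_def)
    finally show "f z = exp_sum I P' Q' z" .
  qed
  have P': "\<And>x. x \<in> I \<Longrightarrow> P' x \<noteq> 0"
    using AB(1) by (force simp: I_def P'_def exp_poly_data_def)
  have Q'0: "\<And>x. x \<in> I \<Longrightarrow> poly (Q' x) 0 = 0"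
    using AB(1) assms(4) by (force simp: I_def Q'_def exp_poly_data_def poly_monom)
  \<comment> \<open>The inner exponents have degree at most \<open>d < q\<close>, so the coefficient
    of order \<open>q\<close> in \<open>Q' (j, i)\<close> is \<open>w j\<close>. It determines
    \<open>j\<close>, and the remainder \<open>B j i\<close> then determines
    \<open>i\<close>.\<close>
  have Q'inj: "inj_on Q' I"
  proof (rule inj_onI, clarify)
    fix j i j' i' assume x: "(j, i) \<in> I" "(j', i') \<in> I" and eq: "Q' (j, i) = Q' (j', i')"
    have "coeff (B j i) q = 0" "coeff (B j' i') q = 0"
      using x AB(3) dq by (auto simp: I_def intro!: coeff_eq_0 elim: le_less_trans[rotated])
    moreover have "coeff (Q' (j, i)) q = coeff (Q' (j', i')) q" using eq by simp
    ultimately have "w j = w j'" by (simp add: Q'_def)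
    then have jj: "j = j'" using x nf(3) by (auto simp: I_def J_def inj_on_def)
    then have "B j i = B j i'" using eq by (simp add: Q'_def)
    moreover have "inj_on (B j) {..l j}" using x AB(1) by (auto simp: I_def exp_poly_data_def)
    ultimately have "i = i'" using x jj by (auto simp: I_def inj_on_def)
    with jj show "j = j' \<and> i = i'" by simp
  qed
  \<comment> \<open>The original representation shows that \<open>f\<close> is not identically zero,
    which makes the expanded index set nonempty.\<close>
  obtain z0 where z0: "f z0 \<noteq> 0"
    using exp_sum_index_bound(1)[of "{..n}" 0 P Q] dat f_sum by auto
  have Ine: "I \<noteq> {}" using z0 f_sum' by (auto simp: exp_sum_def)
  have 1: "nev_proximity (\<lambda>z. 1 / f z) \<in> O[at_top](\<lambda>r. r ^ d + ln r)" if H0: "H 0 \<noteq> (\<lambda>z. 0)"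
  proof -
    \<comment> \<open>As \<open>w 0 = 0\<close>, every exponent in the group of index 0 has degree
      at most \<open>d\<close>; any one of them serves for (i).\<close>
    have x: "(0, 0) \<in> I" using H0 by (auto simp: I_def J_def)
    have "degree (Q' (0, 0)) \<le> d" using AB(3)[of 0 0] x nf(2) by (simp add: Q'_def I_def)
    with exp_sum_proximity[of I "(0, 0)" P' Q' d] I x P' Q'inj Q'0
    show ?thesis unfolding f_sum' by blast
  qed
  have 2: "nev_proximity (\<lambda>z. 1 / f z) \<in> O[at_top](\<lambda>r. ln r)" if Q0: "Q 0 = 0"
  proof (rule nev_proximity_bigo)
    show "circle_mean_bound (\<lambda>z. log_plus (norm (1 / f z))) ln"
      \<comment> \<open>With \<open>Q 0 = 0\<close> the numerator \<open>exp (Q 0)\<close> is 1, so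
        the index bound in the given representation is already the claim.\<close>
      using exp_sum_index_bound(2)[of "{..n}" 0 P Q] dat Q0 unfolding f_sum by simp
    show "eventually (\<lambda>r::real. ln r \<ge> 0) at_top"
      using eventually_ge_at_top[of 1] by eventually_elim simp
  qed
  have V: "(\<lambda>x. cnj (w (fst x))) ` I = conj_leading_set m H w"
  proof -
    have "fst ` I = J" by (force simp: I_def)
    then have "(\<lambda>x. cnj (w (fst x))) ` I = (\<lambda>j. cnj (w j)) ` J" by (metis image_image)
    also have "\<dots> = conj_leading_set m H w"
    proof (cases "H 0 = (\<lambda>z. 0)")
      case True
      have "J = {1..m}"
      proof (intro equalityI subsetI)
        fix j assume "j \<in> J"
        then show "j \<in> {1..m}" using True by (cases "j = 0") (auto simp: J_def)
      qed (use nf(4) in \<open>auto simp: J_def\<close>)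
      then show ?thesis using True by (simp add: conj_leading_set_def)
    next
      case False
      have "J = insert 0 {1..m}"
      proof (intro equalityI subsetI)
        fix j assume "j \<in> J"
        then show "j \<in> insert 0 {1..m}" by (auto simp: J_def)
      next
        fix j assume "j \<in> insert 0 {1..m}"
        then show "j \<in> J" using nf(4)[of j] False by (cases "j = 0") (auto simp: J_def)
      qed
      then show ?thesis using False nf(2) by (simp add: conj_leading_set_def)
    qed
    finally show ?thesis .
  qed
  have "(\<lambda>r. nev_counting (\<lambda>z. 1 / exp_sum I P' Q' z) r -
      circumference (convex hull ((\<lambda>x. cnj (w (fst x))) ` I)) * (r ^ q / (2 * pi))) \<in> O[at_top](\<lambda>r. r ^ d + ln r)"
    by (rule exp_sum_counting[OF I Ine P' Q'inj Q'0, where L = "\<lambda>x. B (fst x) (snd x)"])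
       (use AB(3) assms(4) in \<open>auto simp: Q'_def I_def\<close>)
  then have 3: "(\<lambda>r. nev_counting (\<lambda>z. 1 / f z) r -
      circumference (convex hull (conj_leading_set m H w)) * (r ^ q / (2 * pi))) \<in> O[at_top](\<lambda>r. r ^ d + ln r)"
    by (simp only: V f_sum'[symmetric])
  from 1 2 3 show ?thesis unfolding d_def by blast
qed

end
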